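(* Let $G$, $H_0$, $V$, $H=H_0+V$, $R(\kappa)=(H+\kappa^2)^{-1}$ be as in the context, and assume that $V$ satisfies the assumption $(\mathrm A_\beta)$ of the context for some integer $\beta\ge 4$. Assume that the threshold $0$ is an exceptional point of the second kind, i.e. $\mathcal E=\mathsf E\supsetneq\{0\}$. Then, as $\kappa\to0$ with $\mathop{\mathrm{Re}}\kappa>0$, $$R(\kappa)=\sum_{j=-2}^{\beta-6}\kappa^jG_j+\mathcal O(\kappa^{\beta-5})\quad\text{in }\mathcal B^{\beta-2},$$ with $G_j\in\mathcal B^{j+3}$ for $j$ even and $G_j\in\mathcal B^{j+2}$ for $j$ odd. In particular, the coefficients of $\kappa^{-2}$ and $\kappa^{-1}$ (whenever they occur in the expansion) satisfy $G_{-2}=\mathsf P\ne0$ and $G_{-1}=\mathcal P=0$.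
   Context: Graph. Let $(K,E_0)$ be a connected, finite, undirected, simple graph (no loops, no multiple edges), and for $\alpha=1,\dots,N$ let $(L_\alpha,E_\alpha)$ be a copy of the discrete half-line, $L_\alpha=\{1,2,\dots\}$, $E_\alpha=\{\{n,n+1\}: n\in L_\alpha\}$. Fix vertices $x_1,\dots,x_N\in K$ (not necessarily distinct). Let $G=K\cup L_1\cup\dots\cup L_N$ (disjoint union), with edges those of $E_0,E_1,\dots,E_N$ together with $\{x_\alpha,1^{(\alpha)}\}$, $\alpha=1,\dots,N$, where $1^{(\alpha)}$ is the point $1\in L_\alpha$. Free operator. For $u\colon K\to\mathbb C$ set $(h_0u)[x]=\sum_{y\in K,\{x,y\}\in E_0}(u[x]-u[y])+\sum_{\alpha=1}^Ns_\alpha[x]u[x]$, where $s_\alpha[x]=1$ if $x=x_\alpha$ and $0$ otherwise. For $u\colon L_\alpha\to\mathbb C$ set $(h_\alpha u)[1]=2u[1]-u[2]$ and $(h_\alpha u)[n]=2u[n]-u[n+1]-u[n-1]$ for $n\ge2$. Let $H_0=h_0\oplus h_1\oplus\dots\oplus h_N$, acting on all functions on $G$ decomposed as functions on $K,L_1,\dots,L_N$; on $\mathcal H=\ell^2(G)$ it is bounded and self-adjoint. Spaces. For $s\in\mathbb R$, $\mathcal L^s=\ell^{1,s}(G)$ is the space of $u\colon G\to\mathbb C$ with $\sum_{x\in K}|u[x]|+\sum_{\alpha}\sum_{n\in L_\alpha}(1+n^2)^{s/2}|u[n]|<\infty$; its dual $(\mathcal L^s)^*=\ell^{\infty,-s}(G)$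 is the space of $u$ with $\sup_{x\in K}|u[x]|<\infty$ and $\sup_{n\in L_\alpha}(1+n^2)^{-s/2}|u[n]|<\infty$ for all $\alpha$. Put $\mathcal B^s=\mathcal B(\mathcal L^s,(\mathcal L^s)^* )$. $\langle u,w\rangle=\sum_{x\in G}\overline{u[x]}w[x]$ whenever this converges absolutely, and $|\Psi\rangle\langle\Phi|$ is the operator $u\mapsto\langle\Phi,u\rangle\Psi$. $(\Phi\cdot\Psi)[x]=\Phi[x]\Psi[x]$ is the pointwise product. Assumption $(\mathrm A_\beta)$, $\beta\ge1$: $V\in\mathcal B(\mathcal H)$ is self-adjoint, and there exist a Hilbert space $\mathcal K$, an injective operator $v\in\mathcal B(\mathcal K,\mathcal L^\beta)$ and a self-adjoint unitary operator $U\in\mathcal B(\mathcal K)$ such that $V=vUv^*\in\mathcal B((\mathcal L^\beta)^*,\mathcal L^\beta)$. Put $H=H_0+V$ and $R(\kappa)=(H+\kappa^2)^{-1}$ for $-\kappa^2\notin\sigma(H)$. Eigenspaces. Let $\mathbf n^{(\alpha)}[x]=m$ if $x=m\in L_\alpha$ and $0$ otherwise; $\mathbf 1^{(\alpha)}[x]=1$ if $x\in L_\alpha$ and $0$ otherwise; $\mathbb C\mathbf n=\bigoplus_\alpha\mathbb C\mathbf n^{(\alpha)}$, $\mathbb C\mathbf 1=\bigoplus_\alpha\mathbb C\mathbf 1^{(\alpha)}$. Define $\widetilde{\mathcal E}=\{\Psi\in(\mathcal L^\beta)^*: H\Psi=0\}$, $\mathcal E=\widetilde{\mathcal E}\cap(\mathbb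 C\mathbf 1\oplus\mathcal L^{\beta-2})$, $\mathsf E=\widetilde{\mathcal E}\cap\mathcal L^{\beta-2}$. Projections. A set $\{\Psi_\gamma\}\subset\mathcal E$ is an orthonormal resonance basis if the classes $[\Psi_\gamma]$ form a basis of $\mathcal E/\mathsf E$, for every $\gamma$ and $\Psi\in\mathsf E$ one has $\overline\Psi\cdot\Psi_\gamma\in\mathcal L^0$ and $\langle\Psi,\Psi_\gamma\rangle=0$, and there is an orthonormal system $\{c^{(\gamma)}\}\subset\mathbb C^N$ with $\Psi_\gamma-\sum_\alpha c^{(\gamma)}_\alpha\mathbf 1^{(\alpha)}\in\mathcal L^{\beta-2}$ for every $\gamma$. The orthogonal resonance projection is $\mathcal P=\sum_\gamma|\Psi_\gamma\rangle\langle\Psi_\gamma|$. A basis $\{\Psi_\gamma\}$ of $\mathsf E$ is an orthonormal bound basis if $\overline{\Psi_{\gamma'}}\cdot\Psi_\gamma\in\mathcal L^0$ and $\langle\Psi_{\gamma'},\Psi_\gamma\rangle=\delta_{\gamma\gamma'}$; the orthogonal bound projection is $\mathsf P=\sum_\gamma|\Psi_\gamma\rangle\langle\Psi_\gamma|$. Both are independent of the choice of bases (and are $0$ if the corresponding basis is empty). *)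

theory Defs
  imports "HOL-Analysis.Analysis" "HOL-Library.Landau_Symbols"
begin

text \<open>
  The library has no complex Hilbert spaces. As in the definition of the pairing on functions
  below, inner products are antilinear in the first and linear in the second argument.
\<close>

class complex_hilbert = banach +
  fixes scaleC :: "complex \<Rightarrow> 'a \<Rightarrow> 'a"
    and cinner :: "'a \<Rightarrow> 'a \<Rightarrow> complex"
  assumes scaleC_add_right: "scaleC a (x + y) = scaleC a x + scaleC a y"
    and scaleC_add_left: "scaleC (a + b) x = scaleC a x + scaleC b x"
    and scaleC_scaleC: "scaleC a (scaleC b x) = scaleC (a * b) x"
    and scaleR_scaleC: "scaleR r x = scaleC (complex_of_real r) x"
    and cinner_commute: "cinner x y = cnj (cinner y x)"
    and cinner_add_right: "cinner x (y + z) = cinner x y + cinner x z"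
    and cinner_scaleC_right: "cinner x (scaleC a y) = a * cinner x y"
    and cinner_self: "cinner x x = complex_of_real ((norm x)\<^sup>2)"

text \<open>
  Vertices of the graph \<open>G = K \<union> L\<^sub>1 \<union> \<dots> \<union> L\<^sub>N\<close>. The finite graph \<open>K\<close> is the whole type \<open>'k\<close>,
  and the rays are indexed by the finite type \<open>'r\<close>, so \<open>N = CARD('r)\<close>.
  Since \<open>nat\<close> starts at \<open>0\<close>, \<open>Ray \<alpha> n\<close> stands for the point \<open>n + 1\<close> of \<open>L\<^sub>\<alpha> = {1, 2, \<dots>}\<close>.
\<close>

datatype ('k, 'r) gvert = Core 'k | Ray 'r nat

type_synonym ('k, 'r) gfun = "('k, 'r) gvert \<Rightarrow> complex"
type_synonym ('k, 'r) gop = "('k, 'r) gfun \<Rightarrow> ('k, 'r) gfun"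

definition connected_simple_graph :: "'k set set \<Rightarrow> bool" where
  "connected_simple_graph E \<longleftrightarrow>
     (\<forall>e\<in>E. card e = 2) \<and> (\<forall>x y. (x, y) \<in> {(a, b). {a, b} \<in> E}\<^sup>*)"

text \<open>
  The free operator, for the edge set \<open>E\<close> of \<open>K\<close> and the map \<open>b\<close> sending \<open>\<alpha>\<close> to the base vertex
  \<open>x\<^sub>\<alpha>\<close> of the ray \<open>L\<^sub>\<alpha>\<close>. It is decoupled: the joining edges \<open>{x\<^sub>\<alpha>, 1}\<close> enter only through the
  Dirichlet terms at \<open>x\<^sub>\<alpha>\<close> and at the point \<open>1\<close> of \<open>L\<^sub>\<alpha>\<close>.
\<close>

definition h_core :: "'k::finite set set \<Rightarrow> ('r::finite \<Rightarrow> 'k) \<Rightarrow> ('k \<Rightarrow> complex) \<Rightarrow> 'k \<Rightarrow> complex" where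
  "h_core E b u x =
     (\<Sum>y\<in>{y. {x, y} \<in> E}. u x - u y) + (\<Sum>\<alpha>\<in>UNIV. (if x = b \<alpha> then 1 else 0) * u x)"

fun h_ray :: "(nat \<Rightarrow> complex) \<Rightarrow> nat \<Rightarrow> complex" where
  "h_ray u 0 = 2 * u 0 - u 1"
| "h_ray u (Suc n) = 2 * u (Suc n) - u (Suc (Suc n)) - u n"

fun H_free :: "'k::finite set set \<Rightarrow> ('r::finite \<Rightarrow> 'k) \<Rightarrow> ('k, 'r) gop" where
  "H_free E b u (Core x) = h_core E b (\<lambda>y. u (Core y)) x"
| "H_free E b u (Ray \<alpha> n) = h_ray (\<lambda>m. u (Ray \<alpha> m)) n"

definition H_full :: "'k::finite set set \<Rightarrow> ('r::finite \<Rightarrow> 'k) \<Rightarrow> ('k, 'r) gop \<Rightarrow> ('k, 'r) gop" where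
  "H_full E b V u = (\<lambda>x. H_free E b u x + V u x)"

record 'v fspace =
  fset :: "('v \<Rightarrow> complex) set"
  fnorm :: "('v \<Rightarrow> complex) \<Rightarrow> real"

text \<open>\<open>weight s x\<close> is \<open>(1 + n\<^sup>2)\<^bsup>s/2\<^esup>\<close> at the point \<open>n\<close> of a ray, and \<open>1\<close> on \<open>K\<close>.\<close>

fun weight :: "real \<Rightarrow> ('k, 'r) gvert \<Rightarrow> real" where
  "weight s (Core x) = 1"
| "weight s (Ray \<alpha> n) = (1 + (real (Suc n))\<^sup>2) powr (s / 2)"

definition ell1 :: "real \<Rightarrow> ('k::finite, 'r::finite) gvert fspace" where
  "ell1 s = \<lparr> fset = {u. (\<lambda>x. weight s x * cmod (u x)) summable_on UNIV},
              fnorm = (\<lambda>u. \<Sum>\<^sub>\<infinity>x. weight s x * cmod (u x)) \<rparr>"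

definition ellinf :: "real \<Rightarrow> ('k::finite, 'r::finite) gvert fspace" where
  "ellinf s = \<lparr> fset = {u. bdd_above (range (\<lambda>x. weight s x * cmod (u x)))},
                fnorm = (\<lambda>u. SUP x. weight s x * cmod (u x)) \<rparr>"

definition ell2 :: "('k::finite, 'r::finite) gvert fspace" where
  "ell2 = \<lparr> fset = {u. (\<lambda>x. (cmod (u x))\<^sup>2) summable_on UNIV},
            fnorm = (\<lambda>u. sqrt (\<Sum>\<^sub>\<infinity>x. (cmod (u x))\<^sup>2)) \<rparr>"

text \<open>
  An operator is a function on all of \<open>'v \<Rightarrow> complex\<close>, but only its values on the relevant domain
  are constrained; two operators are identified when they agree there.
\<close>

definition bounded_ops ::
    "'v fspace \<Rightarrow> 'v fspace \<Rightarrow> (('v \<Rightarrow> complex) \<Rightarrow> 'v \<Rightarrow> complex) set" where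
  "bounded_ops X Y = {A.
     (\<forall>u\<in>fset X. A u \<in> fset Y) \<and>
     (\<forall>u\<in>fset X. \<forall>w\<in>fset X. \<forall>a c. A (\<lambda>x. a * u x + c * w x) = (\<lambda>x. a * A u x + c * A w x)) \<and>
     (\<exists>C. \<forall>u\<in>fset X. fnorm Y (A u) \<le> C * fnorm X u)}"

definition op_norm ::
    "'v fspace \<Rightarrow> 'v fspace \<Rightarrow> (('v \<Rightarrow> complex) \<Rightarrow> 'v \<Rightarrow> complex) \<Rightarrow> real" where
  "op_norm X Y A = (SUP u\<in>{u\<in>fset X. fnorm X u \<le> 1}. fnorm Y (A u))"

definition Bs :: "real \<Rightarrow> ('k::finite, 'r::finite) gop set" where
  "Bs s = bounded_ops (ell1 s) (ellinf (- s))"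

definition Bs_norm :: "real \<Rightarrow> ('k::finite, 'r::finite) gop \<Rightarrow> real" where
  "Bs_norm s = op_norm (ell1 s) (ellinf (- s))"

definition pairing :: "('v \<Rightarrow> complex) \<Rightarrow> ('v \<Rightarrow> complex) \<Rightarrow> complex" where
  "pairing u w = (\<Sum>\<^sub>\<infinity>x. cnj (u x) * w x)"

definition self_adjoint_ell2 :: "('k::finite, 'r::finite) gop \<Rightarrow> bool" where
  "self_adjoint_ell2 A \<longleftrightarrow>
     A \<in> bounded_ops ell2 ell2 \<and> (\<forall>u\<in>fset ell2. \<forall>w\<in>fset ell2. pairing u (A w) = pairing (A u) w)"

definition bounded_from_hilbert ::
    "'v fspace \<Rightarrow> ('h::complex_hilbert \<Rightarrow> 'v \<Rightarrow> complex) \<Rightarrow> bool" where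
  "bounded_from_hilbert X v \<longleftrightarrow>
     (\<forall>f. v f \<in> fset X) \<and>
     (\<forall>f g. v (f + g) = (\<lambda>x. v f x + v g x)) \<and>
     (\<forall>a f. v (scaleC a f) = (\<lambda>x. a * v f x)) \<and>
     (\<exists>C. \<forall>f. fnorm X (v f) \<le> C * norm f)"

text \<open>The adjoint, acting on those \<open>\<Phi>\<close> that pair with the target space of \<open>v\<close>.\<close>

definition hilbert_adj ::
    "('h::complex_hilbert \<Rightarrow> 'v \<Rightarrow> complex) \<Rightarrow> ('v \<Rightarrow> complex) \<Rightarrow> 'h" where
  "hilbert_adj v \<Phi> = (THE k. \<forall>f. cinner k f = pairing \<Phi> (v f))"

definition self_adjoint_unitary :: "('h::complex_hilbert \<Rightarrow> 'h) \<Rightarrow> bool" where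
  "self_adjoint_unitary U \<longleftrightarrow>
     bounded_linear U \<and> (\<forall>a f. U (scaleC a f) = scaleC a (U f)) \<and>
     (\<forall>f g. cinner (U f) g = cinner f (U g)) \<and>
     surj U \<and> (\<forall>f g. cinner (U f) (U g) = cinner f g)"

text \<open>
  Assumption \<open>(A\<^sub>\<beta>)\<close> with the auxiliary Hilbert space carried by the type \<open>'h\<close>. A theorem assuming
  this for a type variable \<open>'h\<close> assumes that some auxiliary Hilbert space exists.
\<close>

definition assumption_A ::
    "'h::complex_hilbert itself \<Rightarrow> real \<Rightarrow> ('k::finite, 'r::finite) gop \<Rightarrow> bool" where
  "assumption_A _ \<beta> V \<longleftrightarrow>
     self_adjoint_ell2 V \<and>
     V \<in> bounded_ops (ellinf (- \<beta>)) (ell1 \<beta>) \<and>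
     (\<exists>(v :: 'h \<Rightarrow> ('k, 'r) gfun) U.
        bounded_from_hilbert (ell1 \<beta>) v \<and> inj v \<and> self_adjoint_unitary U \<and>
        (\<forall>\<Phi>\<in>fset (ellinf (- \<beta>)). V \<Phi> = v (U (hilbert_adj v \<Phi>))))"

definition spectrum_ell2 :: "('k::finite, 'r::finite) gop \<Rightarrow> complex set" where
  "spectrum_ell2 A = {z. \<not> (\<exists>B\<in>bounded_ops ell2 ell2. \<forall>u\<in>fset ell2.
     B (\<lambda>x. A u x - z * u x) = u \<and> (\<lambda>x. A (B u) x - z * B u x) = u)}"

definition resolvent :: "('k::finite, 'r::finite) gop \<Rightarrow> complex \<Rightarrow> ('k, 'r) gop" where
  "resolvent A \<kappa> = inv_into (fset ell2) (\<lambda>w x. A w x + \<kappa>\<^sup>2 * w x)"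

fun one_ray :: "'r \<Rightarrow> ('k, 'r) gfun" where
  "one_ray \<alpha> (Core x) = 0"
| "one_ray \<alpha> (Ray \<gamma> n) = (if \<gamma> = \<alpha> then 1 else 0)"

text \<open>The spaces \<open>\<E>\<close> with tilde, \<open>\<E>\<close>, and upright \<open>E\<close>, respectively.\<close>

definition gen_eigenspace :: "real \<Rightarrow> ('k::finite, 'r::finite) gop \<Rightarrow> ('k, 'r) gfun set" where
  "gen_eigenspace \<beta> H = {\<Psi>\<in>fset (ellinf (- \<beta>)). \<forall>x. H \<Psi> x = 0}"

definition res_eigenspace :: "real \<Rightarrow> ('k::finite, 'r::finite) gop \<Rightarrow> ('k, 'r) gfun set" where
  "res_eigenspace \<beta> H = gen_eigenspace \<beta> H \<inter>
     {\<Psi>. \<exists>c. (\<lambda>x. \<Psi> x - (\<Sum>\<alpha>\<in>UNIV. c \<alpha> * one_ray \<alpha> x)) \<in> fset (ell1 (\<beta> - 2))}"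

definition bound_eigenspace :: "real \<Rightarrow> ('k::finite, 'r::finite) gop \<Rightarrow> ('k, 'r) gfun set" where
  "bound_eigenspace \<beta> H = gen_eigenspace \<beta> H \<inter> fset (ell1 (\<beta> - 2))"

definition exceptional_second_kind :: "real \<Rightarrow> ('k::finite, 'r::finite) gop \<Rightarrow> bool" where
  "exceptional_second_kind \<beta> H \<longleftrightarrow>
     res_eigenspace \<beta> H = bound_eigenspace \<beta> H \<and> {\<lambda>x. 0} \<subset> bound_eigenspace \<beta> H"

text \<open>\<open>B\<close> is a finite set of representatives of a basis of the quotient \<open>W / W\<^sub>0\<close>.\<close>

definition basis_mod ::
    "('v \<Rightarrow> complex) set \<Rightarrow> ('v \<Rightarrow> complex) set \<Rightarrow> ('v \<Rightarrow> complex) set \<Rightarrow> bool" where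
  "basis_mod W W\<^sub>0 B \<longleftrightarrow>
     finite B \<and> B \<subseteq> W \<and>
     (\<forall>a. (\<lambda>x. \<Sum>\<Phi>\<in>B. a \<Phi> * \<Phi> x) \<in> W\<^sub>0 \<longrightarrow> (\<forall>\<Phi>\<in>B. a \<Phi> = 0)) \<and>
     (\<forall>\<Psi>\<in>W. \<exists>a. (\<lambda>x. \<Psi> x - (\<Sum>\<Phi>\<in>B. a \<Phi> * \<Phi> x)) \<in> W\<^sub>0)"

definition orthonormal_resonance_basis ::
    "real \<Rightarrow> ('k::finite, 'r::finite) gop \<Rightarrow> ('k, 'r) gfun set \<Rightarrow> bool" where
  "orthonormal_resonance_basis \<beta> H B \<longleftrightarrow>
     basis_mod (res_eigenspace \<beta> H) (bound_eigenspace \<beta> H) B \<and>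
     (\<forall>\<Phi>\<in>B. \<forall>\<Psi>\<in>bound_eigenspace \<beta> H.
        (\<lambda>x. cnj (\<Psi> x) * \<Phi> x) \<in> fset (ell1 0) \<and> pairing \<Psi> \<Phi> = 0) \<and>
     (\<exists>c :: ('k, 'r) gfun \<Rightarrow> 'r \<Rightarrow> complex.
        (\<forall>\<Phi>\<in>B. \<forall>\<Phi>'\<in>B. (\<Sum>\<alpha>\<in>UNIV. cnj (c \<Phi> \<alpha>) * c \<Phi>' \<alpha>) = (if \<Phi> = \<Phi>' then 1 else 0)) \<and>
        (\<forall>\<Phi>\<in>B. (\<lambda>x. \<Phi> x - (\<Sum>\<alpha>\<in>UNIV. c \<Phi> \<alpha> * one_ray \<alpha> x)) \<in> fset (ell1 (\<beta> - 2))))"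

definition orthonormal_bound_basis ::
    "real \<Rightarrow> ('k::finite, 'r::finite) gop \<Rightarrow> ('k, 'r) gfun set \<Rightarrow> bool" where
  "orthonormal_bound_basis \<beta> H B \<longleftrightarrow>
     basis_mod (bound_eigenspace \<beta> H) {\<lambda>x. 0} B \<and>
     (\<forall>\<Phi>\<in>B. \<forall>\<Phi>'\<in>B.
        (\<lambda>x. cnj (\<Phi>' x) * \<Phi> x) \<in> fset (ell1 0) \<and>
        pairing \<Phi>' \<Phi> = (if \<Phi>' = \<Phi> then 1 else 0))"

text \<open>
  The sum of \<open>|\<Psi>\<rangle>\<langle>\<Psi>|\<close> over \<open>\<Psi> \<in> B\<close>: the orthogonal resonance, respectively bound, projection when
  \<open>B\<close> is an orthonormal resonance, respectively bound, basis.
\<close>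

definition ket_bra_sum :: "('v \<Rightarrow> complex) set \<Rightarrow> ('v \<Rightarrow> complex) \<Rightarrow> 'v \<Rightarrow> complex" where
  "ket_bra_sum B u = (\<lambda>x. \<Sum>\<Psi>\<in>B. pairing \<Psi> u * \<Psi> x)"

definition expansion_remainder ::
    "('k::finite, 'r::finite) gop \<Rightarrow> (int \<Rightarrow> ('k, 'r) gop) \<Rightarrow> int \<Rightarrow> int \<Rightarrow> complex \<Rightarrow> ('k, 'r) gop"
  where
  "expansion_remainder H G l m \<kappa> u =
     (\<lambda>x. resolvent H \<kappa> u x - (\<Sum>j\<in>{l..m}. \<kappa> powi j * G j u x))"

text \<open>
  \<open>A\<close> agrees on \<open>\<L>\<^sup>s\<close> with the orthogonal projection given by a basis of the kind \<open>is_basis\<close>: such a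
  basis exists, and every choice of it gives \<open>A\<close>.
\<close>

definition equals_projection ::
    "real \<Rightarrow> (('k::finite, 'r::finite) gfun set \<Rightarrow> bool) \<Rightarrow> ('k, 'r) gop \<Rightarrow> bool" where
  "equals_projection s is_basis A \<longleftrightarrow>
     (\<exists>B. is_basis B) \<and> (\<forall>B. is_basis B \<longrightarrow> (\<forall>u\<in>fset (ell1 s). A u = ket_bra_sum B u))"

end

theory Submission
  imports Defs "HOL-Complex_Analysis.Complex_Analysis"
begin

text \<open>
  If \<open>P\<close> is the orthogonal projection onto the bound eigenspace, \<open>H + P\<close> has no threshold
  eigenfunctions left: in the exceptional case of the second kind the only obstruction at \<open>0\<close> was the
  eigenspace that \<open>P\<close> shifts to the eigenvalue \<open>1\<close>. Since \<open>H\<close> and \<open>P\<close> commute,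
  \<open>R(\<kappa>) = (H + P + \<kappa>\<^sup>2)\<^sup>-\<^sup>1 + (\<kappa>\<^sup>-\<^sup>2 - (1 + \<kappa>\<^sup>2)\<^sup>-\<^sup>1) P\<close>, so everything singular in the expansion is \<open>\<kappa>\<^sup>-\<^sup>2 P\<close>, and
  in particular the term of order \<open>\<kappa>\<^sup>-\<^sup>1\<close> vanishes.

  Write \<open>H + P = D + A\<close>, where \<open>D\<close> is the free operator on the rays and the identity on the core.
  The resolvent kernel of \<open>D\<close> on a ray is a sum of \<open>min(n, m)\<close> powers \<open>z\<^sup>p\<close> with \<open>p < n + m\<close>, where
  \<open>z + 1/z = 2 + \<kappa>\<^sup>2\<close>; Cauchy's inequalities on a disc of radius \<open>1/(n + m)\<close> give its expansion in powers
  of \<open>\<kappa>\<close> with the required weights. Since \<open>V = v U v\<^sup>*\<close> is compact, \<open>1 + G\<^sub>0 A\<close> is a Fredholm operator on a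
  weighted \<open>\<ell>\<^sup>\<infinity>\<close> space, and its kernel is trivial, so it is invertible. Hence \<open>1 + R\<^sub>0(\<kappa>) A\<close> is uniformly
  invertible for small \<open>\<kappa>\<close>, and the expansion of \<open>(H + P + \<kappa>\<^sup>2)\<^sup>-\<^sup>1 = (1 + R\<^sub>0(\<kappa>) A)\<^sup>-\<^sup>1 R\<^sub>0(\<kappa>)\<close> follows from that of
  \<open>R\<^sub>0(\<kappa>)\<close> by comparing coefficients.
\<close>

section \<open>Absolutely convergent sums\<close>

text \<open>Two weights compete. Bound states are only known to have weight s = \<beta> - 2, so P
  and H + P live there, while V maps into weight s + 2. The surplus is spent once: a solution of u +
  G_0 A u = 0 must be constant on each ray up to an error of weight s, and the tail sum for that
  error costs two powers. P u lacks this surplus, so P u = 0 is proved before, by pairing the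
  equation with bound states; the same pairing replaces the commutation of H and P on functions
  outside l^2. The free kernel is holomorphic on a full disc, although the operator exists only for
  Re \<kappa> > 0. Powers of z grow on the other side, so the disc on which they stay bounded
  shrinks with the distance along the rays. Each order in \<kappa> thus costs one weight on either
  side; the first-order estimate behind the uniform inverse requires s \<ge> 2, that is \<beta>
  \<ge> 4. The expansion uses the duality of weighted l^1 and l^infinity, but the resolvent is
  defined on l^2; the inverse is carried back by writing it as the free resolvent of an l^2
  function.\<close>

lemma summable_on_nonneg_bounded:
  fixes f :: "'a \<Rightarrow> real"
  assumes "\<And>x. 0 \<le> f x" "\<And>F. finite F \<Longrightarrow> sum f F \<le> C"
  shows "f summable_on UNIV" "(\<Sum>\<^sub>\<infinity>x. f x) \<le> C"
proof -
  show *: "f summable_on UNIV"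
    by (rule nonneg_bdd_above_summable_on) (use assms in \<open>auto intro!: bdd_aboveI2[where M=C]\<close>)
  show "(\<Sum>\<^sub>\<infinity>x. f x) \<le> C"
    by (rule infsum_le_finite_sums[OF *]) (use assms in auto)
qed

lemma summable_on_dominated:
  fixes f :: "'a \<Rightarrow> 'b::banach" and g :: "'a \<Rightarrow> real"
  assumes "g summable_on UNIV" "\<And>x. norm (f x) \<le> g x"
  shows "f summable_on UNIV"
proof -
  have "(\<lambda>x. norm (f x)) summable_on UNIV"
    by (rule summable_on_comparison_test[OF assms(1)]) (use assms in auto)
  then show ?thesis by (rule abs_summable_summable)
qed

lemma norm_infsum_dominated:
  fixes f :: "'a \<Rightarrow> 'b::banach" and g :: "'a \<Rightarrow> real"
  assumes "g summable_on UNIV" "\<And>x. norm (f x) \<le> g x"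
  shows "norm (\<Sum>\<^sub>\<infinity>x. f x) \<le> (\<Sum>\<^sub>\<infinity>x. g x)"
  using norm_infsum_le[OF has_sum_infsum[OF summable_on_dominated[OF assms]] has_sum_infsum[OF assms(1)]]
    assms(2) by auto

section \<open>Weighted spaces\<close>

text \<open>Since \<beta> is an integer, every weight that occurs is a natural power of this single
  function; real exponents disappear with \<open>weight_of_nat\<close> and
  \<open>weight_minus_of_nat\<close>.\<close>

definition om :: "('k, 'r) gvert \<Rightarrow> real" where "om x = weight 1 x"

lemma om_Core [simp]: "om (Core x) = 1"
  and om_Ray: "om (Ray a n) = sqrt (1 + (real (Suc n))\<^sup>2)"
  by (simp_all add: om_def powr_half_sqrt)

lemma om_ge_1: "1 \<le> om x"
  by (cases x) (auto simp: om_Ray)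

lemma om_gt_0 [simp]: "0 < om x" and om_ge_0 [simp]: "0 \<le> om x" and om_neq_0 [simp]: "om x \<noteq> 0"
  using om_ge_1[of x] by linarith+

lemma om_pow_ge_1: "1 \<le> om x ^ s"
  by (simp add: om_ge_1)

lemma om_pow_mono: "s \<le> t \<Longrightarrow> om x ^ s \<le> om x ^ t"
  by (rule power_increasing[OF _ om_ge_1])

lemma om_Ray_ge: "real n + 1 \<le> om (Ray a n)"
  unfolding om_Ray by (rule real_le_rsqrt) (simp add: power2_eq_square algebra_simps)

lemma om_Ray_mono: "n \<le> m \<Longrightarrow> om (Ray a n) \<le> om (Ray a m)"
  unfolding om_Ray by (simp add: power_mono)

lemma om_Ray_Suc_le: "om (Ray a (Suc n)) \<le> 2 * om (Ray a n)"
proof -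
  have "1 + (real (Suc (Suc n)))\<^sup>2 \<le> 4 * (1 + (real (Suc n))\<^sup>2)"
    by (simp add: power2_eq_square algebra_simps)
  then have "sqrt (1 + (real (Suc (Suc n)))\<^sup>2) \<le> sqrt (4 * (1 + (real (Suc n))\<^sup>2))"
    by (simp only: real_sqrt_le_iff)
  also have "\<dots> = 2 * sqrt (1 + (real (Suc n))\<^sup>2)"
    by (subst real_sqrt_mult) simp
  finally show ?thesis unfolding om_Ray .
qed

lemma weight_eq_om_powr: "weight s x = om x powr s"
proof (cases x)
  case (Ray a n)
  have "(0::real) < 1 + (real (Suc n))\<^sup>2" by (simp add: add_pos_nonneg)
  then show ?thesis using Ray by (simp add: om_def powr_powr)
qed simp

lemma weight_of_nat: "weight (real s) x = om x ^ s"
  by (simp add: weight_eq_om_powr powr_realpow)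

lemma weight_minus_of_nat: "weight (- real s) x = inverse (om x ^ s)"
  by (simp add: weight_eq_om_powr powr_minus powr_realpow)

abbreviation L1 :: "nat \<Rightarrow> ('k::finite, 'r::finite) gvert fspace" where
  "L1 s \<equiv> ell1 (real s)"

abbreviation Linf :: "nat \<Rightarrow> ('k::finite, 'r::finite) gvert fspace" where
  "Linf s \<equiv> ellinf (- real s)"

lemma ell1_iff: "u \<in> fset (L1 s) \<longleftrightarrow> (\<lambda>x. om x ^ s * cmod (u x)) summable_on UNIV"
  by (simp add: ell1_def weight_of_nat)

lemma fnorm_ell1: "fnorm (L1 s) u = (\<Sum>\<^sub>\<infinity>x. om x ^ s * cmod (u x))"
  by (simp add: ell1_def weight_of_nat)

text \<open>One bound on finite partial sums yields both membership and the norm, so the l^1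
  estimates are made for finite sums only.\<close>

lemma ell1_I:
  assumes "\<And>F. finite F \<Longrightarrow> (\<Sum>x\<in>F. om x ^ s * cmod (u x)) \<le> C"
  shows "u \<in> fset (L1 s)" "fnorm (L1 s) u \<le> C"
  unfolding ell1_iff fnorm_ell1
  using summable_on_nonneg_bounded[of "\<lambda>x. om x ^ s * cmod (u x)" C] assms by auto

lemma ell1_finite_sum_le:
  assumes "u \<in> fset (L1 s)" "finite F"
  shows "(\<Sum>x\<in>F. om x ^ s * cmod (u x)) \<le> fnorm (L1 s) u"
  unfolding fnorm_ell1
  by (rule finite_sum_le_infsum) (use assms in \<open>auto simp: ell1_iff\<close>)

lemma ellinf_I:
  fixes u :: "('k::finite, 'r::finite) gfun"
  assumes "\<And>x. cmod (u x) \<le> C * om x ^ s"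
  shows "u \<in> fset (Linf s)" "fnorm (Linf s) u \<le> C"
proof -
  have *: "inverse (om x ^ s) * cmod (u x) \<le> C" for x
    using assms[of x] by (simp add: divide_simps)
  show "u \<in> fset (Linf s)"
    unfolding ellinf_def weight_minus_of_nat using * by (auto intro!: bdd_aboveI2[where M=C])
  show "fnorm (Linf s) u \<le> C"
    unfolding ellinf_def weight_minus_of_nat using * by (auto intro!: cSUP_least)
qed

lemma ellinf_pointwise:
  assumes "u \<in> fset (Linf s)"
  shows "cmod (u x) \<le> fnorm (Linf s) u * om x ^ s"
proof -
  have "weight (- real s) x * cmod (u x) \<le> (SUP x. weight (- real s) x * cmod (u x))"
    by (rule cSUP_upper) (use assms in \<open>auto simp: ellinf_def\<close>)
  then show ?thesis unfolding ellinf_def weight_minus_of_nat by (simp add: divide_simps)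
qed

lemma ellinf_iff:
  "u \<in> fset (Linf s) \<longleftrightarrow> (\<exists>C. \<forall>x. cmod (u x) \<le> C * om x ^ s)"
  using ellinf_I ellinf_pointwise by blast

lemma ell2_iff: "u \<in> fset ell2 \<longleftrightarrow> (\<lambda>x. (cmod (u x))\<^sup>2) summable_on UNIV"
  by (simp add: ell2_def)

lemma fnorm_ell2_sq: "(fnorm ell2 u)\<^sup>2 = (\<Sum>\<^sub>\<infinity>x. (cmod (u x))\<^sup>2)"
  by (simp add: ell2_def infsum_nonneg)

lemma ell2_I:
  assumes "\<And>F. finite F \<Longrightarrow> (\<Sum>x\<in>F. (cmod (u x))\<^sup>2) \<le> C\<^sup>2" "0 \<le> C"
  shows "u \<in> fset ell2" "fnorm ell2 u \<le> C"
proof -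
  show "u \<in> fset ell2"
    unfolding ell2_iff using summable_on_nonneg_bounded(1)[of "\<lambda>x. (cmod (u x))\<^sup>2" "C\<^sup>2"] assms by auto
  have "(\<Sum>\<^sub>\<infinity>x. (cmod (u x))\<^sup>2) \<le> C\<^sup>2"
    using summable_on_nonneg_bounded(2)[of "\<lambda>x. (cmod (u x))\<^sup>2" "C\<^sup>2"] assms by auto
  then show "fnorm ell2 u \<le> C" using assms(2) by (simp add: ell2_def real_le_lsqrt)
qed

lemma ell2_finite_sum_le:
  assumes "u \<in> fset ell2" "finite F"
  shows "(\<Sum>x\<in>F. (cmod (u x))\<^sup>2) \<le> (fnorm ell2 u)\<^sup>2"
  unfolding fnorm_ell2_sq by (rule finite_sum_le_infsum) (use assms in \<open>auto simp: ell2_iff\<close>)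

text \<open>Up to the factor 2, which spares Minkowski's inequality in \<open>\<ell>\<^sup>2\<close>, a seminormed space.\<close>

definition quasi_normed :: "'v fspace \<Rightarrow> bool" where
  "quasi_normed X \<longleftrightarrow> (\<forall>u\<in>fset X. 0 \<le> fnorm X u) \<and>
     (\<forall>u\<in>fset X. \<forall>w\<in>fset X. \<forall>a c. (\<lambda>x. a * u x + c * w x) \<in> fset X \<and>
        fnorm X (\<lambda>x. a * u x + c * w x) \<le> 2 * (cmod a * fnorm X u + cmod c * fnorm X w))"

lemma quasi_normedD:
  assumes "quasi_normed X" "u \<in> fset X"
  shows "0 \<le> fnorm X u"
    and "w \<in> fset X \<Longrightarrow> (\<lambda>x. a * u x + c * w x) \<in> fset X"
    and "w \<in> fset X \<Longrightarrow>
      fnorm X (\<lambda>x. a * u x + c * w x) \<le> 2 * (cmod a * fnorm X u + cmod c * fnorm X w)"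
  using assms by (auto simp: quasi_normed_def)

lemma fnorm_ell1_nonneg: "0 \<le> fnorm (L1 s) u"
  unfolding fnorm_ell1 by (simp add: infsum_nonneg)

lemma fnorm_ellinf_nonneg:
  assumes "u \<in> fset (Linf s)"
  shows "0 \<le> fnorm (Linf s) u"
  using order_trans[OF norm_ge_zero ellinf_pointwise[OF assms, of undefined]]
  by (smt (verit) mult_neg_pos om_gt_0 zero_less_power)

lemma fnorm_ell2_nonneg: "0 \<le> fnorm ell2 u"
  by (simp add: ell2_def infsum_nonneg)

lemma le_double: "x \<le> C \<Longrightarrow> 0 \<le> C \<Longrightarrow> x \<le> 2 * C" for x C :: real
  by linarith

lemma cmod_lincomb_le: "cmod (a * u + c * w) \<le> cmod a * cmod u + cmod c * cmod w"
  by (metis norm_mult norm_triangle_ineq)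

lemma quasi_normed_ell1 [simp]: "quasi_normed (L1 s)"
  unfolding quasi_normed_def
proof (intro conjI ballI allI)
  fix u w :: "('k::finite, 'r::finite) gfun" and a c
  assume u: "u \<in> fset (L1 s)" and w: "w \<in> fset (L1 s)"
  let ?C = "cmod a * fnorm (L1 s) u + cmod c * fnorm (L1 s) w"
  have *: "(\<Sum>x\<in>F. om x ^ s * cmod (a * u x + c * w x)) \<le> ?C" if F: "finite F" for F
  proof -
    have "(\<Sum>x\<in>F. om x ^ s * cmod (a * u x + c * w x))
        \<le> (\<Sum>x\<in>F. cmod a * (om x ^ s * cmod (u x)) + cmod c * (om x ^ s * cmod (w x)))"
      by (rule sum_mono)
        (use mult_left_mono[OF cmod_lincomb_le, of "om _ ^ s"] in \<open>auto simp: algebra_simps\<close>)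
    also have "\<dots> = cmod a * (\<Sum>x\<in>F. om x ^ s * cmod (u x)) + cmod c * (\<Sum>x\<in>F. om x ^ s * cmod (w x))"
      by (simp add: sum.distrib sum_distrib_left)
    also have "\<dots> \<le> ?C"
      by (intro add_mono mult_left_mono ell1_finite_sum_le u w F) auto
    finally show ?thesis .
  qed
  have 0: "0 \<le> ?C" by (intro add_nonneg_nonneg mult_nonneg_nonneg fnorm_ell1_nonneg norm_ge_zero)
  show "(\<lambda>x. a * u x + c * w x) \<in> fset (L1 s)"
    using * by (rule ell1_I)
  have "fnorm (L1 s) (\<lambda>x. a * u x + c * w x) \<le> ?C"
    using * by (rule ell1_I)
  then show "fnorm (L1 s) (\<lambda>x. a * u x + c * w x) \<le> 2 * ?C"
    by (rule le_double[OF _ 0])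
qed (rule fnorm_ell1_nonneg)

lemma ellinf_lincomb_pointwise:
  assumes u: "u \<in> fset (Linf s)" and w: "w \<in> fset (Linf s)"
  shows "cmod (a * u x + c * w x)
    \<le> (cmod a * fnorm (Linf s) u + cmod c * fnorm (Linf s) w) * om x ^ s"
proof -
  have "cmod (a * u x + c * w x) \<le> cmod a * cmod (u x) + cmod c * cmod (w x)"
    by (rule cmod_lincomb_le)
  also have "\<dots> \<le> cmod a * (fnorm (Linf s) u * om x ^ s)
      + cmod c * (fnorm (Linf s) w * om x ^ s)"
    by (intro add_mono mult_left_mono ellinf_pointwise u w) auto
  finally show ?thesis by (simp add: algebra_simps)
qed

lemma quasi_normed_ellinf [simp]: "quasi_normed (Linf s)"
  unfolding quasi_normed_def
proof (intro conjI ballI allI)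
  fix u w :: "('k::finite, 'r::finite) gfun" and a c
  assume u: "u \<in> fset (Linf s)" and w: "w \<in> fset (Linf s)"
  let ?C = "cmod a * fnorm (Linf s) u + cmod c * fnorm (Linf s) w"
  have 0: "0 \<le> ?C" by (intro add_nonneg_nonneg mult_nonneg_nonneg fnorm_ellinf_nonneg norm_ge_zero u w)
  note * = ellinf_lincomb_pointwise[OF u w, of a _ c]
  show "(\<lambda>x. a * u x + c * w x) \<in> fset (Linf s)"
    using * by (rule ellinf_I)
  have "fnorm (Linf s) (\<lambda>x. a * u x + c * w x) \<le> ?C"
    using * by (rule ellinf_I)
  then show "fnorm (Linf s) (\<lambda>x. a * u x + c * w x) \<le> 2 * ?C"
    by (rule le_double[OF _ 0])
qed (rule fnorm_ellinf_nonneg)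

lemma quasi_normed_ell2 [simp]: "quasi_normed ell2"
  unfolding quasi_normed_def
proof (intro conjI ballI allI)
  fix u w :: "('k::finite, 'r::finite) gfun" and a c
  assume u: "u \<in> fset ell2" and w: "w \<in> fset ell2"
  let ?C = "cmod a * fnorm ell2 u + cmod c * fnorm ell2 w"
  have 0: "0 \<le> ?C" by (intro add_nonneg_nonneg mult_nonneg_nonneg fnorm_ell2_nonneg norm_ge_zero)
  have *: "(\<Sum>x\<in>F. (cmod (a * u x + c * w x))\<^sup>2) \<le> (2 * ?C)\<^sup>2" if F: "finite F" for F
  proof -
    have "(cmod (a * u x + c * w x))\<^sup>2 \<le> 2 * (cmod a)\<^sup>2 * (cmod (u x))\<^sup>2 + 2 * (cmod c)\<^sup>2 * (cmod (w x))\<^sup>2" for x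
    proof -
      have "(cmod (a * u x + c * w x))\<^sup>2 \<le> (cmod a * cmod (u x) + cmod c * cmod (w x))\<^sup>2"
        by (rule power_mono[OF cmod_lincomb_le]) auto
      also have "\<dots> \<le> 2 * (cmod a * cmod (u x))\<^sup>2 + 2 * (cmod c * cmod (w x))\<^sup>2"
        using sum_squares_bound[of "cmod a * cmod (u x)" "cmod c * cmod (w x)"]
        by (simp add: power2_sum)
      finally show ?thesis by (simp add: power_mult_distrib)
    qed
    then have "(\<Sum>x\<in>F. (cmod (a * u x + c * w x))\<^sup>2)
        \<le> (\<Sum>x\<in>F. 2 * (cmod a)\<^sup>2 * (cmod (u x))\<^sup>2 + 2 * (cmod c)\<^sup>2 * (cmod (w x))\<^sup>2)"
      by (rule sum_mono)
    also have "\<dots> = 2 * (cmod a)\<^sup>2 * (\<Sum>x\<in>F. (cmod (u x))\<^sup>2) + 2 * (cmod c)\<^sup>2 * (\<Sum>x\<in>F. (cmod (w x))\<^sup>2)"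
      by (simp add: sum.distrib sum_distrib_left)
    also have "\<dots> \<le> 2 * (cmod a)\<^sup>2 * (fnorm ell2 u)\<^sup>2 + 2 * (cmod c)\<^sup>2 * (fnorm ell2 w)\<^sup>2"
      by (intro add_mono mult_left_mono ell2_finite_sum_le u w F) auto
    also have "\<dots> \<le> (2 * ?C)\<^sup>2"
    proof -
      have "0 \<le> cmod a * fnorm ell2 u" "0 \<le> cmod c * fnorm ell2 w"
        by (intro mult_nonneg_nonneg fnorm_ell2_nonneg norm_ge_zero)+
      then have "0 \<le> (cmod a * fnorm ell2 u) * (cmod c * fnorm ell2 w)" by (rule mult_nonneg_nonneg)
      then show ?thesis using zero_le_power2[of "cmod a * fnorm ell2 u"] zero_le_power2[of "cmod c * fnorm ell2 w"]
        by (simp add: power_mult_distrib power2_sum algebra_simps)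
    qed
    finally show ?thesis .
  qed
  show "(\<lambda>x. a * u x + c * w x) \<in> fset ell2"
    by (rule ell2_I[OF *]) (use 0 in auto)
  show "fnorm ell2 (\<lambda>x. a * u x + c * w x) \<le> 2 * ?C"
    by (rule ell2_I[OF *]) (use 0 in auto)
qed (rule fnorm_ell2_nonneg)

section \<open>Bounded operators with explicit bounds\<close>

text \<open>The bound is an argument rather than an existential, so that uniformity in \<kappa>
  becomes a statement about one constant. Nonnegativity is built in to let bounds be
  multiplied.\<close>

definition bop :: "'v fspace \<Rightarrow> 'v fspace \<Rightarrow> real \<Rightarrow> (('v \<Rightarrow> complex) \<Rightarrow> 'v \<Rightarrow> complex) \<Rightarrow> bool" where
  "bop X Y C A \<longleftrightarrow> 0 \<le> C \<and> (\<forall>u\<in>fset X. A u \<in> fset Y \<and> fnorm Y (A u) \<le> C * fnorm X u) \<and>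
     (\<forall>u\<in>fset X. \<forall>w\<in>fset X. \<forall>a c. A (\<lambda>x. a * u x + c * w x) = (\<lambda>x. a * A u x + c * A w x))"

lemma bopD:
  assumes "bop X Y C A"
  shows "0 \<le> C" "u \<in> fset X \<Longrightarrow> A u \<in> fset Y" "u \<in> fset X \<Longrightarrow> fnorm Y (A u) \<le> C * fnorm X u"
    "u \<in> fset X \<Longrightarrow> w \<in> fset X \<Longrightarrow> A (\<lambda>x. a * u x + c * w x) = (\<lambda>x. a * A u x + c * A w x)"
  using assms by (auto simp: bop_def)

lemma bop_imp_bounded_ops: "bop X Y C A \<Longrightarrow> A \<in> bounded_ops X Y"
  unfolding bop_def bounded_ops_def by blast

lemma bounded_ops_imp_bop:
  assumes "A \<in> bounded_ops X Y" "quasi_normed X"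
  obtains C where "bop X Y C A"
proof -
  from assms(1) obtain C where C: "\<forall>u\<in>fset X. fnorm Y (A u) \<le> C * fnorm X u"
    unfolding bounded_ops_def by blast
  have "fnorm Y (A u) \<le> \<bar>C\<bar> * fnorm X u" if "u \<in> fset X" for u
    using C[rule_format, OF that] quasi_normedD(1)[OF assms(2) that]
      mult_right_mono[OF abs_ge_self[of C]] by (meson order_trans)
  then have "bop X Y \<bar>C\<bar> A"
    using assms(1) unfolding bop_def bounded_ops_def by auto
  then show ?thesis by (rule that)
qed

lemma bop_comp:
  assumes "bop X Y C A" "bop Y Z D B"
  shows "bop X Z (D * C) (\<lambda>u. B (A u))"
  unfolding bop_def
proof (intro conjI ballI allI)
  show "0 \<le> D * C" using bopD(1)[OF assms(1)] bopD(1)[OF assms(2)] by simp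
  fix u assume u: "u \<in> fset X"
  note Au = bopD(2)[OF assms(1) u]
  show "B (A u) \<in> fset Z" using bopD(2)[OF assms(2) Au] .
  have "fnorm Z (B (A u)) \<le> D * fnorm Y (A u)" using bopD(3)[OF assms(2) Au] .
  also have "\<dots> \<le> D * (C * fnorm X u)"
    by (rule mult_left_mono[OF bopD(3)[OF assms(1) u] bopD(1)[OF assms(2)]])
  finally show "fnorm Z (B (A u)) \<le> D * C * fnorm X u" by simp
  fix w a c assume w: "w \<in> fset X"
  show "B (A (\<lambda>x. a * u x + c * w x)) = (\<lambda>x. a * B (A u) x + c * B (A w) x)"
    using bopD(4)[OF assms(1) u w] bopD(4)[OF assms(2) Au bopD(2)[OF assms(1) w]] by simp
qed

lemma bop_lincomb:
  assumes "bop X Y C A" "bop X Y D B" "quasi_normed Y"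
  shows "bop X Y (2 * (cmod a * C + cmod c * D)) (\<lambda>u x. a * A u x + c * B u x)"
  unfolding bop_def
proof (intro conjI ballI allI)
  show "0 \<le> 2 * (cmod a * C + cmod c * D)" using bopD(1)[OF assms(1)] bopD(1)[OF assms(2)] by simp
  fix u assume u: "u \<in> fset X"
  note Au = bopD(2)[OF assms(1) u] and Bu = bopD(2)[OF assms(2) u]
  show "(\<lambda>x. a * A u x + c * B u x) \<in> fset Y"
    using quasi_normedD(2)[OF assms(3) Au Bu] .
  have "fnorm Y (\<lambda>x. a * A u x + c * B u x) \<le> 2 * (cmod a * fnorm Y (A u) + cmod c * fnorm Y (B u))"
    using quasi_normedD(3)[OF assms(3) Au Bu] .
  also have "\<dots> \<le> 2 * (cmod a * (C * fnorm X u) + cmod c * (D * fnorm X u))"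
    by (intro mult_left_mono add_mono bopD(3)[OF assms(1) u] bopD(3)[OF assms(2) u]) auto
  finally show "fnorm Y (\<lambda>x. a * A u x + c * B u x) \<le> 2 * (cmod a * C + cmod c * D) * fnorm X u"
    by (simp add: algebra_simps)
  fix w d e assume w: "w \<in> fset X"
  show "(\<lambda>x. a * A (\<lambda>x. d * u x + e * w x) x + c * B (\<lambda>x. d * u x + e * w x) x)
    = (\<lambda>x. d * (a * A u x + c * B u x) + e * (a * A w x + c * B w x))"
    using bopD(4)[OF assms(1) u w, of d e] bopD(4)[OF assms(2) u w, of d e] by (auto simp: algebra_simps)
qed

lemma bop_cong:
  assumes A: "bop X Y C A" and eq: "\<And>u. u \<in> fset X \<Longrightarrow> A u = B u" and X: "quasi_normed X"
  shows "bop X Y C B"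
  unfolding bop_def
proof (intro conjI ballI allI bopD(1)[OF A])
  fix u assume u: "u \<in> fset X"
  show "B u \<in> fset Y" "fnorm Y (B u) \<le> C * fnorm X u"
    using bopD(2,3)[OF A u] by (simp_all add: eq[OF u])
  fix w a c assume w: "w \<in> fset X"
  show "B (\<lambda>x. a * u x + c * w x) = (\<lambda>x. a * B u x + c * B w x)"
    using bopD(4)[OF A u w] by (simp add: eq[OF u] eq[OF w] eq[OF quasi_normedD(2)[OF X u w]])
qed

lemma bop_zero: "quasi_normed Y \<Longrightarrow> fset Y \<noteq> {} \<Longrightarrow> bop X Y 0 (\<lambda>u x. 0)"
  using quasi_normedD(2)[of Y _ _ 0 0] quasi_normedD(3)[of Y _ _ 0 0] quasi_normedD(1)[of Y]
  unfolding bop_def by fastforce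

lemma bop_sum:
  assumes "finite I" "\<And>i. i \<in> I \<Longrightarrow> \<exists>C. bop X Y C (A i)" "quasi_normed Y" "fset Y \<noteq> {}"
  shows "\<exists>C. bop X Y C (\<lambda>u x. \<Sum>i\<in>I. A i u x)"
  using assms(1,2)
proof (induction I rule: finite_induct)
  case empty
  then show ?case using bop_zero[OF assms(3,4)] by auto
next
  case (insert i I)
  then obtain C D where "bop X Y C (A i)" "bop X Y D (\<lambda>u x. \<Sum>i\<in>I. A i u x)" by blast
  from bop_lincomb[OF this assms(3), of 1 1] show ?case using insert by auto
qed

lemma bop_mono: "bop X Y C A \<Longrightarrow> quasi_normed X \<Longrightarrow> C \<le> D \<Longrightarrow> bop X Y D A"
  unfolding bop_def by (smt (verit) mult_right_mono quasi_normedD(1))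

lemma zero_in_ell1 [simp]: "(\<lambda>x. 0) \<in> fset (L1 s)"
  by (simp add: ell1_iff)

lemma zero_in_ellinf [simp]: "(\<lambda>x. 0) \<in> fset (Linf s)"
  unfolding ellinf_iff by (intro exI[of _ 0]) auto

lemma bop_id_ell1: "s \<le> t \<Longrightarrow> bop (L1 t) (L1 s) 1 (\<lambda>u. u)"
proof -
  assume st: "s \<le> t"
  have "(\<Sum>x\<in>F. om x ^ s * cmod (u x)) \<le> fnorm (L1 t) u"
    if "u \<in> fset (L1 t)" "finite F" for u :: "('k::finite, 'r::finite) gfun" and F
    by (rule order_trans[OF _ ell1_finite_sum_le[OF that]])
      (intro sum_mono mult_right_mono om_pow_mono st norm_ge_zero)
  then show ?thesis unfolding bop_def by (auto intro!: ell1_I)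
qed

lemma bop_id_ellinf: "s \<le> t \<Longrightarrow> bop (Linf s) (Linf t) 1 (\<lambda>u. u)"
proof -
  assume st: "s \<le> t"
  have "cmod (u x) \<le> fnorm (Linf s) u * om x ^ t"
    if "u \<in> fset (Linf s)" for u :: "('k::finite, 'r::finite) gfun" and x
    by (rule order_trans[OF ellinf_pointwise[OF that]])
      (intro mult_left_mono om_pow_mono st fnorm_ellinf_nonneg that)
  then show ?thesis unfolding bop_def by (auto intro!: ellinf_I)
qed

lemma bop_id_ell2_ellinf: "bop ell2 (Linf s) 1 (\<lambda>u. u)"
proof -
  have "cmod (u x) \<le> fnorm ell2 u * om x ^ s"
    if u: "u \<in> fset ell2" for u :: "('k::finite, 'r::finite) gfun" and x
  proof -
    have "cmod (u x) \<le> fnorm ell2 u"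
      using ell2_finite_sum_le[OF u, of "{x}"] fnorm_ell2_nonneg[of u]
      by (simp add: power2_le_iff_abs_le)
    then show ?thesis using fnorm_ell2_nonneg[of u] om_pow_ge_1[of x s]
      by (smt (verit) mult_left_mono mult_cancel_left2)
  qed
  then show ?thesis unfolding bop_def by (auto intro!: ellinf_I)
qed

lemma bop_id_ell1_ell2: "bop (L1 s) ell2 1 (\<lambda>u. u)"
proof -
  have "(\<Sum>x\<in>F. (cmod (u x))\<^sup>2) \<le> (fnorm (L1 s) u)\<^sup>2"
    if u: "u \<in> fset (L1 s)" and F: "finite F" for u :: "('k::finite, 'r::finite) gfun" and F
  proof -
    have "(\<Sum>x\<in>F. (cmod (u x))\<^sup>2) \<le> (\<Sum>x\<in>F. cmod (u x))\<^sup>2"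
    proof -
      have "cmod (u x) \<le> (\<Sum>x\<in>F. cmod (u x))" if "x \<in> F" for x
        by (rule member_le_sum[OF that]) (use F in auto)
      then have "(\<Sum>x\<in>F. (cmod (u x))\<^sup>2) \<le> (\<Sum>x\<in>F. cmod (u x) * (\<Sum>x\<in>F. cmod (u x)))"
        unfolding power2_eq_square by (intro sum_mono mult_left_mono) auto
      then show ?thesis by (simp add: power2_eq_square sum_distrib_right)
    qed
    also have "\<dots> \<le> (\<Sum>x\<in>F. om x ^ s * cmod (u x))\<^sup>2"
      by (intro power_mono sum_mono sum_nonneg) (use om_pow_ge_1 in \<open>auto simp: mult_le_cancel_right1\<close>)
    also have "\<dots> \<le> (fnorm (L1 s) u)\<^sup>2"
      by (intro power_mono ell1_finite_sum_le u F sum_nonneg) auto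
    finally show ?thesis .
  qed
  then show ?thesis unfolding bop_def by (auto intro!: ell2_I fnorm_ell1_nonneg)
qed

lemma bop_id_ell1_ellinf: "bop (L1 s) (Linf t) 1 (\<lambda>u. u)"
  using bop_comp[OF bop_id_ell1_ell2 bop_id_ell2_ellinf] by simp

text \<open>Raising the weight shrinks the domain and enlarges the target, so the spaces of
  operators increase with the weight.\<close>

lemma bop_ell1_ellinf_mono:
  assumes "bop (L1 s) (Linf s) C A" "s \<le> t"
  shows "bop (L1 t) (Linf t) C A"
  using bop_comp[OF bop_id_ell1[OF assms(2)] bop_comp[OF assms(1) bop_id_ellinf[OF assms(2)]]] by simp

section \<open>Complex Hilbert spaces\<close>

lemma cinner_scaleR_right: "cinner (x::'h::complex_hilbert) (r *\<^sub>R y) = complex_of_real r * cinner x y"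
  by (simp add: scaleR_scaleC cinner_scaleC_right)

lemma cinner_add_left: "cinner (x + y) (z::'h::complex_hilbert) = cinner x z + cinner y z"
  by (metis cinner_add_right cinner_commute complex_cnj_add)

lemma cinner_minus_right: "cinner (x::'h::complex_hilbert) (- y) = - cinner x y"
  using cinner_scaleR_right[of x "-1" y] by simp

lemma cinner_minus_left: "cinner (- x) (y::'h::complex_hilbert) = - cinner x y"
  by (metis cinner_minus_right cinner_commute complex_cnj_minus)

lemma cinner_diff_left: "cinner (x - y) (z::'h::complex_hilbert) = cinner x z - cinner y z"
  using cinner_add_left[of x "-y" z] by (simp add: cinner_minus_left)

lemma norm_add_sq:
  "(norm (x + y))\<^sup>2 = (norm x)\<^sup>2 + 2 * Re (cinner x y) + (norm (y::'h::complex_hilbert))\<^sup>2"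
proof -
  have "complex_of_real ((norm (x + y))\<^sup>2) = cinner (x + y) (x + y)" by (simp only: cinner_self)
  also have "\<dots> = cinner x x + (cinner x y + cnj (cinner x y)) + cinner y y"
    by (simp add: cinner_add_left cinner_add_right cinner_commute[of y x])
  also have "\<dots> = complex_of_real ((norm x)\<^sup>2 + 2 * Re (cinner x y) + (norm y)\<^sup>2)"
    by (simp add: cinner_self complex_add_cnj)
  finally show ?thesis by (simp only: of_real_eq_iff)
qed

lemma parallelogram:
  "(norm (x + y))\<^sup>2 + (norm (x - y))\<^sup>2 = 2 * (norm x)\<^sup>2 + 2 * (norm (y::'h::complex_hilbert))\<^sup>2"
  using norm_add_sq[of x y] norm_add_sq[of x "- y"] by (simp add: cinner_minus_right)

lemma norm_scaleC: "norm (scaleC a (x::'h::complex_hilbert)) = cmod a * norm x"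
proof -
  have "complex_of_real ((norm (scaleC a x))\<^sup>2) = a * cnj (a * cinner x x)"
    by (metis cinner_self cinner_scaleC_right cinner_commute)
  also have "\<dots> = complex_of_real ((cmod a * norm x)\<^sup>2)"
    using complex_norm_square[of a] by (simp add: cinner_self power_mult_distrib mult.assoc)
  finally have "(norm (scaleC a x))\<^sup>2 = (cmod a * norm x)\<^sup>2" by (simp only: of_real_eq_iff)
  then show ?thesis by (simp add: power2_eq_iff_nonneg)
qed

text \<open>The triangle inequality comes with the norm; squared, it bounds the real part of the
  inner product. Multiplying \<open>y\<close> by the conjugate phase of \<open>cinner x y\<close>
  turns the real part into the modulus.\<close>

lemma Cauchy_Schwarz_cinner: "cmod (cinner x y) \<le> norm x * norm (y::'h::complex_hilbert)"
proof -
  have Re_le: "Re (cinner x z) \<le> norm x * norm z" for z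
  proof -
    have "(norm (x + z))\<^sup>2 \<le> (norm x + norm z)\<^sup>2"
      by (rule power_mono[OF norm_triangle_ineq]) simp
    then show ?thesis by (simp add: norm_add_sq power2_sum)
  qed
  define a where "a = cnj (sgn (cinner x y))"
  have "a * cinner x y = cmod (cinner x y)"
  proof (cases "cinner x y = 0")
    case False
    have "a * cinner x y = (cinner x y * cnj (cinner x y)) / cmod (cinner x y)"
      by (simp add: a_def sgn_eq)
    also have "\<dots> = cmod (cinner x y)"
      using False by (simp add: complex_norm_square[symmetric] power2_eq_square)
    finally show ?thesis .
  qed simp
  then have "cmod (cinner x y) = Re (cinner x (scaleC a y))"
    by (simp add: cinner_scaleC_right)
  also have "\<dots> \<le> norm x * (cmod a * norm y)" using Re_le norm_scaleC by metis
  also have "\<dots> \<le> norm x * norm y"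
    by (intro mult_left_mono) (auto simp: a_def norm_sgn)
  finally show ?thesis .
qed

lemma cinner_eqI:
  assumes "\<And>f. cinner k f = cinner k' f"
  shows "k = (k'::'h::complex_hilbert)"
proof -
  have "cinner (k - k') (k - k') = 0" using assms by (simp add: cinner_diff_left)
  then show ?thesis by (simp add: cinner_self)
qed

text \<open>The representing vector minimizes \<open>\<parallel>f\<parallel>\<^sup>2 - 2 Re (\<phi> f)\<close>.\<close>

theorem Riesz_representation:
  fixes \<phi> :: "'h::complex_hilbert \<Rightarrow> complex"
  assumes add: "\<And>f g. \<phi> (f + g) = \<phi> f + \<phi> g"
    and scale: "\<And>a f. \<phi> (scaleC a f) = a * \<phi> f"
    and bound: "\<And>f. cmod (\<phi> f) \<le> C * norm f"
  shows "\<exists>!k. \<forall>f. cinner k f = \<phi> f"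
proof -
  define J where "J f = (norm f)\<^sup>2 - 2 * Re (\<phi> f)" for f
  have scaleR: "\<phi> (r *\<^sub>R f) = r * \<phi> f" for r f by (simp add: scaleR_scaleC scale)
  have diff: "\<phi> (f - g) = \<phi> f - \<phi> g" for f g
    using add[of f "- g"] scaleR[of "-1" g] by simp
  have J_ge: "- C\<^sup>2 \<le> J f" for f
  proof -
    have "Re (\<phi> f) \<le> C * norm f" using bound[of f] complex_Re_le_cmod order_trans by blast
    moreover have "0 \<le> (norm f - C)\<^sup>2" by simp
    ultimately show ?thesis by (simp add: J_def power2_diff algebra_simps)
  qed
  define m where "m = Inf (range J)"
  have bdd: "bdd_below (range J)" using J_ge by (auto intro!: bdd_belowI)
  have m_le: "m \<le> J f" for f unfolding m_def by (rule cInf_lower) (use bdd in auto)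
  have "\<exists>f. J f < m + 1 / real (Suc n)" for n
    using cInf_lessD[of "range J" "m + 1 / real (Suc n)"] by (auto simp: m_def)
  then obtain f where f: "\<And>n. J (f n) < m + 1 / real (Suc n)" by metis
  \<comment> \<open>Parallelogram law, with \<open>J\<close> at the midpoint bounded below by
    \<open>m\<close>: two almost minimizers are close to each other, which makes the minimizing
    sequence Cauchy.\<close>
  have dist_sq: "(norm (g - h))\<^sup>2 \<le> 2 * (J g - m) + 2 * (J h - m)" for g h
  proof -
    have "(norm (g + h))\<^sup>2 = 4 * (norm ((1/2) *\<^sub>R (g + h)))\<^sup>2" by (simp add: power_mult_distrib power2_eq_square)
    moreover have "(norm ((1/2) *\<^sub>R (g + h)))\<^sup>2 = J ((1/2) *\<^sub>R (g + h)) + Re (\<phi> (g + h))"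
      by (simp add: J_def scaleR)
    ultimately have "(norm (g - h))\<^sup>2
        = 2 * (norm g)\<^sup>2 + 2 * (norm h)\<^sup>2 - 4 * (J ((1/2) *\<^sub>R (g + h)) + Re (\<phi> g) + Re (\<phi> h))"
      using parallelogram[of g h] by (simp add: add)
    also have "\<dots> \<le> 2 * (J g - m) + 2 * (J h - m)"
      using m_le[of "(1/2) *\<^sub>R (g + h)"] by (simp add: J_def[of g] J_def[of h])
    finally show ?thesis .
  qed
  have "Cauchy f"
  proof (rule metric_CauchyI)
    fix e :: real assume e: "0 < e"
    obtain N where N: "4 / real (Suc N) < e\<^sup>2"
    proof -
      obtain N where "inverse (real (Suc N)) < e\<^sup>2 / 4"
        using reals_Archimedean[of "e\<^sup>2 / 4"] e by auto
      then show ?thesis by (intro that[of N]) (simp add: field_simps)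
    qed
    show "\<exists>N. \<forall>n\<ge>N. \<forall>k\<ge>N. dist (f n) (f k) < e"
    proof (intro exI[of _ N] allI impI)
      fix n k assume nk: "N \<le> n" "N \<le> k"
      have *: "J (f i) - m \<le> 1 / real (Suc N)" if "N \<le> i" for i
      proof -
        have "1 / real (Suc i) \<le> 1 / real (Suc N)" using that by (simp add: frac_le)
        then show ?thesis using f[of i] by linarith
      qed
      have "(norm (f n - f k))\<^sup>2 \<le> 4 / real (Suc N)"
        using dist_sq[of "f n" "f k"] *[OF nk(1)] *[OF nk(2)] by simp
      then have "(norm (f n - f k))\<^sup>2 < e\<^sup>2" using N by linarith
      then show "dist (f n) (f k) < e" using e by (simp add: dist_norm power_less_imp_less_base)
    qed
  qed
  then obtain k where k: "f \<longlonglongrightarrow> k" by (meson Cauchy_convergent convergent_def)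
  have "(\<lambda>n. C * norm (f n - k)) \<longlonglongrightarrow> C * norm (k - k)" by (intro tendsto_intros k)
  then have lim0: "(\<lambda>n. C * norm (f n - k)) \<longlonglongrightarrow> 0" by simp
  have "\<forall>n. norm (\<phi> (f n) - \<phi> k) \<le> C * norm (f n - k)" using bound[of "f _ - k"] by (simp only: diff) simp
  then have "(\<lambda>n. \<phi> (f n) - \<phi> k) \<longlonglongrightarrow> 0"
    by (intro Lim_null_comparison[OF _ lim0] always_eventually)
  then have "(\<lambda>n. \<phi> (f n)) \<longlonglongrightarrow> \<phi> k" using Lim_null by blast
  then have "(\<lambda>n. J (f n)) \<longlonglongrightarrow> J k" unfolding J_def by (intro tendsto_intros k)
  moreover have "(\<lambda>n. m + 1 / real (Suc n)) \<longlonglongrightarrow> m + 0"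
    by (intro tendsto_intros LIMSEQ_Suc[OF lim_inverse_n'])
  ultimately have Jk: "J k \<le> m" using f by (intro LIMSEQ_le) (auto intro!: less_imp_le)
  have Re_eq: "Re (cinner k g) = Re (\<phi> g)" for g
  proof (rule ccontr)
    define d where "d = Re (cinner k g) - Re (\<phi> g)"
    define N where "N = (norm g)\<^sup>2"
    \<comment> \<open>The derivative of \<open>J\<close> at \<open>k\<close> along \<open>g\<close>
      is \<open>2 * d\<close>. A step against it would take \<open>J\<close> below \<open>m\<close>;
      dividing by \<open>N + 1\<close> instead of \<open>N\<close> covers
      \<open>g = 0\<close>.\<close>
    define t where "t = - d / (N + 1)"
    assume "Re (cinner k g) \<noteq> Re (\<phi> g)"
    then have d: "d \<noteq> 0" by (simp add: d_def)
    have N: "0 \<le> N" by (simp add: N_def)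
    have "J (k + t *\<^sub>R g) = J k + 2 * t * d + t\<^sup>2 * N"
      by (simp add: J_def norm_add_sq add scaleR cinner_scaleR_right d_def N_def power_mult_distrib algebra_simps)
    then have "0 \<le> 2 * t * d + t\<^sup>2 * N" using m_le[of "k + t *\<^sub>R g"] Jk by linarith
    then have "0 \<le> (2 * t * d + t\<^sup>2 * N) * (N + 1)\<^sup>2" by simp
    also have "\<dots> = 2 * (t * (N + 1)) * d * (N + 1) + (t * (N + 1))\<^sup>2 * N"
      by (simp add: power2_eq_square algebra_simps)
    also have "t * (N + 1) = - d" using N by (simp add: t_def)
    also have "2 * - d * d * (N + 1) + (- d)\<^sup>2 * N = - (d\<^sup>2 * (N + 2))"
      by (simp add: power2_eq_square algebra_simps)
    also have "\<dots> < 0" using d N by simp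
    finally show False by simp
  qed
  have "cinner k g = \<phi> g" for g
  proof (rule complex_eqI)
    show "Im (cinner k g) = Im (\<phi> g)"
      using Re_eq[of "scaleC (- \<i>) g"] by (simp add: cinner_scaleC_right scale)
  qed (rule Re_eq)
  then show ?thesis by (intro ex1I[of _ k]) (auto intro: cinner_eqI)
qed

section \<open>The pairing\<close>

lemma pairing_summand_le:
  assumes "\<Phi> \<in> fset (Linf s)"
  shows "cmod (cnj (\<Phi> x) * u x) \<le> fnorm (Linf s) \<Phi> * (om x ^ s * cmod (u x))"
  using mult_right_mono[OF ellinf_pointwise[OF assms, of x] norm_ge_zero[of "u x"]]
  by (simp add: norm_mult mult.assoc)

lemma pairing_summable:
  assumes "\<Phi> \<in> fset (Linf s)" "u \<in> fset (L1 s)"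
  shows "(\<lambda>x. cnj (\<Phi> x) * u x) summable_on UNIV"
  by (rule summable_on_dominated[OF _ pairing_summand_le[OF assms(1)]])
    (use assms(2) in \<open>auto simp: ell1_iff intro: summable_on_cmult_right\<close>)

lemma pairing_le:
  assumes "\<Phi> \<in> fset (Linf s)" "u \<in> fset (L1 s)"
  shows "cmod (pairing \<Phi> u) \<le> fnorm (Linf s) \<Phi> * fnorm (L1 s) u"
proof -
  have "cmod (pairing \<Phi> u) \<le> (\<Sum>\<^sub>\<infinity>x. fnorm (Linf s) \<Phi> * (om x ^ s * cmod (u x)))"
    unfolding pairing_def by (rule norm_infsum_dominated[OF _ pairing_summand_le[OF assms(1)]])
      (use assms(2) in \<open>auto simp: ell1_iff intro: summable_on_cmult_right\<close>)
  then show ?thesis by (simp add: infsum_cmult_right' fnorm_ell1)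
qed

lemma pairing_commute: "pairing u w = cnj (pairing w u)"
  unfolding pairing_def infsum_cnj[symmetric] by (simp add: mult.commute)

lemma pairing_lincomb_right:
  assumes "(\<lambda>x. cnj (\<Phi> x) * u x) summable_on UNIV" "(\<lambda>x. cnj (\<Phi> x) * w x) summable_on UNIV"
  shows "pairing \<Phi> (\<lambda>x. a * u x + c * w x) = a * pairing \<Phi> u + c * pairing \<Phi> w"
proof -
  have "pairing \<Phi> (\<lambda>x. a * u x + c * w x)
      = (\<Sum>\<^sub>\<infinity>x. a * (cnj (\<Phi> x) * u x) + c * (cnj (\<Phi> x) * w x))"
    unfolding pairing_def by (simp add: algebra_simps)
  also have "\<dots> = (\<Sum>\<^sub>\<infinity>x. a * (cnj (\<Phi> x) * u x)) + (\<Sum>\<^sub>\<infinity>x. c * (cnj (\<Phi> x) * w x))"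
    by (rule infsum_add) (use assms in \<open>auto intro: summable_on_cmult_right\<close>)
  finally show ?thesis by (simp add: pairing_def infsum_cmult_right')
qed

section \<open>The interaction\<close>

text \<open>The functional given by pairing with \<Phi> after \<open>v\<close> is bounded, so the
  Riesz theorem makes the definite description in \<open>hilbert_adj\<close> meaningful.\<close>

lemma hilbert_adj_cinner:
  fixes v :: "'h::complex_hilbert \<Rightarrow> ('k::finite, 'r::finite) gfun"
  assumes v: "bounded_from_hilbert (L1 s) v" and \<Phi>: "\<Phi> \<in> fset (Linf s)"
  shows "cinner (hilbert_adj v \<Phi>) f = pairing \<Phi> (v f)"
proof -
  obtain C where C: "\<And>f. fnorm (L1 s) (v f) \<le> C * norm f"
    using v unfolding bounded_from_hilbert_def by blast
  have mem: "v f \<in> fset (L1 s)" for f using v unfolding bounded_from_hilbert_def by blast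
  have "\<exists>!k. \<forall>f. cinner k f = pairing \<Phi> (v f)"
  proof (rule Riesz_representation)
    fix f g show "pairing \<Phi> (v (f + g)) = pairing \<Phi> (v f) + pairing \<Phi> (v g)"
      using pairing_lincomb_right[OF pairing_summable[OF \<Phi> mem] pairing_summable[OF \<Phi> mem], of 1 f 1 g] v
      by (simp add: bounded_from_hilbert_def)
  next
    fix a f show "pairing \<Phi> (v (scaleC a f)) = a * pairing \<Phi> (v f)"
      using pairing_lincomb_right[OF pairing_summable[OF \<Phi> mem] pairing_summable[OF \<Phi> mem], of a f 0 f] v
      by (simp add: bounded_from_hilbert_def)
  next
    fix f
    have "cmod (pairing \<Phi> (v f)) \<le> fnorm (Linf s) \<Phi> * fnorm (L1 s) (v f)"
      by (rule pairing_le[OF \<Phi> mem])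
    also have "\<dots> \<le> fnorm (Linf s) \<Phi> * (C * norm f)"
      by (rule mult_left_mono[OF C fnorm_ellinf_nonneg[OF \<Phi>]])
    finally show "cmod (pairing \<Phi> (v f)) \<le> (fnorm (Linf s) \<Phi> * C) * norm f" by simp
  qed
  from theI'[OF this] show ?thesis unfolding hilbert_adj_def by blast
qed

lemma assumption_A_bounded:
  assumes "assumption_A TYPE('h::complex_hilbert) (real s) V"
  obtains C where "bop (Linf s) (L1 s) C V"
  using assms bounded_ops_imp_bop[OF _ quasi_normed_ellinf, where Y="L1 s"]
  unfolding assumption_A_def by blast

text \<open>Self-adjointness is stated on l^2 only. The factorization through the Hilbert space
  extends the symmetry to growing functions, to which the threshold equation has to be
  applied.\<close>

lemma assumption_A_symmetric:
  assumes A: "assumption_A TYPE('h::complex_hilbert) (real s) V"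
    and \<Phi>: "\<Phi> \<in> fset (Linf s)" and \<Psi>: "\<Psi> \<in> fset (Linf s)"
  shows "pairing \<Psi> (V \<Phi>) = pairing (V \<Psi>) \<Phi>"
proof -
  obtain v :: "'h \<Rightarrow> _" and U where v: "bounded_from_hilbert (L1 s) v"
    and U: "self_adjoint_unitary U"
    and V: "\<And>\<Phi>. \<Phi> \<in> fset (Linf s) \<Longrightarrow> V \<Phi> = v (U (hilbert_adj v \<Phi>))"
    using A unfolding assumption_A_def by blast
  note adj = hilbert_adj_cinner[OF v]
  have "pairing \<Psi> (V \<Phi>) = cinner (hilbert_adj v \<Psi>) (U (hilbert_adj v \<Phi>))"
    by (simp add: V[OF \<Phi>] adj[OF \<Psi>])
  also have "\<dots> = cinner (U (hilbert_adj v \<Psi>)) (hilbert_adj v \<Phi>)"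
    using U unfolding self_adjoint_unitary_def by metis
  also have "\<dots> = cnj (cinner (hilbert_adj v \<Phi>) (U (hilbert_adj v \<Psi>)))"
    by (rule cinner_commute)
  also have "\<dots> = cnj (pairing \<Phi> (V \<Psi>))" by (simp add: V[OF \<Psi>] adj[OF \<Phi>])
  finally show ?thesis by (simp add: pairing_commute[of "V \<Psi>"])
qed

text \<open>
  By the parallelogram law \<open>\<parallel>v\<^sup>*\<Phi>\<^sub>0\<parallel>\<^sup>2 + \<parallel>v\<^sup>*\<Phi>\<parallel>\<^sup>2\<close> is at most the supremum of \<open>\<parallel>v\<^sup>*\<Phi>\<parallel>\<^sup>2\<close> over the unit ball whenever
  \<open>\<Phi>\<^sub>0\<close> and \<open>\<Phi>\<close> have disjoint supports. Hence \<open>v\<^sup>*\<close> is small on functions supported away from an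
  almost maximizing \<open>\<Phi>\<^sub>0\<close>.
\<close>

lemma hilbert_adj_tail:
  fixes v :: "'h::complex_hilbert \<Rightarrow> ('k::finite, 'r::finite) gfun"
  assumes v: "bounded_from_hilbert (L1 s) v" and e: "0 < e"
  obtains F where "finite F"
    "\<And>f G. finite G \<Longrightarrow> G \<inter> F = {} \<Longrightarrow> (\<Sum>x\<in>G. om x ^ s * cmod (v f x)) \<le> e * norm f"
proof -
  obtain C where C: "\<And>f. fnorm (L1 s) (v f) \<le> C * norm f"
    using v unfolding bounded_from_hilbert_def by blast
  have mem: "v f \<in> fset (L1 s)" for f using v unfolding bounded_from_hilbert_def by blast
  \<comment> \<open>Finitely supported elements of the dual unit ball: they suffice to recover
    finite weighted sums of \<open>v f\<close>, and they stay in the ball when two of them with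
    disjoint supports are added or subtracted.\<close>
  define S where "S = {\<Phi>::('k, 'r) gfun. finite {x. \<Phi> x \<noteq> 0} \<and> (\<forall>x. cmod (\<Phi> x) \<le> 1 * om x ^ s)}"
  define adj where "adj = hilbert_adj v"
  have S_mem: "\<Phi> \<in> fset (Linf s)" and S_norm: "fnorm (Linf s) \<Phi> \<le> 1" if "\<Phi> \<in> S" for \<Phi>
    using that ellinf_I[of \<Phi> 1 s] unfolding S_def by blast+
  note adj = hilbert_adj_cinner[OF v, folded adj_def]
  have adj_le: "norm (adj \<Phi>) \<le> \<bar>C\<bar>" if \<Phi>: "\<Phi> \<in> S" for \<Phi>
  proof (cases "adj \<Phi> = 0")
    case False
    have "(norm (adj \<Phi>))\<^sup>2 = cmod (cinner (adj \<Phi>) (adj \<Phi>))" by (simp only: cinner_self norm_of_real abs_power2)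
    also have "\<dots> \<le> fnorm (Linf s) \<Phi> * fnorm (L1 s) (v (adj \<Phi>))"
      unfolding adj[OF S_mem[OF \<Phi>]] by (rule pairing_le[OF S_mem[OF \<Phi>] mem])
    also have "\<dots> \<le> 1 * (C * norm (adj \<Phi>))"
      by (intro mult_mono S_norm \<Phi> C fnorm_ell1_nonneg) auto
    also have "\<dots> \<le> \<bar>C\<bar> * norm (adj \<Phi>)" by (simp add: mult_right_mono)
    finally show ?thesis using False by (simp add: power2_eq_square)
  qed simp
  define q where "q = (SUP \<Phi>\<in>S. (norm (adj \<Phi>))\<^sup>2)"
  have bdd: "bdd_above ((\<lambda>\<Phi>. (norm (adj \<Phi>))\<^sup>2) ` S)"
    using adj_le by (auto intro!: bdd_aboveI2[where M="\<bar>C\<bar>\<^sup>2"] power_mono simp del: power2_abs)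
  have "(\<lambda>x. 0) \<in> S" by (simp add: S_def)
  then have "S \<noteq> {}" by blast
  then have "\<exists>\<Phi>\<in>S. q - e\<^sup>2 < (norm (adj \<Phi>))\<^sup>2"
    using less_cSUP_iff[OF _ bdd, of "q - e\<^sup>2"] e by (simp flip: q_def)
  then obtain \<Phi>0 where \<Phi>0: "\<Phi>0 \<in> S" "q - e\<^sup>2 < (norm (adj \<Phi>0))\<^sup>2" by blast
  define F where "F = {x. \<Phi>0 x \<noteq> 0}"
  have adj_lincomb: "adj (\<lambda>x. \<Phi> x + \<Psi> x) = adj \<Phi> + adj \<Psi>" "adj (\<lambda>x. \<Phi> x - \<Psi> x) = adj \<Phi> - adj \<Psi>"
    if "\<Phi> \<in> S" "\<Psi> \<in> S" for \<Phi> \<Psi>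
  proof -
    note \<Phi> = S_mem[OF that(1)] and \<Psi> = S_mem[OF that(2)]
    have plus: "(\<lambda>x. \<Phi> x + \<Psi> x) \<in> fset (Linf s)"
      using quasi_normedD(2)[OF quasi_normed_ellinf \<Phi> \<Psi>, of 1 1] by simp
    have minus: "(\<lambda>x. \<Phi> x - \<Psi> x) \<in> fset (Linf s)"
      using quasi_normedD(2)[OF quasi_normed_ellinf \<Phi> \<Psi>, of 1 "-1"] by simp
    have sm: "(\<lambda>x. cnj (\<Phi> x) * v f x) summable_on UNIV" "(\<lambda>x. cnj (\<Psi> x) * v f x) summable_on UNIV" for f
      by (rule pairing_summable[OF \<Phi> mem] pairing_summable[OF \<Psi> mem])+
    have "pairing (\<lambda>x. \<Phi> x + \<Psi> x) (v f) = pairing \<Phi> (v f) + pairing \<Psi> (v f)" for f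
      unfolding pairing_def using infsum_add[OF sm] by (simp add: algebra_simps)
    then show "adj (\<lambda>x. \<Phi> x + \<Psi> x) = adj \<Phi> + adj \<Psi>"
      by (intro cinner_eqI) (simp add: adj \<Phi> \<Psi> plus cinner_add_left)
    have "pairing (\<lambda>x. \<Phi> x - \<Psi> x) (v f) = pairing \<Phi> (v f) - pairing \<Psi> (v f)" for f
      unfolding pairing_def using infsum_add[OF sm(1) summable_on_uminus[THEN iffD2, OF sm(2)]]
      by (simp add: algebra_simps infsum_uminus)
    then show "adj (\<lambda>x. \<Phi> x - \<Psi> x) = adj \<Phi> - adj \<Psi>"
      by (intro cinner_eqI) (simp add: adj \<Phi> \<Psi> minus cinner_diff_left)
  qed
  have small: "norm (adj \<Phi>) \<le> e" if \<Phi>: "\<Phi> \<in> S" and disj: "\<And>x. x \<in> F \<Longrightarrow> \<Phi> x = 0" for \<Phi>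
  proof -
    have supp: "{x. \<Phi>0 x + \<Phi> x \<noteq> 0} \<subseteq> {x. \<Phi>0 x \<noteq> 0} \<union> {x. \<Phi> x \<noteq> 0}"
      "{x. \<Phi>0 x - \<Phi> x \<noteq> 0} \<subseteq> {x. \<Phi>0 x \<noteq> 0} \<union> {x. \<Phi> x \<noteq> 0}" by auto
    have fin: "finite ({x. \<Phi>0 x \<noteq> 0} \<union> {x. \<Phi> x \<noteq> 0})" using \<Phi>0(1) \<Phi> by (auto simp: S_def)
    have le: "cmod (\<Phi>0 x + \<Phi> x) \<le> 1 * om x ^ s" "cmod (\<Phi>0 x - \<Phi> x) \<le> 1 * om x ^ s" for x
      using disj[of x] \<Phi>0(1) \<Phi> by (cases "x \<in> F"; simp add: S_def F_def)+
    have "(\<lambda>x. \<Phi>0 x + \<Phi> x) \<in> S" "(\<lambda>x. \<Phi>0 x - \<Phi> x) \<in> S"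
      using finite_subset[OF supp(1) fin] finite_subset[OF supp(2) fin] le by (simp_all add: S_def)
    then have "(norm (adj (\<lambda>x. \<Phi>0 x + \<Phi> x)))\<^sup>2 \<le> q" "(norm (adj (\<lambda>x. \<Phi>0 x - \<Phi> x)))\<^sup>2 \<le> q"
      unfolding q_def using cSUP_upper[OF _ bdd] by blast+
    then have "(norm (adj \<Phi>0 + adj \<Phi>))\<^sup>2 + (norm (adj \<Phi>0 - adj \<Phi>))\<^sup>2 \<le> 2 * q"
      by (simp add: adj_lincomb \<Phi>0(1) \<Phi>)
    then have "(norm (adj \<Phi>))\<^sup>2 \<le> e\<^sup>2" using parallelogram[of "adj \<Phi>0" "adj \<Phi>"] \<Phi>0(2) by linarith
    then show ?thesis using e by (simp add: power2_le_iff_abs_le)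
  qed
  show ?thesis
  proof (rule that[of F])
    show "finite F" using \<Phi>0(1) by (simp add: S_def F_def)
    fix f and G :: "('k, 'r) gvert set" assume G: "finite G" "G \<inter> F = {}"
    \<comment> \<open>The dual extremal function for \<open>v f\<close> on \<open>G\<close>: pairing
      with it returns exactly the weighted sum, and its support misses that of the almost maximizing
      function.\<close>
    define \<Phi> where "\<Phi> x = (if x \<in> G then om x ^ s * sgn (v f x) else 0)" for x
    have "{x. \<Phi> x \<noteq> 0} \<subseteq> G" by (auto simp: \<Phi>_def)
    then have \<Phi>: "\<Phi> \<in> S"
      using finite_subset[OF _ G(1)] by (auto simp: S_def \<Phi>_def norm_mult norm_power norm_sgn)
    have sgn: "cnj (sgn z) * z = cmod z" for z
    proof (cases "z = 0")
      case False
      have "cnj (sgn z) * z = (z * cnj z) / cmod z" by (simp add: sgn_eq)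
      also have "\<dots> = cmod z" using False by (simp add: complex_norm_square[symmetric] power2_eq_square)
      finally show ?thesis .
    qed simp
    have "pairing \<Phi> (v f) = (\<Sum>\<^sub>\<infinity>x\<in>G. of_real (om x ^ s * cmod (v f x)))"
      unfolding pairing_def by (rule infsum_cong_neutral) (auto simp: \<Phi>_def sgn mult.assoc)
    also have "\<dots> = of_real (\<Sum>x\<in>G. om x ^ s * cmod (v f x))" using G(1) by simp
    finally have "(\<Sum>x\<in>G. om x ^ s * cmod (v f x)) = cmod (cinner (adj \<Phi>) f)"
      by (simp add: adj[OF S_mem[OF \<Phi>]] sum_nonneg del: of_real_sum)
    also have "\<dots> \<le> norm (adj \<Phi>) * norm f" by (rule Cauchy_Schwarz_cinner)
    also have "\<dots> \<le> e * norm f"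
      by (intro mult_right_mono small[OF \<Phi>]) (use G in \<open>auto simp: \<Phi>_def\<close>)
    finally show "(\<Sum>x\<in>G. om x ^ s * cmod (v f x)) \<le> e * norm f" .
  qed
qed

text \<open>Every \<open>V \<Phi>\<close> is \<open>v\<close> of a vector whose norm is that of
  \<open>hilbert_adj v \<Phi>\<close>, because \<open>U\<close> is isometric. So the uniform tails
  of \<open>v\<close> carry over, up to the norm of the adjoint, which the constant \<open>d\<close>
  absorbs.\<close>

lemma assumption_A_tail:
  fixes V :: "('k::finite, 'r::finite) gop"
  assumes A: "assumption_A TYPE('h::complex_hilbert) (real s) V" and e: "0 < e"
  obtains F where "finite F"
    "\<And>\<Phi> G. \<Phi> \<in> fset (Linf s) \<Longrightarrow> finite G \<Longrightarrow> G \<inter> F = {} \<Longrightarrow>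
      (\<Sum>x\<in>G. om x ^ s * cmod (V \<Phi> x)) \<le> e * fnorm (Linf s) \<Phi>"
proof -
  obtain v :: "'h \<Rightarrow> _" and U where v: "bounded_from_hilbert (L1 s) v"
    and U: "self_adjoint_unitary U"
    and V: "\<And>\<Phi>. \<Phi> \<in> fset (Linf s) \<Longrightarrow> V \<Phi> = v (U (hilbert_adj v \<Phi>))"
    using A unfolding assumption_A_def by blast
  obtain C where C: "\<And>f. fnorm (L1 s) (v f) \<le> C * norm f"
    using v unfolding bounded_from_hilbert_def by blast
  have mem: "v f \<in> fset (L1 s)" for f using v unfolding bounded_from_hilbert_def by blast
  have norm_U: "norm (U f) = norm f" for f
  proof -
    have "complex_of_real ((norm (U f))\<^sup>2) = complex_of_real ((norm f)\<^sup>2)"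
      using U unfolding self_adjoint_unitary_def cinner_self[symmetric] by blast
    then show ?thesis by (simp only: of_real_eq_iff power2_eq_iff_nonneg norm_ge_zero)
  qed
  have adj_le: "norm (hilbert_adj v \<Phi>) \<le> fnorm (Linf s) \<Phi> * \<bar>C\<bar>"
    if \<Phi>: "\<Phi> \<in> fset (Linf s)" for \<Phi>
  proof (cases "hilbert_adj v \<Phi> = 0")
    case False
    let ?k = "hilbert_adj v \<Phi>"
    have "(norm ?k)\<^sup>2 = cmod (cinner ?k ?k)" by (simp only: cinner_self norm_of_real abs_power2)
    also have "\<dots> \<le> fnorm (Linf s) \<Phi> * fnorm (L1 s) (v ?k)"
      unfolding hilbert_adj_cinner[OF v \<Phi>] by (rule pairing_le[OF \<Phi> mem])
    also have "\<dots> \<le> fnorm (Linf s) \<Phi> * (\<bar>C\<bar> * norm ?k)"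
      by (intro mult_left_mono fnorm_ellinf_nonneg \<Phi> order_trans[OF C] mult_right_mono) auto
    finally show ?thesis using False by (simp add: power2_eq_square)
  qed (simp add: fnorm_ellinf_nonneg \<Phi>)
  define d where "d = e / (\<bar>C\<bar> + 1)"
  have d: "0 < d" "d * \<bar>C\<bar> \<le> e" using e by (auto simp: d_def field_simps)
  obtain F where F: "finite F"
    "\<And>f G. finite G \<Longrightarrow> G \<inter> F = {} \<Longrightarrow> (\<Sum>x\<in>G. om x ^ s * cmod (v f x)) \<le> d * norm f"
    using hilbert_adj_tail[OF v d(1)] by metis
  show ?thesis
  proof (rule that[OF F(1)])
    fix \<Phi> :: "('k, 'r) gfun" and G :: "('k, 'r) gvert set" assume \<Phi>: "\<Phi> \<in> fset (Linf s)" and G: "finite G" "G \<inter> F = {}"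
    have "(\<Sum>x\<in>G. om x ^ s * cmod (V \<Phi> x)) \<le> d * norm (hilbert_adj v \<Phi>)"
      using F(2)[OF G, of "U (hilbert_adj v \<Phi>)"] by (simp add: V[OF \<Phi>] norm_U)
    also have "\<dots> \<le> d * (fnorm (Linf s) \<Phi> * \<bar>C\<bar>)"
      by (rule mult_left_mono[OF adj_le[OF \<Phi>]]) (use d in auto)
    also have "\<dots> = (d * \<bar>C\<bar>) * fnorm (Linf s) \<Phi>" by simp
    also have "\<dots> \<le> e * fnorm (Linf s) \<Phi>"
      by (rule mult_right_mono[OF d(2) fnorm_ellinf_nonneg[OF \<Phi>]])
    finally show "(\<Sum>x\<in>G. om x ^ s * cmod (V \<Phi> x)) \<le> e * fnorm (Linf s) \<Phi>" .
  qed
qed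

section \<open>The free resolvent kernel\<close>

text \<open>The solution \<open>z\<close> of \<open>z + 1/z = 2 + \<kappa>\<^sup>2\<close> with \<open>\<bar>z\<bar> < 1\<close>, in the half-plane \<open>Re \<kappa> > 0\<close>.\<close>

definition zeta :: "complex \<Rightarrow> complex" where
  "zeta \<kappa> = (csqrt (1 + \<kappa>\<^sup>2 / 4) - \<kappa> / 2)\<^sup>2"

lemma zeta_0 [simp]: "zeta 0 = 1"
  by (simp add: zeta_def)

text \<open>The factors are square roots of \<open>zeta \<kappa>\<close> and of its inverse. Taking
  the root of \<open>1 + \<kappa>\<^sup>2 / 4\<close> rather than solving the quadratic equation for
  z keeps a branch that is holomorphic in \<kappa> across 0.\<close>

lemma zeta_factor: "(csqrt (1 + \<kappa>\<^sup>2 / 4) - \<kappa> / 2) * (csqrt (1 + \<kappa>\<^sup>2 / 4) + \<kappa> / 2) = 1"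
proof -
  have "(csqrt (1 + \<kappa>\<^sup>2 / 4) - \<kappa> / 2) * (csqrt (1 + \<kappa>\<^sup>2 / 4) + \<kappa> / 2) = (csqrt (1 + \<kappa>\<^sup>2 / 4))\<^sup>2 - \<kappa>\<^sup>2 / 4"
    by (simp add: power2_eq_square algebra_simps)
  then show ?thesis by (simp only: power2_csqrt) simp
qed

lemma zeta_nonzero: "zeta \<kappa> \<noteq> 0"
proof
  assume "zeta \<kappa> = 0"
  then have "csqrt (1 + \<kappa>\<^sup>2 / 4) - \<kappa> / 2 = 0" unfolding zeta_def by (simp only: power_eq_0_iff)
  then show False using zeta_factor[of \<kappa>] by (metis mult_zero_left zero_neq_one)
qed

lemma zeta_equation: "zeta \<kappa> + 1 / zeta \<kappa> = 2 + \<kappa>\<^sup>2"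
proof -
  let ?q = "csqrt (1 + \<kappa>\<^sup>2 / 4)"
  have "zeta \<kappa> * (?q + \<kappa> / 2)\<^sup>2 = 1"
    unfolding zeta_def power_mult_distrib[symmetric] zeta_factor by simp
  then have "1 / zeta \<kappa> = (?q + \<kappa> / 2)\<^sup>2"
    using zeta_nonzero[of \<kappa>] by (simp add: divide_eq_eq mult.commute)
  then have "zeta \<kappa> + 1 / zeta \<kappa> = 2 * ?q\<^sup>2 + \<kappa>\<^sup>2 / 2"
    by (simp add: zeta_def power2_sum power2_diff power_divide)
  then show ?thesis by (simp only: power2_csqrt) simp
qed

text \<open>The root \<open>q\<close> has positive real part, and comparing imaginary parts in its
  defining equation shows that \<open>Im q\<close> and \<open>Im \<kappa>\<close> do not have
  opposite signs. Hence \<open>q\<close> is closer to \<open>\<kappa> / 2\<close> than to its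
  negative, and the two distances have product 1.\<close>

lemma norm_zeta_less_1:
  assumes "0 < Re \<kappa>" "cmod \<kappa> < 1"
  shows "cmod (zeta \<kappa>) < 1"
proof -
  define q where "q = csqrt (1 + \<kappa>\<^sup>2 / 4)"
  have q2: "q\<^sup>2 = 1 + \<kappa>\<^sup>2 / 4" unfolding q_def by (rule power2_csqrt)
  have "\<bar>Re (\<kappa>\<^sup>2)\<bar> \<le> cmod (\<kappa>\<^sup>2)" by (rule abs_Re_le_cmod)
  also have "\<dots> < 1" using assms by (simp add: norm_power power_less_one_iff)
  finally have "0 < Re (q\<^sup>2)" unfolding q2 by simp
  then have "Re q \<noteq> 0" by (auto simp: power2_eq_square)
  then have Re_q: "0 < Re q" using csqrt_principal[of "1 + \<kappa>\<^sup>2 / 4"] by (auto simp: q_def)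
  have "Im (q\<^sup>2) = Im (1 + \<kappa>\<^sup>2 / 4)" using q2 by simp
  then have "2 * Re q * Im q = Re \<kappa> * Im \<kappa> / 2" by (simp add: power2_eq_square mult.commute)
  then have "2 * Re q * (Im q * Im \<kappa>) = Re \<kappa> * (Im \<kappa>)\<^sup>2 / 2"
    by (simp add: power2_eq_square algebra_simps)
  moreover have "0 \<le> Re \<kappa> * (Im \<kappa>)\<^sup>2 / 2" using assms by simp
  ultimately have "0 \<le> 2 * Re q * (Im q * Im \<kappa>)" by (simp only:)
  then have "0 \<le> Im q * Im \<kappa>" using Re_q by (simp add: zero_le_mult_iff)
  then have pos: "0 < Re q * Re \<kappa> + Im q * Im \<kappa>" using Re_q assms by (simp add: add_pos_nonneg)
  have "(cmod (q - \<kappa> / 2))\<^sup>2 < (cmod (q + \<kappa> / 2))\<^sup>2"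
    unfolding cmod_power2 using pos by (simp add: power2_eq_square algebra_simps)
  then have less: "cmod (q - \<kappa> / 2) < cmod (q + \<kappa> / 2)" by (rule power_less_imp_less_base) simp
  have "cmod (q - \<kappa> / 2) * cmod (q + \<kappa> / 2) = 1"
    using zeta_factor[of \<kappa>] by (metis norm_mult norm_one q_def)
  then have "cmod (q - \<kappa> / 2) < 1"
    using less mult_right_mono[of 1 "cmod (q - \<kappa> / 2)" "cmod (q + \<kappa> / 2)"] by fastforce
  then show ?thesis by (simp add: zeta_def norm_power power_less_one_iff flip: q_def)
qed

text \<open>Outside the half-plane \<open>zeta\<close> may exceed 1, but at most exponentially in
  \<kappa>. A power \<open>p\<close> of it is therefore bounded by e as soon as
  \<open>2 * p * cmod \<kappa> \<le> 1\<close>; this fixes the radius of the discs below.\<close>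

lemma norm_zeta_le: "cmod (zeta \<kappa>) \<le> exp (2 * cmod \<kappa>)"
proof -
  have "cmod (csqrt (1 + \<kappa>\<^sup>2 / 4)) \<le> 1 + cmod \<kappa> / 2"
  proof -
    have "(cmod (csqrt (1 + \<kappa>\<^sup>2 / 4)))\<^sup>2 = cmod (1 + \<kappa>\<^sup>2 / 4)" by (simp only: power2_csqrt flip: norm_power)
    also have "\<dots> \<le> 1 + (cmod \<kappa>)\<^sup>2 / 4"
      by (rule order_trans[OF norm_triangle_ineq]) (simp add: norm_divide norm_power)
    also have "\<dots> \<le> (1 + cmod \<kappa> / 2)\<^sup>2" by (simp add: power2_sum power_divide)
    finally show ?thesis by (rule power2_le_imp_le) simp
  qed
  then have "cmod (csqrt (1 + \<kappa>\<^sup>2 / 4) - \<kappa> / 2) \<le> 1 + cmod \<kappa>"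
    by (intro order_trans[OF norm_triangle_ineq4]) (simp add: norm_divide)
  also have "\<dots> \<le> exp (cmod \<kappa>)" by (rule exp_ge_add_one_self)
  finally have "(cmod (csqrt (1 + \<kappa>\<^sup>2 / 4) - \<kappa> / 2))\<^sup>2 \<le> (exp (cmod \<kappa>))\<^sup>2"
    by (rule power_mono) simp
  then show ?thesis by (simp add: zeta_def norm_power exp_double)
qed

lemma zeta_holomorphic: "zeta holomorphic_on ball 0 1"
proof -
  have "1 + \<kappa>\<^sup>2 / 4 \<notin> \<real>\<^sub>\<le>\<^sub>0" if "\<kappa> \<in> ball 0 1" for \<kappa> :: complex
  proof -
    have "\<bar>Re (\<kappa>\<^sup>2)\<bar> \<le> cmod (\<kappa>\<^sup>2)" by (rule abs_Re_le_cmod)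
    also have "\<dots> < 1" using that by (simp add: norm_power power_less_one_iff)
    finally have "0 < Re (1 + \<kappa>\<^sup>2 / 4)" by simp
    then show ?thesis by (auto simp: complex_nonpos_Reals_iff)
  qed
  then show ?thesis unfolding zeta_def by (intro holomorphic_intros) auto
qed

lemma one_plus_sq_nonzero:
  assumes "cmod \<kappa> < 1"
  shows "1 + \<kappa>\<^sup>2 \<noteq> 0"
proof
  assume "1 + \<kappa>\<^sup>2 = 0"
  then have "\<kappa>\<^sup>2 = - 1" by (simp add: eq_neg_iff_add_eq_0 add.commute)
  then have "cmod (\<kappa>\<^sup>2) = 1" by simp
  moreover have "cmod (\<kappa>\<^sup>2) < 1" using assms by (simp add: norm_power power_less_one_iff)
  ultimately show False by simp
qed

text \<open>On a ray this is the Dirichlet kernel from the method of images,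
  \<open>(z ^ |n - m| - z ^ (n + m + 2)) / (1 / z - z)\<close>, with the geometric series written
  out. The quotient is singular at z = 1, the value at \<kappa> = 0; the finite sum is not. The two
  truncated differences add up to the distance.\<close>

fun green :: "complex \<Rightarrow> ('k, 'r) gvert \<Rightarrow> ('k, 'r) gvert \<Rightarrow> complex" where
  "green \<kappa> (Core x) (Core y) = (if x = y then 1 / (1 + \<kappa>\<^sup>2) else 0)"
| "green \<kappa> (Ray a n) (Ray b m) = (if a = b then \<Sum>i\<le>min n m. zeta \<kappa> ^ ((n - m) + (m - n) + 1 + 2 * i) else 0)"
| "green \<kappa> (Core x) (Ray b m) = 0"
| "green \<kappa> (Ray a n) (Core y) = 0"

lemma green_commute: "green \<kappa> x y = green \<kappa> y x"
  by (cases x; cases y) (auto simp: min.commute add.commute)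

text \<open>On the core the free operator has finite rank, so it is moved to the perturbation.\<close>

fun D_op :: "('k, 'r) gop" where
  "D_op u (Core x) = u (Core x)"
| "D_op u (Ray a n) = h_ray (\<lambda>m. u (Ray a m)) n"

text \<open>The diagonal coefficient \<open>2 + c\<close> is \<open>z + 1 / z\<close>. Multiplying
  the sum \<open>K a d\<close> by z raises \<open>d\<close> by one and dividing lowers it, which
  reproduces the two neighbours; only on the diagonal does the division leave an extra 1.\<close>

lemma ray_kernel_equation:
  fixes z c :: complex
  assumes z: "z \<noteq> 0" "z + 1 / z = 2 + c"
  defines "S \<equiv> \<lambda>n m. \<Sum>i\<le>min n m. z ^ ((n - m) + (m - n) + 1 + 2 * i)"
  shows "h_ray (\<lambda>n. S n m) n + c * S n m = (if n = m then 1 else 0)"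
proof -
  define K where "K a d = (\<Sum>i\<le>a. z ^ (d + 1 + 2 * i))" for a d
  have S: "S n m = (if n \<le> m then K n (m - n) else K m (n - m))" for n m
    by (auto simp: S_def K_def min_def)
  have zz: "(2 + c) * w = z * w + w / z" for w
    using z(2)[symmetric] by (simp add: algebra_simps)
  have up: "z * K a d = K a (Suc d)" for a d by (simp add: K_def sum_distrib_left mult_ac)
  then have down: "K a (Suc d) / z = K a d" for a d
    using z(1) by (metis nonzero_mult_div_cancel_left)
  have ext: "K (Suc a) d = K a d + z ^ (d + 1 + 2 * Suc a)" for a d by (simp add: K_def)
  have K0: "K 0 d = z ^ (d + 1)" for d by (simp add: K_def)
  have down0: "K (Suc a) 0 / z = 1 + K a 1" for a
  proof -
    have "K (Suc a) 0 = z * (\<Sum>i\<le>Suc a. z ^ (2 * i))" by (simp add: K_def sum_distrib_left distrib_left)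
    also have "(\<Sum>i\<le>Suc a. z ^ (2 * i)) = 1 + K a 1"
      by (subst sum.atMost_Suc_shift) (simp add: K_def)
    finally show ?thesis using z(1) by simp
  qed
  have main: "(2 + c) * S n m - S (Suc n) m - (case n of 0 \<Rightarrow> 0 | Suc k \<Rightarrow> S k m) = (if n = m then 1 else 0)"
  proof (cases rule: linorder_cases[of n m])
    case less
    then obtain d where d: "m = n + Suc d" using less_imp_Suc_add by auto
    show ?thesis
    proof (cases n)
      case 0
      then show ?thesis using d z(1) unfolding zz by (simp add: S up down ext K0)
    next
      case (Suc k)
      have S1: "S n m = K n (Suc d)" and S2: "S (Suc n) m = K (Suc n) d" and S3: "S k m = K k (Suc (Suc d))"
        using d Suc by (auto simp: S)
      have "K n (Suc (Suc d)) = K k (Suc (Suc d)) + z ^ (d + 1 + 2 * Suc n)"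
        using ext[of k "Suc (Suc d)"] Suc by simp
      then have "(2 + c) * S n m - S (Suc n) m - S k m = 0"
        unfolding zz S1 S2 S3 up down ext by simp
      then show ?thesis using d Suc by simp
    qed
  next
    case equal
    show ?thesis
    proof (cases n)
      case 0
      then show ?thesis using equal z(1) unfolding zz by (simp add: S K0 power2_eq_square)
    next
      case (Suc k)
      have S1: "S (Suc k) (Suc k) = K (Suc k) 0" and S2: "S (Suc (Suc k)) (Suc k) = K (Suc k) 1"
        and S3: "S k (Suc k) = K k 1"
        by (simp_all add: S)
      have "(2 + c) * S (Suc k) (Suc k) - S (Suc (Suc k)) (Suc k) - S k (Suc k) = 1"
        unfolding zz S1 S2 S3 up down0 by simp
      then show ?thesis using Suc unfolding equal[symmetric] by simp
    qed
  next
    case greater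
    then obtain d where d: "n = m + Suc d" using less_imp_Suc_add by auto
    have "S n m = K m (Suc d)" "S (Suc n) m = K m (Suc (Suc d))" "S (m + d) m = K m d"
      using d by (auto simp: S)
    then show ?thesis using d unfolding zz by (simp add: up down)
  qed
  show ?thesis using main by (cases n) (simp_all add: algebra_simps)
qed

lemma green_equation:
  assumes "cmod \<kappa> < 1"
  shows "D_op (\<lambda>x. green \<kappa> x y) x + \<kappa>\<^sup>2 * green \<kappa> x y = (if x = y then 1 else 0)"
proof (cases x)
  case (Core c)
  have "1 + \<kappa>\<^sup>2 \<noteq> 0"
    by (rule one_plus_sq_nonzero[OF assms])
  then have "1 / (1 + \<kappa>\<^sup>2) + \<kappa>\<^sup>2 / (1 + \<kappa>\<^sup>2) = 1" by (simp flip: add_divide_distrib)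
  then show ?thesis using Core by (cases y) auto
next
  case (Ray a n)
  show ?thesis
  proof (cases y)
    case (Core c)
    then show ?thesis using Ray by (cases n) auto
  next
    case (Ray b m)
    show ?thesis
    proof (cases "a = b")
      case True
      then show ?thesis
        using Ray \<open>x = Ray a n\<close> ray_kernel_equation[OF zeta_nonzero zeta_equation, of \<kappa> m n] by simp
    next
      case False
      then show ?thesis using Ray \<open>x = Ray a n\<close> by (cases n) auto
    qed
  qed
qed

lemma green_holomorphic: "(\<lambda>\<kappa>. green \<kappa> x y) holomorphic_on ball 0 1"
proof -
  have core: "(\<lambda>\<kappa>. green \<kappa> (Core c) (Core d :: ('a, 'b) gvert)) holomorphic_on ball 0 1" for c d
  proof (cases "c = d")
    case True
    have "(\<lambda>\<kappa>::complex. 1 / (1 + \<kappa>\<^sup>2)) holomorphic_on ball 0 1"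
      by (intro holomorphic_on_divide holomorphic_on_const holomorphic_on_add holomorphic_on_power
          holomorphic_on_ident one_plus_sq_nonzero) simp
    then show ?thesis using True by simp
  qed simp
  have ray: "(\<lambda>\<kappa>. green \<kappa> (Ray a n) (Ray b m :: ('a, 'b) gvert)) holomorphic_on ball 0 1" for a b n m
    by (cases "a = b") (auto intro!: holomorphic_intros zeta_holomorphic)
  show ?thesis
    by (cases x; cases y) (simp_all only: green.simps(3,4) core ray holomorphic_on_const)
qed

text \<open>The kernel is bounded as for \<open>\<kappa> = 0\<close> on the disc of radius \<open>1 / (2 * green_scale x y)\<close>.\<close>

fun green_scale :: "('k, 'r) gvert \<Rightarrow> ('k, 'r) gvert \<Rightarrow> real" where
  "green_scale (Ray a n) (Ray b m) = real (n + m + 2)"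
| "green_scale x y = 1"

lemma green_scale_ge_1: "1 \<le> green_scale x y"
  by (cases "(x, y)" rule: green_scale.cases) auto

lemma om_mult_ge_1: "1 \<le> om x * om y"
  using mult_mono[OF om_ge_1 om_ge_1, of x y] by simp

lemma green_scale_le: "green_scale x y \<le> 2 * (om x * om y)"
proof (cases "(x, y)" rule: green_scale.cases)
  case (1 a n b m)
  have "real (n + m + 2) \<le> 2 * ((real n + 1) * (real m + 1))" by (simp add: algebra_simps)
  also have "\<dots> \<le> 2 * (om (Ray a n) * om (Ray b m))"
    by (intro mult_left_mono mult_mono om_Ray_ge) auto
  finally show ?thesis using 1 by simp
qed (use om_mult_ge_1[of x y] in auto)

lemma norm_inverse_1_plus_sq_le:
  assumes "cmod \<kappa> \<le> 1 / 2"
  shows "cmod (1 / (1 + \<kappa>\<^sup>2)) \<le> 3"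
proof -
  have "cmod (\<kappa>\<^sup>2) \<le> (1 / 2)\<^sup>2" unfolding norm_power by (rule power_mono) (use assms in auto)
  then have "3 / 4 \<le> cmod (1 + \<kappa>\<^sup>2)"
    using norm_triangle_ineq2[of 1 "- (\<kappa>\<^sup>2)"] by (simp add: power2_eq_square)
  then have "1 \<le> 3 * cmod (1 + \<kappa>\<^sup>2)" "0 < cmod (1 + \<kappa>\<^sup>2)" by linarith+
  then show ?thesis by (simp add: norm_divide divide_le_eq)
qed

text \<open>The disc serves the Taylor coefficients, the half-plane the value at \<kappa> itself in
  the remainder. In both regions every power of z in the kernel is at most 3, and the number of
  terms, \<open>min n m + 1\<close>, is bounded by either weight.\<close>

lemma norm_green_le:
  assumes "cmod \<kappa> \<le> 1 / (2 * green_scale x y) \<or> 0 < Re \<kappa> \<and> cmod \<kappa> \<le> 1 / 2"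
  shows "cmod (green \<kappa> x y) \<le> 3 * (om x * om y)"
proof (cases "(x, y)" rule: green_scale.cases)
  case (1 a n b m)
  have pow: "cmod (zeta \<kappa>) ^ p \<le> 3" if p: "p \<le> n + m + 2" for p
  proof (cases "0 < Re \<kappa> \<and> cmod \<kappa> \<le> 1 / 2")
    case True
    then have "cmod (zeta \<kappa>) \<le> 1" using norm_zeta_less_1[of \<kappa>] by simp
    then have "cmod (zeta \<kappa>) ^ p \<le> 1" by (simp add: power_le_one)
    then show ?thesis by simp
  next
    case False
    then have "cmod \<kappa> \<le> 1 / (2 * real (n + m + 2))" using assms 1 by auto
    then have "2 * cmod \<kappa> * real (n + m + 2) \<le> 1" by (simp add: field_simps)
    moreover have "real p * (2 * cmod \<kappa>) \<le> real (n + m + 2) * (2 * cmod \<kappa>)"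
      using p by (intro mult_right_mono) auto
    ultimately have le: "real p * (2 * cmod \<kappa>) \<le> 1" by (simp add: mult.commute)
    have "cmod (zeta \<kappa>) ^ p \<le> exp (2 * cmod \<kappa>) ^ p" by (rule power_mono[OF norm_zeta_le]) simp
    also have "\<dots> = exp (real p * (2 * cmod \<kappa>))" by (rule exp_of_nat_mult[symmetric])
    also have "\<dots> \<le> exp 1" using le by simp
    also have "\<dots> \<le> 3" by (rule exp_le)
    finally show ?thesis .
  qed
  have "cmod (green \<kappa> x y) \<le> (\<Sum>i\<le>min n m. 3)"
  proof (cases "a = b")
    case True
    then have "cmod (green \<kappa> x y) = cmod (\<Sum>i\<le>min n m. zeta \<kappa> ^ ((n - m) + (m - n) + 1 + 2 * i))"
      using 1 by simp
    also have "\<dots> \<le> (\<Sum>i\<le>min n m. 3)"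
      by (rule sum_norm_le) (auto simp only: norm_power intro!: pow)
    finally show ?thesis .
  qed (use 1 in auto)
  also have "\<dots> \<le> 3 * ((real n + 1) * 1)" by (simp add: min_def)
  also have "\<dots> \<le> 3 * (om (Ray a n) * om (Ray b m))"
    by (intro mult_left_mono mult_mono om_Ray_ge om_ge_1) auto
  finally show ?thesis using 1 by simp
next
  case ("2_1" c w)
  have "cmod \<kappa> \<le> 1 / 2" using assms "2_1" by auto
  then have "cmod (green \<kappa> x y) \<le> 3" using "2_1" norm_inverse_1_plus_sq_le by (cases w) auto
  then show ?thesis using om_mult_ge_1[of x y] by linarith
next
  case ("2_2" w c)
  have "cmod \<kappa> \<le> 1 / 2" using assms "2_2" by auto
  then have "cmod (green \<kappa> x y) \<le> 3" using "2_2" norm_inverse_1_plus_sq_le by (cases w) auto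
  then show ?thesis using om_mult_ge_1[of x y] by linarith
qed

section \<open>Taylor expansion\<close>

definition tcoeff :: "(complex \<Rightarrow> complex) \<Rightarrow> nat \<Rightarrow> complex" where
  "tcoeff F j = (deriv ^^ j) F 0 / fact j"

lemma norm_tcoeff_le:
  assumes hol: "F holomorphic_on ball 0 R" and r: "0 < \<rho>" "\<rho> < R"
    and B: "\<And>\<kappa>. cmod \<kappa> \<le> \<rho> \<Longrightarrow> cmod (F \<kappa>) \<le> B"
  shows "cmod (tcoeff F j) \<le> B * (1 / \<rho>) ^ j"
proof -
  have "cmod ((deriv ^^ j) F 0) \<le> fact j * B / \<rho> ^ j"
  proof (rule Cauchy_inequality)
    show "F holomorphic_on ball 0 \<rho>" by (rule holomorphic_on_subset[OF hol]) (use r in auto)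
    show "continuous_on (cball 0 \<rho>) F"
      by (rule holomorphic_on_imp_continuous_on[OF holomorphic_on_subset[OF hol]]) (use r in auto)
  qed (use r B in auto)
  then show ?thesis by (simp add: tcoeff_def norm_divide field_simps)
qed

text \<open>For \<open>\<bar>\<kappa>\<bar> \<ge> \<rho>/2\<close> the estimate is trivial, since then \<open>2\<bar>\<kappa>\<bar>/\<rho> \<ge> 1\<close>.\<close>

lemma taylor_remainder_le:
  assumes hol: "F holomorphic_on ball 0 R" and r: "0 < \<rho>" "\<rho> < R"
    and B: "\<And>\<kappa>. cmod \<kappa> \<le> \<rho> \<Longrightarrow> cmod (F \<kappa>) \<le> B" and F\<kappa>: "cmod (F \<kappa>) \<le> B"
  shows "cmod (F \<kappa> - (\<Sum>j<M. \<kappa> ^ j * tcoeff F j)) \<le> real (M + 2) * B * (2 * cmod \<kappa> / \<rho>) ^ M"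
proof -
  have B0: "0 \<le> B" using B[of 0] r by (metis less_imp_le norm_ge_zero norm_zero order_trans)
  define t where "t = cmod \<kappa> / \<rho>"
  have t0: "0 \<le> t" using r by (simp add: t_def)
  have term_le: "cmod (\<kappa> ^ j * tcoeff F j) \<le> B * t ^ j" for j
    using mult_left_mono[OF norm_tcoeff_le[OF hol r B, of j], of "cmod \<kappa> ^ j"]
    by (simp add: norm_mult norm_power t_def power_divide mult_ac)
  \<comment> \<open>The factor \<open>M + 2\<close> covers both cases: the geometric tail
    contributes 2 for small \<open>t\<close>; otherwise there are \<open>M\<close> terms of the
    polynomial and the value of \<open>F\<close>, each at most
    \<open>B * (2 * t) ^ M\<close>.\<close>
  show ?thesis
  proof (cases "t \<le> 1 / 2")
    case True
    then have \<kappa>: "\<kappa> \<in> ball 0 R" using r by (simp add: t_def divide_le_eq)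
    have "(\<lambda>j. tcoeff F j * (\<kappa> - 0) ^ j) sums F \<kappa>"
      using holomorphic_power_series[OF hol \<kappa>] unfolding tcoeff_def by simp
    then have sums: "(\<lambda>j. \<kappa> ^ j * tcoeff F j) sums F \<kappa>" by (simp add: mult.commute)
    have sm: "summable (\<lambda>j. \<kappa> ^ j * tcoeff F j)" using sums by (rule sums_summable)
    have geo: "(\<lambda>j. B * t ^ M * t ^ j) sums (B * t ^ M * (1 / (1 - t)))"
      by (intro sums_mult geometric_sums) (use True t0 in auto)
    have "F \<kappa> - (\<Sum>j<M. \<kappa> ^ j * tcoeff F j) = (\<Sum>j. \<kappa> ^ (j + M) * tcoeff F (j + M))"
      using suminf_minus_initial_segment[OF sm, of M] sums_unique[OF sums] by simp
    also have "cmod \<dots> \<le> (\<Sum>j. B * t ^ M * t ^ j)"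
    proof (rule norm_suminf_le[OF _ sums_summable[OF geo]])
      show "cmod (\<kappa> ^ (j + M) * tcoeff F (j + M)) \<le> B * t ^ M * t ^ j" for j
        using term_le[of "j + M"] by (simp add: power_add mult_ac)
    qed
    also have "\<dots> = B * t ^ M * (1 / (1 - t))" using sums_unique[OF geo] by simp
    also have "\<dots> \<le> B * t ^ M * 2"
      by (intro mult_left_mono) (use True B0 t0 in \<open>auto simp: field_simps\<close>)
    also have "\<dots> \<le> real (M + 2) * B * (2 * t) ^ M"
    proof -
      have "t ^ M \<le> (2 * t) ^ M" by (rule power_mono) (use t0 in auto)
      then have "2 * B * t ^ M \<le> real (M + 2) * B * (2 * t) ^ M"
        by (intro mult_mono) (use B0 t0 in auto)
      then show ?thesis by (simp add: mult_ac)
    qed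
    finally show ?thesis by (simp add: t_def)
  next
    case False
    then have t: "1 \<le> 2 * t" by simp
    have "cmod (\<kappa> ^ j * tcoeff F j) \<le> B * (2 * t) ^ M" if "j < M" for j
    proof -
      have "t ^ j \<le> (2 * t) ^ j" by (rule power_mono) (use t0 in auto)
      also have "\<dots> \<le> (2 * t) ^ M" by (rule power_increasing[OF _ t]) (use that in auto)
      finally show ?thesis using term_le[of j] B0 by (meson mult_left_mono order_trans)
    qed
    then have "cmod (\<Sum>j<M. \<kappa> ^ j * tcoeff F j) \<le> (\<Sum>j<M. B * (2 * t) ^ M)"
      by (intro sum_norm_le) auto
    moreover have "cmod (F \<kappa>) \<le> B * (2 * t) ^ M"
      using F\<kappa> mult_left_mono[OF one_le_power[OF t, of M] B0] by simp
    moreover have "0 \<le> B * (2 * t) ^ M" using B0 t0 by simp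
    ultimately have "cmod (F \<kappa> - (\<Sum>j<M. \<kappa> ^ j * tcoeff F j)) \<le> real (M + 2) * (B * (2 * t) ^ M)"
      using norm_triangle_ineq4[of "F \<kappa>" "\<Sum>j<M. \<kappa> ^ j * tcoeff F j"]
      by (simp add: algebra_simps)
    then show ?thesis by (simp add: t_def)
  qed
qed

definition green_coeff :: "nat \<Rightarrow> ('k, 'r) gvert \<Rightarrow> ('k, 'r) gvert \<Rightarrow> complex" where
  "green_coeff j x y = tcoeff (\<lambda>\<kappa>. green \<kappa> x y) j"

lemma green_coeff_0: "green_coeff 0 x y = green 0 x y"
  by (simp add: green_coeff_def tcoeff_def)

lemma green_scale_radius: "0 < 1 / (2 * green_scale x y)" "1 / (2 * green_scale x y) < 1"
  using green_scale_ge_1[of x y] by (auto simp: divide_less_eq)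

text \<open>Cauchy's inequality on the disc of radius \<open>1 / (2 * green_scale x y)\<close>. Each
  derivative costs the inverse radius, at most \<open>4 * (om x * om y)\<close>: one weight on each
  side per order, beyond the one already present at order 0.\<close>

lemma norm_green_coeff_le: "cmod (green_coeff j x y) \<le> (3 * 4 ^ j) * (om x * om y) ^ Suc j"
proof -
  have "cmod (green_coeff j x y) \<le> 3 * (om x * om y) * (1 / (1 / (2 * green_scale x y))) ^ j"
    unfolding green_coeff_def by (rule norm_tcoeff_le[OF green_holomorphic green_scale_radius]) (use norm_green_le in blast)
  also have "\<dots> \<le> 3 * (om x * om y) * (4 * (om x * om y)) ^ j"
    by (intro mult_left_mono power_mono) (use green_scale_le[of x y] green_scale_ge_1[of x y] in auto)
  finally show ?thesis by (simp add: power_mult_distrib mult_ac)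
qed

text \<open>Far out on the rays \<kappa> leaves the disc where the Taylor series is controlled.
  There the bound in the half-plane and the crude case of \<open>taylor_remainder_le\<close> take
  over, so the estimate is uniform in the points.\<close>

lemma green_expansion:
  assumes "0 < Re \<kappa>" "cmod \<kappa> \<le> 1 / 2"
  shows "cmod (green \<kappa> x y - (\<Sum>j<M. \<kappa> ^ j * green_coeff j x y))
    \<le> (3 * real (M + 2) * 8 ^ M) * cmod \<kappa> ^ M * (om x * om y) ^ Suc M"
proof -
  have "cmod (green \<kappa> x y - (\<Sum>j<M. \<kappa> ^ j * green_coeff j x y))
      \<le> real (M + 2) * (3 * (om x * om y)) * (2 * cmod \<kappa> / (1 / (2 * green_scale x y))) ^ M"
    unfolding green_coeff_def
    by (rule taylor_remainder_le[OF green_holomorphic green_scale_radius]) (use norm_green_le assms in blast)+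
  also have "\<dots> \<le> real (M + 2) * (3 * (om x * om y)) * (8 * cmod \<kappa> * (om x * om y)) ^ M"
  proof (intro mult_left_mono power_mono)
    show "2 * cmod \<kappa> / (1 / (2 * green_scale x y)) \<le> 8 * cmod \<kappa> * (om x * om y)"
      using mult_left_mono[OF green_scale_le[of x y], of "4 * cmod \<kappa>"] by simp
    show "0 \<le> 2 * cmod \<kappa> / (1 / (2 * green_scale x y))" using green_scale_ge_1[of x y] by simp
  qed auto
  finally show ?thesis by (simp add: power_mult_distrib mult_ac)
qed

text \<open>At the threshold the kernel on a ray is the minimum of the two points, so the weight of
  one argument suffices. Hence G_0 produces bounded functions, on which several later arguments
  depend.\<close>

lemma norm_green_coeff_0_le: "cmod (green_coeff 0 x y) \<le> om y"
proof (cases "(x, y)" rule: green_scale.cases)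
  case (1 a n b m)
  have "green_coeff 0 x y = (if a = b then of_nat (Suc (min n m)) else 0)" using 1 by (simp add: green_coeff_0)
  then have "cmod (green_coeff 0 x y) \<le> real m + 1" by (simp only: norm_of_nat split: if_split) auto
  moreover have "real m + 1 \<le> om y" using 1 by (simp add: om_Ray_ge)
  ultimately show ?thesis by linarith
next
  case ("2_1" c w)
  then show ?thesis by (cases w) (auto simp: green_coeff_0)
next
  case ("2_2" w c)
  then show ?thesis by (cases w) (auto simp: green_coeff_0)
qed

section \<open>Perturbations of the identity in Banach spaces\<close>

text \<open>Solutions of \<open>y + S y = z\<close> are the fixed points of the contraction taking
  \<open>y\<close> to \<open>z - S y\<close>.\<close>

lemma neumann_inverse:
  fixes S :: "'a::banach \<Rightarrow> 'a"
  assumes S: "bounded_linear S" and c: "0 \<le> c" "c < 1" "\<And>y. norm (S y) \<le> c * norm y"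
  shows "\<exists>N. bounded_linear N \<and> (\<forall>z. N z + S (N z) = z) \<and> (\<forall>y. N (y + S y) = y) \<and>
    (\<forall>z. norm (N z) \<le> norm z / (1 - c))"
proof -
  interpret S: bounded_linear S by (rule S)
  have ex1: "\<exists>!y. y + S y = z" for z
  proof -
    have "dist (z - S x) (z - S y) \<le> c * dist x y" for x y
      using c(3)[of "y - x"] by (simp add: dist_norm norm_minus_commute S.diff)
    then have "\<exists>!y. z - S y = y" by (intro banach_fix_type[OF c(1,2)]) blast
    moreover have "z - S y = y \<longleftrightarrow> y + S y = z" for y by (auto simp only: diff_eq_eq)
    ultimately show ?thesis by simp
  qed
  define N where "N z = (THE y. y + S y = z)" for z
  have N: "N z + S (N z) = z" for z using theI'[OF ex1] unfolding N_def by blast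
  have N_eq: "N z = y" if "y + S y = z" for y z using ex1 N that by blast
  have le: "norm (N z) \<le> norm z / (1 - c)" for z
  proof -
    have "norm (N z) \<le> norm (N z + S (N z)) + norm (S (N z))"
      using norm_triangle_ineq4[of "N z + S (N z)" "S (N z)"] by simp
    then have "norm (N z) \<le> norm z + c * norm (N z)" using c(3)[of "N z"] N[of z] by simp
    then show ?thesis using c by (simp add: field_simps)
  qed
  have "bounded_linear N"
  proof (rule bounded_linear_intro)
    fix x y and r :: real
    have "(N x + N y) + S (N x + N y) = (N x + S (N x)) + (N y + S (N y))"
      by (simp only: S.add add_ac)
    then show "N (x + y) = N x + N y" by (intro N_eq) (simp only: N)
    have "r *\<^sub>R N x + S (r *\<^sub>R N x) = r *\<^sub>R (N x + S (N x))"
      by (simp only: S.scaleR scaleR_add_right)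
    then show "N (r *\<^sub>R x) = r *\<^sub>R N x" by (intro N_eq) (simp only: N)
    show "norm (N z) \<le> norm z * (1 / (1 - c))" for z using le[of z] by simp
  qed
  then show ?thesis by (intro exI[of _ N] conjI allI N N_eq le refl)
qed

text \<open>A dimension count inside an arbitrary real vector space: the image of a basis of the
  span is independent and equally large, so a vector outside its span would give too many
  independent vectors.\<close>

lemma linear_inj_on_span_imp_onto:
  fixes J :: "'a::real_vector \<Rightarrow> 'a"
  assumes J: "linear J" "inj_on J (span B)" "J ` span B \<subseteq> span B" and B: "finite B"
  shows "J ` span B = span B"
proof
  obtain B0 where B0: "B0 \<subseteq> B" "independent B0" "span B0 = span B"
    by (metis maximal_independent_subset span_mono span_superset span_span subset_antisym)
  have fin: "finite B0" using finite_subset[OF B0(1) B] .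
  have inj: "inj_on J (span B0)" using J(2) B0(3) by simp
  have ind: "independent (J ` B0)" by (rule linear_independent_injective_image[OF J(1) B0(2) inj])
  have sub: "J ` B0 \<subseteq> span B0" using J(3) B0 span_superset by blast
  have card: "card (J ` B0) = card B0"
    by (rule card_image[OF inj_on_subset[OF inj span_superset]])
  show "span B \<subseteq> J ` span B"
  proof
    fix w assume w: "w \<in> span B"
    have "w \<in> span (J ` B0)"
    proof (rule ccontr)
      assume notin: "w \<notin> span (J ` B0)"
      then have "independent (insert w (J ` B0))" by (simp add: independent_insert ind)
      moreover have "insert w (J ` B0) \<subseteq> span B0" using w sub B0(3) by blast
      ultimately have "card (insert w (J ` B0)) \<le> card B0"
        using independent_span_bound[OF fin] by blast
      moreover have nin: "w \<notin> J ` B0" using notin span_base[of w "J ` B0"] by blast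
      have "card (insert w (J ` B0)) = Suc (card B0)"
        unfolding card_insert_disjoint[OF finite_imageI[OF fin] nin] card ..
      ultimately show False by simp
    qed
    then show "w \<in> J ` span B" by (simp add: linear_span_image[OF J(1)] B0(3))
  qed
qed (rule J(3))

text \<open>With N the inverse of \<open>1 + S\<close>, the operator \<open>J = (1 + T) N\<close> is
  the identity plus a finite rank operator. Injectivity of \<open>1 + T\<close> passes to
  \<open>J\<close>, and surjectivity is needed only on the span of the \<open>e i\<close>, where it
  is linear algebra.\<close>

theorem fredholm_alternative:
  fixes T S :: "'a::banach \<Rightarrow> 'a"
  assumes T: "\<And>y. T y = (\<Sum>i\<in>I. \<phi> i y *\<^sub>R e i) + S y" and I: "finite I"
    and \<phi>: "\<And>i. i \<in> I \<Longrightarrow> bounded_linear (\<phi> i)"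
    and S: "bounded_linear S" and c: "0 \<le> c" "c < 1" "\<And>y. norm (S y) \<le> c * norm y"
    and inj: "\<And>y. y + T y = 0 \<Longrightarrow> y = 0"
  shows "\<exists>L. bounded_linear L \<and> (\<forall>z. L z + T (L z) = z) \<and> (\<forall>y. L (y + T y) = y)"
proof -
  obtain N where N: "bounded_linear N" "\<And>z. N z + S (N z) = z" "\<And>y. N (y + S y) = y"
    using neumann_inverse[OF S c] by blast
  interpret N: bounded_linear N by (rule N(1))
  interpret S: bounded_linear S by (rule S)
  define J where "J w = w + (\<Sum>i\<in>I. \<phi> i (N w) *\<^sub>R e i)" for w
  have J: "N w + T (N w) = J w" for w
    using N(2)[of w] by (simp add: T J_def algebra_simps)
  have "linear (\<lambda>y. (\<Sum>i\<in>I. \<phi> i y *\<^sub>R e i) + S y)"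
    by (intro linear_compose_add linear_compose_sum ballI bounded_linear.linear
        bounded_linear_scaleR_const \<phi> S)
  moreover have "T = (\<lambda>y. (\<Sum>i\<in>I. \<phi> i y *\<^sub>R e i) + S y)" by (rule ext) (rule T)
  ultimately have linear_T: "linear T" by simp
  have "linear (\<lambda>w. N w + T (N w))"
    by (intro linear_compose_add N.linear linear_compose[OF N.linear linear_T, unfolded o_def])
  then have lin_J: "linear J" by (simp only: J)
  have J_inj: "w = 0" if "J w = 0" for w
  proof -
    have "N w = 0" by (rule inj) (simp only: J that)
    then show ?thesis using N(2)[of w] by (simp add: S.zero)
  qed
  have "inj J" using linear_injective_0[OF lin_J] J_inj by blast
  then have inj_J: "inj_on J (span (e ` I))" by (rule inj_on_subset) simp
  have e: "(\<Sum>i\<in>I. a i *\<^sub>R e i) \<in> span (e ` I)" for a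
    by (intro span_sum span_scale span_base) auto
  have "J ` span (e ` I) \<subseteq> span (e ` I)" unfolding J_def by (auto intro!: span_add e)
  then have onto: "J ` span (e ` I) = span (e ` I)"
    by (rule linear_inj_on_span_imp_onto[OF lin_J inj_J]) (use I in auto)
  have "\<exists>w. J w = e i" if "i \<in> I" for i
  proof -
    have "e i \<in> J ` span (e ` I)" unfolding onto using that by (auto intro: span_base)
    then show ?thesis by auto
  qed
  then obtain w where w: "\<And>i. i \<in> I \<Longrightarrow> J (w i) = e i" by metis
  \<comment> \<open>\<open>J z\<close> differs from \<open>z\<close> by the combination of the
    \<open>e i\<close> with coefficients \<open>\<phi> i (N z)\<close>; subtracting the same
    combination of their preimages \<open>w i\<close> inverts \<open>J\<close>. The formula is
    visibly bounded.\<close>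
  define L where "L z = N (z - (\<Sum>i\<in>I. \<phi> i (N z) *\<^sub>R w i))" for z
  have bl: "bounded_linear L"
  proof -
    have "bounded_linear (\<lambda>z. \<phi> i (N z) *\<^sub>R w i)" if "i \<in> I" for i
      by (rule bounded_linear_scaleR_const[OF bounded_linear_compose[OF \<phi>[OF that] N(1)]])
    then show ?thesis unfolding L_def
      by (intro bounded_linear_compose[OF N(1)] bounded_linear_sub bounded_linear_ident bounded_linear_sum)
  qed
  have right: "L z + T (L z) = z" for z
  proof -
    have "L z + T (L z) = J z - (\<Sum>i\<in>I. \<phi> i (N z) *\<^sub>R J (w i))"
      unfolding L_def J by (simp add: linear_diff[OF lin_J] linear_sum[OF lin_J] linear_scale[OF lin_J])
    also have "(\<Sum>i\<in>I. \<phi> i (N z) *\<^sub>R J (w i)) = (\<Sum>i\<in>I. \<phi> i (N z) *\<^sub>R e i)"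
      by (rule sum.cong) (simp_all only: w)
    also have "J z - \<dots> = z" by (simp add: J_def)
    finally show ?thesis .
  qed
  have left: "L (y + T y) = y" for y
  proof -
    have "T (L (y + T y) - y) = T (L (y + T y)) - T y" by (rule linear_diff[OF linear_T])
    then have "(L (y + T y) - y) + T (L (y + T y) - y) = (L (y + T y) + T (L (y + T y))) - (y + T y)"
      by (simp only: add_diff_add)
    also have "\<dots> = 0" by (simp only: right diff_self)
    finally have "L (y + T y) - y = 0" by (rule inj)
    then show ?thesis by (simp only: right_minus_eq)
  qed
  show ?thesis by (intro exI[of _ L] conjI allI bl right left)
qed

text \<open>Needed before any injectivity is available: applied to H itself, it bounds the dimension
  of the eigenspace from which P is built. The equation \<open>y + T y = 0\<close> expresses
  \<open>(1 + S) y\<close> by the \<open>e i\<close>, so the vectors \<open>N (e i)\<close>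
  span.\<close>

lemma fredholm_kernel_subset_span:
  fixes T S :: "'a::banach \<Rightarrow> 'a"
  assumes T: "\<And>y. T y = (\<Sum>i\<in>I. \<phi> i y *\<^sub>R e i) + S y" and I: "finite I"
    and S: "bounded_linear S" and c: "0 \<le> c" "c < 1" "\<And>y. norm (S y) \<le> c * norm y"
  shows "\<exists>B. finite B \<and> card B \<le> card I \<and> {y. y + T y = 0} \<subseteq> span B"
proof -
  obtain N where N: "bounded_linear N" "\<And>y. N (y + S y) = y"
    using neumann_inverse[OF S c] by blast
  interpret N: bounded_linear N by (rule N(1))
  have "y \<in> span ((\<lambda>i. N (e i)) ` I)" if "y + T y = 0" for y
  proof -
    have "y + S y = - (\<Sum>i\<in>I. \<phi> i y *\<^sub>R e i)" using that by (simp add: T eq_neg_iff_add_eq_0 algebra_simps)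
    then have "y = - (\<Sum>i\<in>I. \<phi> i y *\<^sub>R N (e i))"
      using N(2)[of y] by (simp add: linear_neg[OF bounded_linear.linear[OF N(1)]] N.sum N.scaleR)
    also have "\<dots> \<in> span ((\<lambda>i. N (e i)) ` I)"
      by (intro span_neg span_sum span_scale span_base) auto
    finally show ?thesis .
  qed
  then show ?thesis using I card_image_le[OF I]
    by (intro exI[of _ "(\<lambda>i. N (e i)) ` I"]) auto
qed

section \<open>Weighted bounded functions as a Banach space\<close>

text \<open>
  Completeness of the space of bounded continuous functions is available for metric index types only;
  for the discrete metric every function is continuous.
\<close>

instantiation gvert :: (type, type) metric_space
begin

definition dist_gvert :: "('a, 'b) gvert \<Rightarrow> ('a, 'b) gvert \<Rightarrow> real" where
  "dist_gvert x y = (if x = y then 0 else 1)"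

definition uniformity_gvert :: "(('a, 'b) gvert \<times> ('a, 'b) gvert) filter" where
  "uniformity_gvert = (INF e\<in>{0<..}. principal {(x, y). dist x y < e})"

definition open_gvert :: "('a, 'b) gvert set \<Rightarrow> bool" where
  "open_gvert U \<longleftrightarrow> (\<forall>x\<in>U. \<forall>\<^sub>F (x', y) in uniformity. x' = x \<longrightarrow> y \<in> U)"

instance
  by standard (auto simp: dist_gvert_def uniformity_gvert_def open_gvert_def)

end

instance gvert :: (type, type) discrete_topology
  by standard (auto simp: open_dist dist_gvert_def intro!: exI[of _ 1])

instance bcontfun :: (metric_space, banach) banach ..

type_synonym ('k, 'r) bfun = "('k, 'r) gvert \<Rightarrow>\<^sub>C complex"

definition of_bfun :: "nat \<Rightarrow> ('k, 'r) bfun \<Rightarrow> ('k, 'r) gfun" where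
  "of_bfun s y = (\<lambda>x. om x ^ s * apply_bcontfun y x)"

definition to_bfun :: "nat \<Rightarrow> ('k, 'r) gfun \<Rightarrow> ('k, 'r) bfun" where
  "to_bfun s u = Bcontfun (\<lambda>x. u x / om x ^ s)"

lemma to_bfun_apply:
  assumes "u \<in> fset (Linf s)"
  shows "apply_bcontfun (to_bfun s u) x = u x / om x ^ s"
proof -
  have "(\<lambda>x. u x / om x ^ s) \<in> bcontfun"
  proof (rule bcontfun_normI)
    show "continuous_on UNIV (\<lambda>x. u x / om x ^ s)"
      by (simp add: continuous_on_def at_within_def nhds_discrete)
    show "norm (u x / om x ^ s) \<le> fnorm (Linf s) u" for x
      using ellinf_pointwise[OF assms, of x] by (simp add: norm_divide norm_power divide_le_eq)
  qed
  then show ?thesis unfolding to_bfun_def by (simp add: Bcontfun_inverse)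
qed

lemma of_to_bfun: "u \<in> fset (Linf s) \<Longrightarrow> of_bfun s (to_bfun s u) = u"
  by (auto simp: of_bfun_def to_bfun_apply)

lemma norm_of_bfun_apply: "cmod (of_bfun s y x) \<le> norm y * om x ^ s"
  using mult_right_mono[OF norm_bounded[of y x], of "om x ^ s"]
  by (simp add: of_bfun_def norm_mult norm_power mult.commute)

lemma of_bfun_mem [simp]: "of_bfun s y \<in> fset (Linf s)"
  and fnorm_of_bfun: "fnorm (Linf s) (of_bfun s y) \<le> norm y"
  using norm_of_bfun_apply by (rule ellinf_I)+

lemma to_of_bfun: "to_bfun s (of_bfun s y) = (y :: ('k::finite, 'r::finite) bfun)"
  by (rule bcontfun_eqI) (simp add: to_bfun_apply, simp add: of_bfun_def)

lemma norm_to_bfun: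
  assumes "u \<in> fset (Linf s)"
  shows "norm (to_bfun s u) \<le> fnorm (Linf s) u"
  by (rule norm_bound)
    (use ellinf_pointwise[OF assms] in \<open>simp add: to_bfun_apply[OF assms] norm_divide norm_power divide_le_eq\<close>)

lemma of_bfun_add: "of_bfun s (y + z) = (\<lambda>x. of_bfun s y x + of_bfun s z x)"
  and of_bfun_scaleR: "of_bfun s (r *\<^sub>R y) = (\<lambda>x. of_real r * of_bfun s y x)"
  and of_bfun_zero: "of_bfun s 0 = (\<lambda>x. 0)"
  by (auto simp: of_bfun_def algebra_simps scaleR_conv_of_real)

lemma of_bfun_sum: "of_bfun s (\<Sum>i\<in>I. y i) = (\<lambda>x. \<Sum>i\<in>I. of_bfun s (y i) x)"
  by (induction I rule: infinite_finite_induct) (auto simp: of_bfun_zero of_bfun_add)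

lemma of_bfun_inject: "of_bfun s y = of_bfun s z \<Longrightarrow> y = (z :: ('k::finite, 'r::finite) bfun)"
  by (metis to_of_bfun)

lemma bounded_linear_bfun:
  fixes T :: "('k::finite, 'r::finite) gop"
  assumes T: "bop (Linf s) (Linf s) C T"
  defines "T' \<equiv> \<lambda>y. to_bfun s (T (of_bfun s y))"
  shows "bounded_linear T'" "of_bfun s (T' y) = T (of_bfun s y)" "norm (T' y) \<le> C * norm y"
proof -
  note mem = bopD(2)[OF T of_bfun_mem]
  show of: "of_bfun s (T' y) = T (of_bfun s y)" for y unfolding T'_def by (rule of_to_bfun[OF mem])
  show le: "norm (T' y) \<le> C * norm y" for y
  proof -
    have "norm (T' y) \<le> fnorm (Linf s) (T (of_bfun s y))"
      unfolding T'_def by (rule norm_to_bfun[OF mem])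
    also have "\<dots> \<le> C * fnorm (Linf s) (of_bfun s y)" by (rule bopD(3)[OF T of_bfun_mem])
    also have "\<dots> \<le> C * norm y" by (rule mult_left_mono[OF fnorm_of_bfun bopD(1)[OF T]])
    finally show ?thesis .
  qed
  show "bounded_linear T'"
  proof (rule bounded_linear_intro)
    show "T' (y + z) = T' y + T' z" for y z
      using bopD(4)[OF T of_bfun_mem of_bfun_mem, of 1 y 1 z]
      by (intro of_bfun_inject[of s]) (simp add: of of_bfun_add)
    show "T' (r *\<^sub>R y) = r *\<^sub>R T' y" for r y
      using bopD(4)[OF T of_bfun_mem of_bfun_mem, of "of_real r" y 0 y]
      by (intro of_bfun_inject[of s]) (simp add: of of_bfun_scaleR)
    show "norm (T' y) \<le> norm y * C" for y using le[of y] by (simp add: mult.commute)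
  qed
qed

text \<open>The inverse found in the real Banach space is complex linear, since \<open>1 + T\<close> is.\<close>

lemma bop_inverseI:
  fixes T :: "('k::finite, 'r::finite) gop" and s :: nat
  defines "Y \<equiv> Linf s"
  assumes T: "bop Y Y C T" and L: "bounded_linear L" "0 \<le> C'" "\<And>z. norm (L z) \<le> C' * norm z"
    and right: "\<And>z. L z + to_bfun s (T (of_bfun s (L z))) = z"
    and left: "\<And>y. L (y + to_bfun s (T (of_bfun s y))) = y"
  shows "\<exists>L. bop Y Y C' L \<and> (\<forall>u\<in>fset Y. (\<lambda>x. L u x + T (L u) x) = u \<and> L (\<lambda>x. u x + T u x) = u)"
proof -
  note T' = bounded_linear_bfun[OF T[unfolded Y_def]]
  define M where "M u = of_bfun s (L (to_bfun s u))" for u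
  have mem: "M u \<in> fset Y" for u by (simp add: M_def Y_def)
  have R: "(\<lambda>x. M u x + T (M u) x) = u" if u: "u \<in> fset Y" for u
  proof -
    have "(\<lambda>x. M u x + T (M u) x) = of_bfun s (L (to_bfun s u) + to_bfun s (T (of_bfun s (L (to_bfun s u)))))"
      by (simp only: of_bfun_add T'(2)) (simp add: M_def)
    also have "\<dots> = u" unfolding right using u by (simp add: of_to_bfun Y_def)
    finally show ?thesis .
  qed
  have Lf: "M (\<lambda>x. u x + T u x) = u" if u: "u \<in> fset Y" for u
  proof -
    have *: "(\<lambda>x. u x + T u x) = of_bfun s (to_bfun s u + to_bfun s (T (of_bfun s (to_bfun s u))))"
      using u by (simp only: of_bfun_add T'(2)) (simp add: of_to_bfun Y_def)
    show ?thesis unfolding M_def * to_of_bfun left using u by (simp add: of_to_bfun Y_def)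
  qed
  have lin: "M (\<lambda>x. a * u x + c * w x) = (\<lambda>x. a * M u x + c * M w x)"
    if u: "u \<in> fset Y" and w: "w \<in> fset Y" for u w a c
  proof -
    let ?m = "\<lambda>x. a * M u x + c * M w x"
    have m: "?m \<in> fset Y" using quasi_normedD(2)[OF quasi_normed_ellinf] mem unfolding Y_def by blast
    have "(\<lambda>x. ?m x + T ?m x) = (\<lambda>x. a * (M u x + T (M u) x) + c * (M w x + T (M w) x))"
      by (simp add: bopD(4)[OF T mem mem] algebra_simps)
    also have "\<dots> = (\<lambda>x. a * u x + c * w x)" using fun_cong[OF R[OF u]] fun_cong[OF R[OF w]] by simp
    finally show ?thesis using Lf[OF m] by simp
  qed
  have "fnorm Y (M u) \<le> C' * fnorm Y u" if u: "u \<in> fset Y" for u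
  proof -
    have "fnorm Y (M u) \<le> norm (L (to_bfun s u))" unfolding M_def Y_def by (rule fnorm_of_bfun)
    also have "\<dots> \<le> C' * norm (to_bfun s u)" by (rule L(3))
    also have "\<dots> \<le> C' * fnorm Y u"
      using u L(2) unfolding Y_def by (intro mult_left_mono norm_to_bfun)
    finally show ?thesis .
  qed
  then have "bop Y Y C' M" unfolding bop_def using L(2) mem lin by blast
  then show ?thesis using R Lf by blast
qed

lemma ellinf_neumann:
  fixes T :: "('k::finite, 'r::finite) gop" and s :: nat
  defines "Y \<equiv> Linf s"
  assumes T: "bop Y Y c T" and c: "c < 1"
  shows "\<exists>L. bop Y Y (1 / (1 - c)) L \<and>
    (\<forall>u\<in>fset Y. (\<lambda>x. L u x + T (L u) x) = u \<and> L (\<lambda>x. u x + T u x) = u)"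
proof -
  note T' = bounded_linear_bfun[OF T[unfolded Y_def]]
  obtain N where N: "bounded_linear N" "\<And>z. N z + to_bfun s (T (of_bfun s (N z))) = z"
      "\<And>y. N (y + to_bfun s (T (of_bfun s y))) = y" "\<And>z. norm (N z) \<le> norm z / (1 - c)"
    using neumann_inverse[where S="\<lambda>y. to_bfun s (T (of_bfun s y))", OF T'(1) bopD(1)[OF T] c T'(3)]
    by (elim exE conjE) (rule that, assumption, (erule spec)+)
  show ?thesis unfolding Y_def
    by (rule bop_inverseI[OF T[unfolded Y_def] N(1) _ _ N(2,3)]) (use N(4) c in auto)
qed

text \<open>The Banach space is real, so a complex term \<psi> e splits into Re \<psi> times e and
  Im \<psi> times \<i> e. The index set \<open>I \<times> UNIV\<close> over the booleans records
  this doubling.\<close>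

lemma ellinf_finite_rank_decomposition:
  fixes T S :: "('k::finite, 'r::finite) gop" and s :: nat and e :: "'i \<Rightarrow> ('k, 'r) gfun"
  defines "Y \<equiv> Linf s"
  defines "T' \<equiv> \<lambda>y. to_bfun s (T (of_bfun s y))"
    and "S' \<equiv> \<lambda>y. to_bfun s (S (of_bfun s y))"
  assumes T: "bop Y Y C T" and S: "bop Y Y c S" and I: "finite I"
    and dec: "\<And>u. u \<in> fset Y \<Longrightarrow> T u = (\<lambda>x. (\<Sum>i\<in>I. \<psi> i u * e i x) + S u x)"
    and e: "\<And>i. i \<in> I \<Longrightarrow> e i \<in> fset Y"
    and \<psi>_lin: "\<And>i u w a c. i \<in> I \<Longrightarrow> u \<in> fset Y \<Longrightarrow> w \<in> fset Y \<Longrightarrow>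
      \<psi> i (\<lambda>x. a * u x + c * w x) = a * \<psi> i u + c * \<psi> i w"
    and \<psi>_le: "\<And>i u. i \<in> I \<Longrightarrow> u \<in> fset Y \<Longrightarrow> cmod (\<psi> i u) \<le> D * fnorm Y u"
  obtains \<phi> f where
    "\<And>y. T' y = (\<Sum>p\<in>I \<times> UNIV. \<phi> p y *\<^sub>R f p) + S' y"
    "\<And>p. p \<in> I \<times> (UNIV :: bool set) \<Longrightarrow> bounded_linear (\<phi> p)"
proof -
  define \<phi> where "\<phi> p y = (if snd p then Re (\<psi> (fst p) (of_bfun s y)) else Im (\<psi> (fst p) (of_bfun s y)))"
    for p :: "'i \<times> bool" and y
  define f where "f p = to_bfun s (if snd p then e (fst p) else (\<lambda>x. \<i> * e (fst p) x))" for p :: "'i \<times> bool"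
  have T'2: "of_bfun s (T' y) = T (of_bfun s y)" and S'2: "of_bfun s (S' y) = S (of_bfun s y)" for y
    unfolding T'_def S'_def
    by (rule bounded_linear_bfun(2)[OF T[unfolded Y_def]] bounded_linear_bfun(2)[OF S[unfolded Y_def]])+
  have ie: "(\<lambda>x. \<i> * e i x) \<in> fset Y" if "i \<in> I" for i
    using quasi_normedD(2)[OF quasi_normed_ellinf e[OF that, unfolded Y_def] e[OF that, unfolded Y_def], of \<i> 0]
    by (simp add: Y_def)
  have of_mem: "of_bfun s y \<in> fset Y" for y by (simp add: Y_def)
  show ?thesis
  proof (rule that[of \<phi> f])
    fix y
    have pair: "(\<Sum>p\<in>I \<times> UNIV. \<phi> p y *\<^sub>R f p) = (\<Sum>i\<in>I. \<phi> (i, True) y *\<^sub>R f (i, True) + \<phi> (i, False) y *\<^sub>R f (i, False))"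
    proof -
      have "(\<Sum>p\<in>I \<times> UNIV. \<phi> p y *\<^sub>R f p) = (\<Sum>i\<in>I. \<Sum>b\<in>UNIV. \<phi> (i, b) y *\<^sub>R f (i, b))"
        by (subst sum.cartesian_product) (simp add: case_prod_unfold)
      then show ?thesis by (simp add: UNIV_bool add.commute)
    qed
    have "of_bfun s ((\<Sum>p\<in>I \<times> UNIV. \<phi> p y *\<^sub>R f p) + S' y)
        = (\<lambda>x. (\<Sum>i\<in>I. \<psi> i (of_bfun s y) * e i x) + S (of_bfun s y) x)"
    proof
      fix x
      have "(\<Sum>i\<in>I. of_bfun s (\<phi> (i, True) y *\<^sub>R f (i, True) + \<phi> (i, False) y *\<^sub>R f (i, False)) x)
          = (\<Sum>i\<in>I. \<psi> i (of_bfun s y) * e i x)"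
      proof (rule sum.cong[OF refl])
        fix i assume i: "i \<in> I"
        have "complex_of_real (Re (\<psi> i (of_bfun s y))) * e i x + complex_of_real (Im (\<psi> i (of_bfun s y))) * (\<i> * e i x)
          = \<psi> i (of_bfun s y) * e i x"
          by (subst (3) complex_eq) (simp add: algebra_simps)
        then show "of_bfun s (\<phi> (i, True) y *\<^sub>R f (i, True) + \<phi> (i, False) y *\<^sub>R f (i, False)) x
            = \<psi> i (of_bfun s y) * e i x"
          using of_to_bfun[OF e[OF i, unfolded Y_def]] of_to_bfun[OF ie[OF i, unfolded Y_def]]
          by (simp add: of_bfun_add of_bfun_scaleR \<phi>_def f_def)
      qed
      then show "of_bfun s ((\<Sum>p\<in>I \<times> UNIV. \<phi> p y *\<^sub>R f p) + S' y) x
        = (\<Sum>i\<in>I. \<psi> i (of_bfun s y) * e i x) + S (of_bfun s y) x"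
        by (simp add: of_bfun_add[of s _ "S' y"] pair of_bfun_sum S'2)
    qed
    also have "\<dots> = of_bfun s (T' y)" using dec[OF of_mem] by (simp add: T'2)
    finally show "T' y = (\<Sum>p\<in>I \<times> UNIV. \<phi> p y *\<^sub>R f p) + S' y" by (metis of_bfun_inject)
  next
    fix p :: "'i \<times> bool" assume "p \<in> I \<times> UNIV"
    then have i: "fst p \<in> I" by auto
    have add: "\<psi> (fst p) (of_bfun s (y + z)) = \<psi> (fst p) (of_bfun s y) + \<psi> (fst p) (of_bfun s z)" for y z
      using \<psi>_lin[OF i of_mem of_mem, of 1 y 1 z] by (simp add: of_bfun_add)
    have scale: "\<psi> (fst p) (of_bfun s (r *\<^sub>R y)) = of_real r * \<psi> (fst p) (of_bfun s y)" for r y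
      using \<psi>_lin[OF i of_mem of_mem, of "of_real r" y 0 y] by (simp add: of_bfun_scaleR)
    have le: "cmod (\<psi> (fst p) (of_bfun s y)) \<le> norm y * \<bar>D\<bar>" for y
    proof -
      have "cmod (\<psi> (fst p) (of_bfun s y)) \<le> D * fnorm Y (of_bfun s y)" by (rule \<psi>_le[OF i of_mem])
      also have "\<dots> \<le> \<bar>D\<bar> * norm y"
        using fnorm_of_bfun[of s y] fnorm_ellinf_nonneg[OF of_bfun_mem, of s y]
        unfolding Y_def by (intro mult_mono) auto
      finally show ?thesis by (simp add: mult.commute)
    qed
    show "bounded_linear (\<phi> p)"
    proof (rule bounded_linear_intro)
      show "norm (\<phi> p y) \<le> norm y * \<bar>D\<bar>" for y
        using order_trans[OF abs_Re_le_cmod le[of y]] order_trans[OF abs_Im_le_cmod le[of y]]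
        by (simp add: \<phi>_def)
    qed (simp_all add: \<phi>_def add scale)
  qed
qed

lemma ellinf_fredholm:
  fixes T S :: "('k::finite, 'r::finite) gop" and s :: nat and e :: "'i \<Rightarrow> ('k, 'r) gfun"
  defines "Y \<equiv> Linf s"
  assumes T: "bop Y Y C T" and S: "bop Y Y c S" and c: "c < 1" and I: "finite I"
    and dec: "\<And>u. u \<in> fset Y \<Longrightarrow> T u = (\<lambda>x. (\<Sum>i\<in>I. \<psi> i u * e i x) + S u x)"
    and e: "\<And>i. i \<in> I \<Longrightarrow> e i \<in> fset Y"
    and \<psi>_lin: "\<And>i u w a c. i \<in> I \<Longrightarrow> u \<in> fset Y \<Longrightarrow> w \<in> fset Y \<Longrightarrow>
      \<psi> i (\<lambda>x. a * u x + c * w x) = a * \<psi> i u + c * \<psi> i w"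
    and \<psi>_le: "\<And>i u. i \<in> I \<Longrightarrow> u \<in> fset Y \<Longrightarrow> cmod (\<psi> i u) \<le> D * fnorm Y u"
    and inj: "\<And>u. u \<in> fset Y \<Longrightarrow> (\<And>x. u x + T u x = 0) \<Longrightarrow> u = (\<lambda>x. 0)"
  shows "\<exists>L C'. bop Y Y C' L \<and>
    (\<forall>u\<in>fset Y. (\<lambda>x. L u x + T (L u) x) = u \<and> L (\<lambda>x. u x + T u x) = u)"
proof -
  note T' = bounded_linear_bfun[OF T[unfolded Y_def]] and S' = bounded_linear_bfun[OF S[unfolded Y_def]]
  obtain \<phi> f where \<phi>: "\<And>y. to_bfun s (T (of_bfun s y)) = (\<Sum>p\<in>I \<times> UNIV. \<phi> p y *\<^sub>R f p) + to_bfun s (S (of_bfun s y))"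
    "\<And>p. p \<in> I \<times> (UNIV :: bool set) \<Longrightarrow> bounded_linear (\<phi> p)"
    by (rule ellinf_finite_rank_decomposition[OF T[unfolded Y_def] S[unfolded Y_def] I dec[unfolded Y_def]
        e[unfolded Y_def] \<psi>_lin[unfolded Y_def] \<psi>_le[unfolded Y_def]]) (assumption | rule that)+
  have inj': "y = 0" if "y + to_bfun s (T (of_bfun s y)) = 0" for y
  proof -
    have "of_bfun s (y + to_bfun s (T (of_bfun s y))) = (\<lambda>x. 0)" unfolding that by (rule of_bfun_zero)
    then have "of_bfun s y x + T (of_bfun s y) x = 0" for x
      by (simp add: of_bfun_add T'(2) fun_eq_iff)
    then have "of_bfun s y = of_bfun s 0"
      using inj[of "of_bfun s y"] by (simp add: Y_def of_bfun_zero)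
    then show ?thesis by (rule of_bfun_inject)
  qed
  have fin: "finite (I \<times> (UNIV :: bool set))" using I by simp
  have "\<exists>L. bounded_linear L \<and> (\<forall>z. L z + to_bfun s (T (of_bfun s (L z))) = z) \<and>
      (\<forall>y. L (y + to_bfun s (T (of_bfun s y))) = y)"
    by (rule fredholm_alternative[where T="\<lambda>y. to_bfun s (T (of_bfun s y))" and S="\<lambda>y. to_bfun s (S (of_bfun s y))"
      and I="I \<times> UNIV" and \<phi>=\<phi> and e=f, OF \<phi>(1) fin \<phi>(2) S'(1) bopD(1)[OF S] c S'(3) inj'])
  then obtain L where L: "bounded_linear L" "\<And>z. L z + to_bfun s (T (of_bfun s (L z))) = z"
    "\<And>y. L (y + to_bfun s (T (of_bfun s y))) = y"
    by (elim exE conjE) (rule that, assumption, (erule spec)+)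
  obtain C' where C': "0 \<le> C'" "\<And>z. norm (L z) \<le> C' * norm z"
    using bounded_linear.nonneg_bounded[OF L(1)] by (metis mult.commute)
  show ?thesis using bop_inverseI[OF T[unfolded Y_def] L(1) C' L(2,3)] unfolding Y_def by blast
qed

text \<open>Independence is taken over the reals to match the real Banach space; orthonormal
  families satisfy it. The factor 2 is the real rank of one complex functional.\<close>

lemma ellinf_kernel_finite_dim:
  fixes T S :: "('k::finite, 'r::finite) gop" and s :: nat and e :: "'i \<Rightarrow> ('k, 'r) gfun"
  defines "Y \<equiv> Linf s"
  assumes T: "bop Y Y C T" and S: "bop Y Y c S" and c: "c < 1" and I: "finite I"
    and dec: "\<And>u. u \<in> fset Y \<Longrightarrow> T u = (\<lambda>x. (\<Sum>i\<in>I. \<psi> i u * e i x) + S u x)"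
    and e: "\<And>i. i \<in> I \<Longrightarrow> e i \<in> fset Y"
    and \<psi>_lin: "\<And>i u w a c. i \<in> I \<Longrightarrow> u \<in> fset Y \<Longrightarrow> w \<in> fset Y \<Longrightarrow>
      \<psi> i (\<lambda>x. a * u x + c * w x) = a * \<psi> i u + c * \<psi> i w"
    and \<psi>_le: "\<And>i u. i \<in> I \<Longrightarrow> u \<in> fset Y \<Longrightarrow> cmod (\<psi> i u) \<le> D * fnorm Y u"
    and B: "finite B" "\<And>u. u \<in> B \<Longrightarrow> u \<in> fset Y \<and> (\<forall>x. u x + T u x = 0)"
    and indep: "\<And>a. (\<And>x. (\<Sum>u\<in>B. complex_of_real (a u) * u x) = 0) \<Longrightarrow> \<forall>u\<in>B. a u = 0"
  shows "card B \<le> 2 * card I"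
proof -
  note T' = bounded_linear_bfun[OF T[unfolded Y_def]] and S' = bounded_linear_bfun[OF S[unfolded Y_def]]
  obtain \<phi> f where \<phi>: "\<And>y. to_bfun s (T (of_bfun s y)) = (\<Sum>p\<in>I \<times> UNIV. \<phi> p y *\<^sub>R f p) + to_bfun s (S (of_bfun s y))"
    "\<And>p. p \<in> I \<times> (UNIV :: bool set) \<Longrightarrow> bounded_linear (\<phi> p)"
    by (rule ellinf_finite_rank_decomposition[OF T[unfolded Y_def] S[unfolded Y_def] I dec[unfolded Y_def]
        e[unfolded Y_def] \<psi>_lin[unfolded Y_def] \<psi>_le[unfolded Y_def]]) (assumption | rule that)+
  have fin: "finite (I \<times> (UNIV :: bool set))" using I by simp
  obtain K where K: "finite K" "card K \<le> card (I \<times> (UNIV :: bool set))"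
      "{y. y + to_bfun s (T (of_bfun s y)) = 0} \<subseteq> span K"
    using fredholm_kernel_subset_span[where T="\<lambda>y. to_bfun s (T (of_bfun s y))" and S="\<lambda>y. to_bfun s (S (of_bfun s y))"
      and I="I \<times> UNIV" and \<phi>=\<phi> and e=f, OF \<phi>(1) fin S'(1) bopD(1)[OF S] c S'(3)]
    by (elim exE conjE) (rule that)
  have of_to: "of_bfun s (to_bfun s u) = u" if "u \<in> B" for u
    using B(2)[OF that] by (simp add: Y_def of_to_bfun)
  have inj: "inj_on (to_bfun s) B" using of_to by (metis inj_onI)
  have sub: "to_bfun s ` B \<subseteq> span K"
  proof
    fix y assume "y \<in> to_bfun s ` B"
    then obtain u where u: "u \<in> B" "y = to_bfun s u" by blast
    have "of_bfun s (y + to_bfun s (T (of_bfun s y))) = of_bfun s 0"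
      using B(2)[OF u(1)] bopD(2)[OF T] unfolding of_bfun_add u(2) of_bfun_zero of_to[OF u(1)]
      by (simp add: of_to_bfun Y_def)
    then show "y \<in> span K" using K(3) of_bfun_inject by blast
  qed
  have "independent (to_bfun s ` B)"
  proof (rule independent_if_scalars_zero)
    fix g y assume sum: "(\<Sum>y\<in>to_bfun s ` B. g y *\<^sub>R y) = 0" and y: "y \<in> to_bfun s ` B"
    have "(\<Sum>u\<in>B. complex_of_real (g (to_bfun s u)) * u x) = 0" for x
    proof -
      have "0 = of_bfun s (\<Sum>u\<in>B. g (to_bfun s u) *\<^sub>R to_bfun s u) x"
        using sum by (simp add: sum.reindex[OF inj] of_bfun_zero)
      then show ?thesis by (simp add: of_bfun_sum of_bfun_scaleR of_to cong: sum.cong)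
    qed
    then show "g y = 0" using indep[of "\<lambda>u. g (to_bfun s u)"] y by auto
  qed (use B in auto)
  from independent_span_bound[OF K(1) this sub] have "card (to_bfun s ` B) \<le> card K" by blast
  then show ?thesis using K(2) by (simp add: card_image[OF inj] card_cartesian_product)
qed

section \<open>Operators with a kernel\<close>

lemma infsum_lincomb:
  fixes f g :: "'a \<Rightarrow> complex"
  assumes "f summable_on UNIV" "g summable_on UNIV"
  shows "(\<lambda>x. a * f x + c * g x) summable_on UNIV"
    "(\<Sum>\<^sub>\<infinity>x. a * f x + c * g x) = a * (\<Sum>\<^sub>\<infinity>x. f x) + c * (\<Sum>\<^sub>\<infinity>x. g x)"
proof -
  have s: "(\<lambda>x. a * f x) summable_on UNIV" "(\<lambda>x. c * g x) summable_on UNIV"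
    using assms by (auto intro: summable_on_cmult_right)
  show "(\<lambda>x. a * f x + c * g x) summable_on UNIV" by (rule summable_on_add[OF s])
  show "(\<Sum>\<^sub>\<infinity>x. a * f x + c * g x) = a * (\<Sum>\<^sub>\<infinity>x. f x) + c * (\<Sum>\<^sub>\<infinity>x. g x)"
    using infsum_add[OF s] by (simp only: infsum_cmult_right')
qed

lemma infsum_finite_sum:
  fixes f :: "'i \<Rightarrow> 'a \<Rightarrow> 'b::banach"
  assumes "finite I" "\<And>i. i \<in> I \<Longrightarrow> f i summable_on UNIV"
  shows "(\<lambda>x. \<Sum>i\<in>I. f i x) summable_on UNIV \<and> (\<Sum>\<^sub>\<infinity>x. \<Sum>i\<in>I. f i x) = (\<Sum>i\<in>I. \<Sum>\<^sub>\<infinity>x. f i x)"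
  using assms
proof (induction I rule: finite_induct)
  case (insert i I)
  then have s: "f i summable_on UNIV" "(\<lambda>x. \<Sum>i\<in>I. f i x) summable_on UNIV" by auto
  show ?case using insert summable_on_add[OF s] infsum_add[OF s] by simp
qed simp

definition kop :: "('v \<Rightarrow> 'v \<Rightarrow> complex) \<Rightarrow> ('v \<Rightarrow> complex) \<Rightarrow> 'v \<Rightarrow> complex" where
  "kop k f x = (\<Sum>\<^sub>\<infinity>y. k x y * f y)"

lemma kop_summable:
  assumes k: "\<And>x y. cmod (k x y) \<le> C * om x ^ t * om y ^ s" and f: "f \<in> fset (L1 s)"
  shows "(\<lambda>y. k x y * f y) summable_on UNIV"
    "cmod (kop k f x) \<le> C * om x ^ t * fnorm (L1 s) f"
proof -
  have le: "cmod (k x y * f y) \<le> (C * om x ^ t) * (om y ^ s * cmod (f y))" for y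
    using mult_right_mono[OF k[of x y] norm_ge_zero[of "f y"]] by (simp add: norm_mult mult.assoc)
  have sm: "(\<lambda>y. (C * om x ^ t) * (om y ^ s * cmod (f y))) summable_on UNIV"
    using f by (intro summable_on_cmult_right) (simp add: ell1_iff)
  show "(\<lambda>y. k x y * f y) summable_on UNIV" by (rule summable_on_dominated[OF sm le])
  have "cmod (kop k f x) \<le> (\<Sum>\<^sub>\<infinity>y. (C * om x ^ t) * (om y ^ s * cmod (f y)))"
    unfolding kop_def by (rule norm_infsum_dominated[OF sm le])
  then show "cmod (kop k f x) \<le> C * om x ^ t * fnorm (L1 s) f"
    by (simp only: infsum_cmult_right' fnorm_ell1)
qed

lemma kop_lincomb:
  assumes "(\<lambda>y. k x y * f y) summable_on UNIV" "(\<lambda>y. k x y * g y) summable_on UNIV"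
  shows "kop k (\<lambda>y. a * f y + c * g y) x = a * kop k f x + c * kop k g x"
  using infsum_lincomb(2)[OF assms, of a c] by (simp add: kop_def algebra_simps)

lemma kop_bop:
  fixes k :: "('k::finite, 'r::finite) gvert \<Rightarrow> ('k, 'r) gvert \<Rightarrow> complex"
  assumes k: "\<And>x y. cmod (k x y) \<le> C * om x ^ t * om y ^ s" and C: "0 \<le> C"
  shows "bop (L1 s) (Linf t) C (kop k)"
  unfolding bop_def
proof (intro conjI ballI allI C)
  fix f :: "('k, 'r) gfun" assume f: "f \<in> fset (L1 s)"
  have "cmod (kop k f x) \<le> (C * fnorm (L1 s) f) * om x ^ t" for x
    using kop_summable(2)[OF k f, of x] by (simp add: mult_ac)
  then show "kop k f \<in> fset (Linf t)" "fnorm (Linf t) (kop k f) \<le> C * fnorm (L1 s) f"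
    by (rule ellinf_I)+
  fix g :: "('k, 'r) gfun" and a c assume g: "g \<in> fset (L1 s)"
  show "kop k (\<lambda>x. a * f x + c * g x) = (\<lambda>x. a * kop k f x + c * kop k g x)"
    by (rule ext) (rule kop_lincomb[OF kop_summable(1)[OF k f] kop_summable(1)[OF k g]])
qed

text \<open>Only weighted column sums enter: with finitely many \<open>x\<close>, the sums over
  \<open>x\<close> and \<open>y\<close> may be exchanged. This gives decay of the output, unlike the
  pointwise kernel bounds of \<open>kop_bop\<close>.\<close>

lemma kop_ell1_ell1:
  assumes k: "\<And>y F. finite F \<Longrightarrow> (\<Sum>x\<in>F. om x ^ t * cmod (k x y)) \<le> C * om y ^ s"
    and f: "f \<in> fset (L1 s)"
  shows "kop k f \<in> fset (L1 t)"
proof (rule ell1_I)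
  fix F :: "('a, 'b) gvert set" assume F: "finite F"
  have k1: "om x ^ t * cmod (k x y) \<le> C * om y ^ s" for x y using k[of "{x}" y] by simp
  have le: "om x ^ t * cmod (k x y * f y) \<le> C * (om y ^ s * cmod (f y))" for x y
    using mult_right_mono[OF k1[of x y] norm_ge_zero[of "f y"]] by (simp add: norm_mult mult.assoc)
  have sm: "(\<lambda>y. C * (om y ^ s * cmod (f y))) summable_on UNIV"
    using f by (intro summable_on_cmult_right) (simp add: ell1_iff)
  have sm1: "(\<lambda>y. om x ^ t * cmod (k x y * f y)) summable_on UNIV" for x
    by (rule summable_on_dominated[OF sm]) (use le in simp)
  have "(\<Sum>x\<in>F. om x ^ t * cmod (kop k f x)) \<le> (\<Sum>x\<in>F. \<Sum>\<^sub>\<infinity>y. om x ^ t * cmod (k x y * f y))"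
  proof (rule sum_mono)
    fix x
    have "(\<lambda>y. inverse (om x ^ t) * (om x ^ t * cmod (k x y * f y))) summable_on UNIV"
      by (rule summable_on_cmult_right[OF sm1])
    moreover have "inverse (om x ^ t) * (om x ^ t * w) = w" for w by (simp add: mult.assoc[symmetric])
    ultimately have s2: "(\<lambda>y. cmod (k x y * f y)) summable_on UNIV" by (simp only:)
    have "cmod (kop k f x) \<le> (\<Sum>\<^sub>\<infinity>y. cmod (k x y * f y))"
      unfolding kop_def by (rule norm_infsum_dominated[OF s2]) simp
    then have "om x ^ t * cmod (kop k f x) \<le> om x ^ t * (\<Sum>\<^sub>\<infinity>y. cmod (k x y * f y))"
      by (rule mult_left_mono) simp
    then show "om x ^ t * cmod (kop k f x) \<le> (\<Sum>\<^sub>\<infinity>y. om x ^ t * cmod (k x y * f y))"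
      by (simp only: infsum_cmult_right')
  qed
  also have "\<dots> = (\<Sum>\<^sub>\<infinity>y. \<Sum>x\<in>F. om x ^ t * cmod (k x y * f y))"
    using infsum_finite_sum[OF F, of "\<lambda>x y. om x ^ t * cmod (k x y * f y)"] sm1 by simp
  also have "\<dots> \<le> (\<Sum>\<^sub>\<infinity>y. C * (om y ^ s * cmod (f y)))"
  proof (rule infsum_mono[OF _ sm])
    show "(\<lambda>y. \<Sum>x\<in>F. om x ^ t * cmod (k x y * f y)) summable_on UNIV"
      using infsum_finite_sum[OF F, of "\<lambda>x y. om x ^ t * cmod (k x y * f y)"] sm1 by simp
    fix y
    show "(\<Sum>x\<in>F. om x ^ t * cmod (k x y * f y)) \<le> C * (om y ^ s * cmod (f y))"
      using mult_right_mono[OF k[OF F, of y] norm_ge_zero[of "f y"]]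
      by (simp add: norm_mult sum_distrib_right mult.assoc)
  qed
  finally show "(\<Sum>x\<in>F. om x ^ t * cmod (kop k f x)) \<le> (\<Sum>\<^sub>\<infinity>y. C * (om y ^ s * cmod (f y)))" .
qed

text \<open>Schur's test. A Cauchy-Schwarz estimate in each row with weight
  \<open>cmod (k x y)\<close> uses the row sums; summing its squares over \<open>x\<close> uses the
  column sums.\<close>

lemma kop_ell2_Schur:
  fixes k :: "('k::finite, 'r::finite) gvert \<Rightarrow> ('k, 'r) gvert \<Rightarrow> complex"
  assumes C: "0 < C"
    and rows: "\<And>x F. finite F \<Longrightarrow> (\<Sum>y\<in>F. cmod (k x y)) \<le> C"
    and cols: "\<And>y F. finite F \<Longrightarrow> (\<Sum>x\<in>F. cmod (k x y)) \<le> C"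
  shows "f \<in> fset ell2 \<Longrightarrow> (\<lambda>y. k x y * f y) summable_on UNIV" and "bop ell2 ell2 C (kop k)"
proof -
  have pt: "cmod (f y) \<le> fnorm ell2 f" if f: "f \<in> fset ell2" for f :: "('k, 'r) gfun" and y
    using ellinf_pointwise[OF bopD(2)[OF bop_id_ell2_ellinf[of 0] f], of y]
      bopD(3)[OF bop_id_ell2_ellinf[of 0] f] by simp
  have row_sm: "(\<lambda>y. cmod (k x y)) summable_on UNIV" and row_le: "(\<Sum>\<^sub>\<infinity>y. cmod (k x y)) \<le> C" for x
    using summable_on_nonneg_bounded[of "\<lambda>y. cmod (k x y)" C] rows by auto
  have abs_sm: "(\<lambda>y. cmod (k x y) * cmod (f y)) summable_on UNIV" if f: "f \<in> fset ell2" for f x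
    by (rule summable_on_dominated[OF summable_on_cmult_left[OF row_sm[of x], where c="fnorm ell2 f"]])
      (use pt[OF f] in \<open>auto intro: mult_left_mono\<close>)
  show sm: "(\<lambda>y. k x y * f y) summable_on UNIV" if f: "f \<in> fset ell2" for f x
    by (rule summable_on_dominated[OF abs_sm[OF f, of x]]) (simp add: norm_mult)
  have sq_sm: "(\<lambda>y. cmod (k x y) * (cmod (f y))\<^sup>2) summable_on UNIV" if f: "f \<in> fset ell2" for f x
    by (rule summable_on_dominated[OF summable_on_cmult_left[OF row_sm[of x], where c="(fnorm ell2 f)\<^sup>2"]])
      (use pt[OF f] in \<open>auto intro!: mult_left_mono power_mono\<close>)
  have sq_le: "(cmod (kop k f x))\<^sup>2 \<le> C * (\<Sum>\<^sub>\<infinity>y. cmod (k x y) * (cmod (f y))\<^sup>2)"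
    if f: "f \<in> fset ell2" for f x
  proof -
    define S where "S = (\<Sum>\<^sub>\<infinity>y. cmod (k x y) * cmod (f y))"
    define Q where "Q = (\<Sum>\<^sub>\<infinity>y. cmod (k x y) * (cmod (f y))\<^sup>2)"
    have le_S: "cmod (kop k f x) \<le> S"
      unfolding kop_def S_def by (rule norm_infsum_dominated[OF abs_sm[OF f]]) (simp add: norm_mult)
    have Q0: "0 \<le> Q" unfolding Q_def by (rule infsum_nonneg) simp
    have "S\<^sup>2 \<le> C * Q"
    proof (cases "S \<le> 0")
      case True
      have "0 \<le> S" unfolding S_def by (rule infsum_nonneg) simp
      then show ?thesis using True C Q0 by simp
    next
      case False
      \<comment> \<open>With this parameter the first part of Young's inequality adds up to at most
        \<open>S / 2\<close>, which is absorbed on the left and leaves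
        \<open>S\<^sup>2 \<le> C * Q\<close>.\<close>
      define l where "l = S / C"
      have l: "0 < l" using False C by (simp add: l_def)
      have "S \<le> (\<Sum>\<^sub>\<infinity>y. l / 2 * cmod (k x y) + 1 / (2 * l) * (cmod (k x y) * (cmod (f y))\<^sup>2))"
        unfolding S_def
      proof (rule infsum_mono[OF abs_sm[OF f]])
        show "(\<lambda>y. l / 2 * cmod (k x y) + 1 / (2 * l) * (cmod (k x y) * (cmod (f y))\<^sup>2)) summable_on UNIV"
          by (intro summable_on_add summable_on_cmult_right row_sm sq_sm[OF f])
        fix y
        have "0 \<le> (l - cmod (f y))\<^sup>2" by simp
        then have "2 * l * cmod (f y) \<le> l\<^sup>2 + (cmod (f y))\<^sup>2" by (simp add: power2_diff)
        then have "cmod (f y) \<le> l / 2 + 1 / (2 * l) * (cmod (f y))\<^sup>2"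
          using l by (simp add: field_simps power2_eq_square)
        from mult_left_mono[OF this, of "cmod (k x y)"]
        show "cmod (k x y) * cmod (f y) \<le> l / 2 * cmod (k x y) + 1 / (2 * l) * (cmod (k x y) * (cmod (f y))\<^sup>2)"
          by (simp add: algebra_simps)
      qed
      also have "\<dots> = l / 2 * (\<Sum>\<^sub>\<infinity>y. cmod (k x y)) + 1 / (2 * l) * Q"
        unfolding Q_def
        by (subst infsum_add) (auto intro!: summable_on_cmult_right row_sm sq_sm[OF f] simp only: infsum_cmult_right')
      also have "\<dots> \<le> l / 2 * C + 1 / (2 * l) * Q"
        using mult_left_mono[OF row_le, of "l / 2" x] l by simp
      also have "\<dots> = S / 2 + C * Q / (2 * S)" using C False by (simp add: l_def)
      finally have "S / 2 \<le> C * Q / (2 * S)" by simp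
      then show ?thesis using False by (simp add: field_simps power2_eq_square)
    qed
    moreover have "(cmod (kop k f x))\<^sup>2 \<le> S\<^sup>2" by (rule power_mono[OF le_S]) simp
    ultimately show ?thesis unfolding Q_def by linarith
  qed
  show "bop ell2 ell2 C (kop k)"
    unfolding bop_def
  proof (intro conjI ballI allI)
    show "0 \<le> C" using C by simp
    fix f :: "('k, 'r) gfun" assume f: "f \<in> fset ell2"
    have *: "(\<Sum>x\<in>F. (cmod (kop k f x))\<^sup>2) \<le> (C * fnorm ell2 f)\<^sup>2" if F: "finite F" for F
    proof -
      have "(\<Sum>x\<in>F. (cmod (kop k f x))\<^sup>2) \<le> (\<Sum>x\<in>F. C * (\<Sum>\<^sub>\<infinity>y. cmod (k x y) * (cmod (f y))\<^sup>2))"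
        by (rule sum_mono[OF sq_le[OF f]])
      also have "\<dots> = C * (\<Sum>\<^sub>\<infinity>y. \<Sum>x\<in>F. cmod (k x y) * (cmod (f y))\<^sup>2)"
        using infsum_finite_sum[OF F, of "\<lambda>x y. cmod (k x y) * (cmod (f y))\<^sup>2"] sq_sm[OF f]
        by (simp flip: sum_distrib_left)
      also have "\<dots> \<le> C * (\<Sum>\<^sub>\<infinity>y. C * (cmod (f y))\<^sup>2)"
      proof (rule mult_left_mono[OF infsum_mono])
        show "(\<lambda>y. \<Sum>x\<in>F. cmod (k x y) * (cmod (f y))\<^sup>2) summable_on UNIV"
          using infsum_finite_sum[OF F, of "\<lambda>x y. cmod (k x y) * (cmod (f y))\<^sup>2"] sq_sm[OF f] by simp
        show "(\<lambda>y. C * (cmod (f y))\<^sup>2) summable_on UNIV"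
          using f by (intro summable_on_cmult_right) (simp add: ell2_iff)
        show "(\<Sum>x\<in>F. cmod (k x y) * (cmod (f y))\<^sup>2) \<le> C * (cmod (f y))\<^sup>2" for y
          using mult_right_mono[OF cols[OF F, of y], of "(cmod (f y))\<^sup>2"] by (simp add: sum_distrib_right)
      qed (use C in simp)
      also have "\<dots> = (C * fnorm ell2 f)\<^sup>2"
        by (simp only: infsum_cmult_right' power_mult_distrib fnorm_ell2_sq) (simp add: power2_eq_square)
      finally show ?thesis .
    qed
    have nn: "0 \<le> C * fnorm ell2 f" using C fnorm_ell2_nonneg[of f] by simp
    show "kop k f \<in> fset ell2" by (rule ell2_I(1)[OF * nn])
    show "fnorm ell2 (kop k f) \<le> C * fnorm ell2 f" by (rule ell2_I(2)[OF * nn])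
    fix g :: "('k, 'r) gfun" and a c assume g: "g \<in> fset ell2"
    show "kop k (\<lambda>x. a * f x + c * g x) = (\<lambda>x. a * kop k f x + c * kop k g x)"
      by (rule ext) (rule kop_lincomb[OF sm[OF f] sm[OF g]])
  qed
qed

section \<open>The free resolvent\<close>

lemma finite_geometric_sum_le:
  fixes t :: real
  assumes "0 \<le> t" "t < 1" "finite D"
  shows "(\<Sum>d\<in>D. t ^ d) \<le> 1 / (1 - t)"
proof -
  have "(\<Sum>d\<in>D. t ^ d) \<le> (\<Sum>d. t ^ d)"
    by (rule sum_le_suminf) (use assms in \<open>auto intro: summable_geometric\<close>)
  then show ?thesis using assms suminf_geometric[of t] by simp
qed

text \<open>For fixed \<kappa> in the half-plane the kernel decays like \<open>t\<close> to the
  distance, with \<open>t < 1\<close>. One factor \<open>g\<close> comes from the inner sum,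
  \<open>2 * g\<close> from the two sides of the diagonal, \<open>c\<close> from the core. The
  constant degenerates as \<kappa> tends to 0 and serves only for l^2 at fixed \<kappa>.\<close>

lemma green_row_sum_le:
  fixes x :: "('k, 'r) gvert"
  assumes "0 < Re \<kappa>" "cmod \<kappa> < 1"
  shows "\<exists>C>0. \<forall>x::('k, 'r) gvert. \<forall>F. finite F \<longrightarrow> (\<Sum>y\<in>F. cmod (green \<kappa> x y)) \<le> C"
proof -
  define t where "t = cmod (zeta \<kappa>)"
  define c where "c = cmod (1 / (1 + \<kappa>\<^sup>2))"
  define g where "g = 1 / (1 - t)"
  have t: "0 \<le> t" "t < 1" using norm_zeta_less_1[OF assms] by (auto simp: t_def)
  have g: "1 \<le> g" "0 \<le> g" using t by (auto simp: g_def)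
  have geo: "(\<Sum>d\<in>D. t ^ d) \<le> g" if "finite D" for D
    unfolding g_def by (rule finite_geometric_sum_le[OF t that])
  have ray: "cmod (green \<kappa> (Ray a n) (Ray a m :: ('k, 'r) gvert)) \<le> t ^ (n - m) * t ^ (m - n) * g" for a n m
  proof -
    have "cmod (green \<kappa> (Ray a n) (Ray a m :: ('k, 'r) gvert)) \<le> (\<Sum>i\<le>min n m. t ^ ((n - m) + (m - n) + 1 + 2 * i))"
      by (simp only: green.simps simp_thms if_True) (rule sum_norm_le, simp only: norm_power t_def order_refl)
    also have "\<dots> \<le> (\<Sum>i\<le>min n m. t ^ (n - m) * t ^ (m - n) * t ^ i)"
    proof (rule sum_mono)
      fix i
      have "t ^ ((n - m) + (m - n) + 1 + 2 * i) \<le> t ^ ((n - m) + (m - n) + i)"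
        by (rule power_decreasing) (use t in auto)
      then show "t ^ ((n - m) + (m - n) + 1 + 2 * i) \<le> t ^ (n - m) * t ^ (m - n) * t ^ i"
        by (simp add: power_add)
    qed
    also have "\<dots> \<le> t ^ (n - m) * t ^ (m - n) * g"
      unfolding sum_distrib_left[symmetric] by (intro mult_left_mono geo) (use t in auto)
    finally show ?thesis .
  qed
  have row: "(\<Sum>y\<in>F. cmod (green \<kappa> x y)) \<le> c + 2 * g * g" if F: "finite F" for x :: "('k, 'r) gvert" and F
  proof (cases x)
    case (Core z)
    have "(\<Sum>y\<in>F. cmod (green \<kappa> x y)) \<le> (\<Sum>y\<in>F. if y = x then c else 0)"
    proof (rule sum_mono)
      fix y show "cmod (green \<kappa> x y) \<le> (if y = x then c else 0)"
        using Core by (cases y) (auto simp: c_def)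
    qed
    also have "\<dots> \<le> c" using F by (simp add: c_def)
    finally show ?thesis using g(2) mult_nonneg_nonneg[OF g(2) g(2)] by linarith
  next
    case (Ray a n)
    define M where "M = {m. Ray a m \<in> F}"
    have inj: "inj_on (Ray a) M" for M by (rule inj_onI) simp
    have img: "Ray a ` M \<subseteq> F" by (auto simp: M_def)
    have M: "finite M" using finite_imageD[OF finite_subset[OF img F] inj] .
    have "(\<Sum>y\<in>F. cmod (green \<kappa> x y)) = (\<Sum>y\<in>Ray a ` M. cmod (green \<kappa> x y))"
    proof (rule sum.mono_neutral_right[OF F img])
      show "\<forall>y\<in>F - Ray a ` M. cmod (green \<kappa> x y) = 0"
      proof
        fix y assume "y \<in> F - Ray a ` M"
        then show "cmod (green \<kappa> x y) = 0" using Ray by (cases y) (auto simp: M_def)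
      qed
    qed
    also have "\<dots> = (\<Sum>m\<in>M. cmod (green \<kappa> x (Ray a m)))" by (simp add: sum.reindex[OF inj])
    also have "\<dots> \<le> (\<Sum>m\<in>M. (t ^ (n - m) * t ^ (m - n)) * g)"
      using ray Ray by (intro sum_mono) (simp only:)
    also have "\<dots> = (\<Sum>m\<in>M. t ^ (n - m) * t ^ (m - n)) * g" by (simp only: sum_distrib_right)
    also have "\<dots> \<le> (2 * g) * g"
    proof (rule mult_right_mono[OF _ g(2)])
      have split: "M = {m\<in>M. m \<le> n} \<union> {m\<in>M. n < m}" by auto
      have "(\<Sum>m\<in>M. t ^ (n - m) * t ^ (m - n))
          = (\<Sum>m | m \<in> M \<and> m \<le> n. t ^ (n - m) * t ^ (m - n)) + (\<Sum>m | m \<in> M \<and> n < m. t ^ (n - m) * t ^ (m - n))"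
        by (subst split, rule sum.union_disjoint) (use M in auto)
      also have "\<dots> = (\<Sum>m | m \<in> M \<and> m \<le> n. t ^ (n - m)) + (\<Sum>m | m \<in> M \<and> n < m. t ^ (m - n))"
        by (intro arg_cong2[where f="(+)"] sum.cong) auto
      also have "(\<Sum>m | m \<in> M \<and> m \<le> n. t ^ (n - m)) = (\<Sum>d\<in>(\<lambda>m. n - m) ` {m\<in>M. m \<le> n}. t ^ d)"
        by (subst sum.reindex) (auto intro!: inj_onI)
      also have "(\<Sum>m | m \<in> M \<and> n < m. t ^ (m - n)) = (\<Sum>d\<in>(\<lambda>m. m - n) ` {m\<in>M. n < m}. t ^ d)"
        by (subst sum.reindex) (auto intro!: inj_onI)
      finally show "(\<Sum>m\<in>M. t ^ (n - m) * t ^ (m - n)) \<le> 2 * g"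
        using geo[of "(\<lambda>m. n - m) ` {m\<in>M. m \<le> n}"] geo[of "(\<lambda>m. m - n) ` {m\<in>M. n < m}"] M by simp
    qed
    finally show ?thesis by (simp add: c_def add_increasing)
  qed
  have "0 < c + 2 * g * g" using g by (simp add: c_def add_nonneg_pos)
  then show ?thesis using row by blast
qed

lemma green_ell2:
  assumes "0 < Re \<kappa>" "cmod \<kappa> < 1"
  shows "\<exists>C. bop (ell2 :: ('k::finite, 'r::finite) gvert fspace) ell2 C (kop (green \<kappa>))"
    and "f \<in> fset (ell2 :: ('k, 'r) gvert fspace) \<Longrightarrow> (\<lambda>y. green \<kappa> x y * f y) summable_on UNIV"
    and "green \<kappa> x \<in> fset (L1 0 :: ('k, 'r) gvert fspace)"
proof -
  obtain C where C: "C > 0" "\<And>(x :: ('k, 'r) gvert) F. finite F \<Longrightarrow> (\<Sum>y\<in>F. cmod (green \<kappa> x y)) \<le> C"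
    using green_row_sum_le[OF assms] by blast
  have cols: "finite F \<Longrightarrow> (\<Sum>x\<in>F. cmod (green \<kappa> x y)) \<le> C" for y :: "('k, 'r) gvert" and F
    using C(2)[of F y] by (simp add: green_commute[of \<kappa> _ y])
  show "\<exists>C. bop (ell2 :: ('k, 'r) gvert fspace) ell2 C (kop (green \<kappa>))"
    using kop_ell2_Schur(2)[OF C(1), where k="green \<kappa>"] C(2) cols by blast
  show "f \<in> fset (ell2 :: ('k, 'r) gvert fspace) \<Longrightarrow> (\<lambda>y. green \<kappa> x y * f y) summable_on UNIV"
    using kop_ell2_Schur(1)[OF C(1), where k="green \<kappa>"] C(2) cols by blast
  show "green \<kappa> x \<in> fset (L1 0 :: ('k, 'r) gvert fspace)"
    by (rule ell1_I(1)[where C=C]) (use C(2) in simp)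
qed

subsection \<open>Shifts along the rays\<close>

text \<open>Splitting \<open>D_op\<close> into a diagonal and two mutually adjoint shifts reduces
  its symmetry and boundedness to reindexing. The value 0 that \<open>shr\<close> inserts at the
  first point is the Dirichlet condition.\<close>

fun shl :: "('k, 'r) gop" where
  "shl u (Core c) = 0"
| "shl u (Ray a n) = u (Ray a (Suc n))"

fun shr :: "('k, 'r) gop" where
  "shr u (Core c) = 0"
| "shr u (Ray a 0) = 0"
| "shr u (Ray a (Suc n)) = u (Ray a n)"

fun dcoef :: "('k, 'r) gvert \<Rightarrow> complex" where
  "dcoef (Core c) = 1"
| "dcoef (Ray a n) = 2"

lemma D_op_eq: "D_op u x = dcoef x * u x - shl u x - shr u x"
proof (cases x)
  case (Ray a n)
  then show ?thesis by (cases n) auto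
qed simp

lemma D_op_lincomb: "D_op (\<lambda>x. a * u x + c * w x) x = a * D_op u x + c * D_op w x"
proof -
  have "shl (\<lambda>x. a * u x + c * w x) x = a * shl u x + c * shl w x"
    by (cases x) auto
  moreover have "shr (\<lambda>x. a * u x + c * w x) x = a * shr u x + c * shr w x"
    by (induction "\<lambda>x. a * u x + c * w x" x rule: shr.induct) auto
  ultimately show ?thesis by (simp add: D_op_eq algebra_simps)
qed

text \<open>Both families consist of the same products, reindexed by the injection of each ray into
  itself, together with zeros. Hence summability transfers too, without any decay
  assumption.\<close>

lemma shift_adjoint:
  fixes \<phi> \<psi> :: "('k, 'r) gfun"
  shows "(\<lambda>x. \<phi> x * shr \<psi> x) summable_on UNIV \<longleftrightarrow> (\<lambda>x. shl \<phi> x * \<psi> x) summable_on UNIV"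
    and "(\<Sum>\<^sub>\<infinity>x. \<phi> x * shr \<psi> x) = (\<Sum>\<^sub>\<infinity>x. shl \<phi> x * \<psi> x)"
proof -
  define \<sigma> where "\<sigma> x = (case x of Core c \<Rightarrow> Core c | Ray a n \<Rightarrow> Ray a (Suc n))" for x :: "('k, 'r) gvert"
  define R where "R = {x :: ('k, 'r) gvert. \<exists>a n. x = Ray a n}"
  have inj: "inj_on \<sigma> R" by (auto simp: inj_on_def \<sigma>_def R_def)
  have img: "Ray a (Suc n) \<in> \<sigma> ` R" for a n
    by (rule image_eqI[of _ _ "Ray a n"]) (auto simp: \<sigma>_def R_def)
  have out1: "\<phi> x * shr \<psi> x = 0" if "x \<notin> \<sigma> ` R" for x
  proof -
    have "shr \<psi> x = 0" using that img by (cases "(\<psi>, x)" rule: shr.cases) auto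
    then show ?thesis by simp
  qed
  have out2: "shl \<phi> x * \<psi> x = 0" if "x \<notin> R" for x
    using that by (cases x) (auto simp: R_def)
  have eq: "((\<lambda>x. \<phi> x * shr \<psi> x) \<circ> \<sigma>) x = shl \<phi> x * \<psi> x" if "x \<in> R" for x
    using that by (auto simp: R_def \<sigma>_def)
  have "(\<lambda>x. \<phi> x * shr \<psi> x) summable_on UNIV \<longleftrightarrow> (\<lambda>x. \<phi> x * shr \<psi> x) summable_on \<sigma> ` R"
    by (rule summable_on_cong_neutral) (use out1 in auto)
  also have "\<dots> \<longleftrightarrow> ((\<lambda>x. \<phi> x * shr \<psi> x) \<circ> \<sigma>) summable_on R" by (rule summable_on_reindex[OF inj])
  also have "\<dots> \<longleftrightarrow> (\<lambda>x. shl \<phi> x * \<psi> x) summable_on UNIV"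
    by (rule summable_on_cong_neutral) (use out2 eq in auto)
  finally show "(\<lambda>x. \<phi> x * shr \<psi> x) summable_on UNIV \<longleftrightarrow> (\<lambda>x. shl \<phi> x * \<psi> x) summable_on UNIV" .
  have "(\<Sum>\<^sub>\<infinity>x. \<phi> x * shr \<psi> x) = infsum (\<lambda>x. \<phi> x * shr \<psi> x) (\<sigma> ` R)"
    by (rule infsum_cong_neutral) (use out1 in auto)
  also have "\<dots> = infsum ((\<lambda>x. \<phi> x * shr \<psi> x) \<circ> \<sigma>) R" by (rule infsum_reindex[OF inj])
  also have "\<dots> = (\<Sum>\<^sub>\<infinity>x. shl \<phi> x * \<psi> x)"
    by (rule infsum_cong_neutral) (use out2 eq in auto)
  finally show "(\<Sum>\<^sub>\<infinity>x. \<phi> x * shr \<psi> x) = (\<Sum>\<^sub>\<infinity>x. shl \<phi> x * \<psi> x)" .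
qed

lemma shift_ellinf:
  fixes u :: "('k::finite, 'r::finite) gfun"
  assumes "u \<in> fset (Linf s)"
  shows "shl u \<in> fset (Linf s)" "shr u \<in> fset (Linf s)"
proof -
  define N where "N = fnorm (Linf s) u"
  have N: "0 \<le> N" unfolding N_def by (rule fnorm_ellinf_nonneg[OF assms])
  have u: "cmod (u x) \<le> N * om x ^ s" for x unfolding N_def by (rule ellinf_pointwise[OF assms])
  have "cmod (shl u x) \<le> (N * 2 ^ s) * om x ^ s" for x
  proof (cases x)
    case (Ray a n)
    have "cmod (shl u x) \<le> N * om (Ray a (Suc n) :: ('k, 'r) gvert) ^ s" using u Ray by simp
    also have "\<dots> \<le> N * (2 * om (Ray a n :: ('k, 'r) gvert)) ^ s"
      by (intro mult_left_mono power_mono om_Ray_Suc_le N) auto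
    finally show ?thesis using Ray by (simp add: power_mult_distrib mult_ac)
  qed (use N in simp)
  then show "shl u \<in> fset (Linf s)" by (rule ellinf_I)
  have "cmod (shr u x) \<le> N * om x ^ s" for x
  proof (cases "(u, x)" rule: shr.cases)
    case (3 u' a n)
    have "cmod (shr u x) \<le> N * om (Ray a n :: ('k, 'r) gvert) ^ s" using u 3 by simp
    also have "\<dots> \<le> N * om x ^ s"
      using 3 by (intro mult_left_mono N) (auto intro!: power_mono om_Ray_mono)
    finally show ?thesis .
  qed (use N in auto)
  then show "shr u \<in> fset (Linf s)" by (rule ellinf_I)
qed

lemma dual_summable:
  fixes \<phi> \<psi> :: "('k::finite, 'r::finite) gfun"
  assumes "\<phi> \<in> fset (L1 s)" "\<psi> \<in> fset (Linf s)"
  shows "(\<lambda>x. \<phi> x * \<psi> x) summable_on UNIV"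
proof -
  have "cmod (\<phi> x * \<psi> x) \<le> fnorm (Linf s) \<psi> * (om x ^ s * cmod (\<phi> x))" for x
    using mult_left_mono[OF ellinf_pointwise[OF assms(2), of x] norm_ge_zero[of "\<phi> x"]]
    by (simp add: norm_mult mult_ac)
  moreover have "(\<lambda>x. fnorm (Linf s) \<psi> * (om x ^ s * cmod (\<phi> x))) summable_on UNIV"
    using assms(1) by (intro summable_on_cmult_right) (simp add: ell1_iff)
  ultimately show ?thesis by (rule summable_on_dominated[rotated])
qed

text \<open>Summation by parts between dual weighted spaces. The form is bilinear, without
  conjugation, so that rows of the Green function can be inserted directly.\<close>

lemma D_op_symmetric:
  fixes \<phi> \<psi> :: "('k::finite, 'r::finite) gfun"
  assumes \<phi>: "\<phi> \<in> fset (L1 s)" and \<psi>: "\<psi> \<in> fset (Linf s)"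
  shows "(\<Sum>\<^sub>\<infinity>x. \<phi> x * D_op \<psi> x) = (\<Sum>\<^sub>\<infinity>x. D_op \<phi> x * \<psi> x)"
    and "(\<lambda>x. \<phi> x * D_op \<psi> x) summable_on UNIV" "(\<lambda>x. D_op \<phi> x * \<psi> x) summable_on UNIV"
proof -
  have d: "(\<lambda>x. dcoef x * \<psi> x) \<in> fset (Linf s)"
  proof (rule ellinf_I(1))
    fix x :: "('k, 'r) gvert"
    have "cmod (dcoef x) \<le> 2" by (cases x) auto
    then have "cmod (dcoef x * \<psi> x) \<le> 2 * (fnorm (Linf s) \<psi> * om x ^ s)"
      unfolding norm_mult by (intro mult_mono ellinf_pointwise[OF \<psi>]) auto
    then show "cmod (dcoef x * \<psi> x) \<le> (2 * fnorm (Linf s) \<psi>) * om x ^ s" by simp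
  qed
  note s0 = dual_summable[OF \<phi> d]
    and s1 = dual_summable[OF \<phi> shift_ellinf(1)[OF \<psi>]]
    and s2 = dual_summable[OF \<phi> shift_ellinf(2)[OF \<psi>]]
  have s1': "(\<lambda>x. \<psi> x * shr \<phi> x) summable_on UNIV" using s1 by (simp add: shift_adjoint(1) mult.commute)
  have s2': "(\<lambda>x. shl \<phi> x * \<psi> x) summable_on UNIV" using s2 by (simp add: shift_adjoint(1))
  have e1: "(\<Sum>\<^sub>\<infinity>x. \<phi> x * shl \<psi> x) = (\<Sum>\<^sub>\<infinity>x. \<psi> x * shr \<phi> x)"
    unfolding shift_adjoint(2) by (simp add: mult.commute)
  have l: "\<phi> x * D_op \<psi> x = 1 * (1 * (\<phi> x * (dcoef x * \<psi> x)) + -1 * (\<phi> x * shl \<psi> x)) + -1 * (\<phi> x * shr \<psi> x)" for x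
    by (simp add: D_op_eq algebra_simps)
  have r: "D_op \<phi> x * \<psi> x = 1 * (1 * (\<phi> x * (dcoef x * \<psi> x)) + -1 * (\<psi> x * shr \<phi> x)) + -1 * (shl \<phi> x * \<psi> x)" for x
    by (simp add: D_op_eq algebra_simps)
  show "(\<lambda>x. \<phi> x * D_op \<psi> x) summable_on UNIV" "(\<lambda>x. D_op \<phi> x * \<psi> x) summable_on UNIV"
    unfolding l r by (rule infsum_lincomb(1)[OF infsum_lincomb(1)[OF s0 s1] s2] infsum_lincomb(1)[OF infsum_lincomb(1)[OF s0 s1'] s2'])+
  show "(\<Sum>\<^sub>\<infinity>x. \<phi> x * D_op \<psi> x) = (\<Sum>\<^sub>\<infinity>x. D_op \<phi> x * \<psi> x)"
    unfolding l r infsum_lincomb(2)[OF infsum_lincomb(1)[OF s0 s1] s2] infsum_lincomb(2)[OF s0 s1]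
      infsum_lincomb(2)[OF infsum_lincomb(1)[OF s0 s1'] s2'] infsum_lincomb(2)[OF s0 s1'] e1 shift_adjoint(2) ..
qed

section \<open>Kernel operators as inverses of D + \<kappa>^2\<close>

lemma D_op_kop:
  assumes s: "\<And>x. (\<lambda>y. k x y * f y) summable_on UNIV"
  shows "D_op (kop k f) x = (\<Sum>\<^sub>\<infinity>y. D_op (\<lambda>x. k x y) x * f y)"
proof -
  have l: "(\<lambda>y. shl (\<lambda>x. k x y) x * f y) summable_on UNIV \<and> shl (kop k f) x = (\<Sum>\<^sub>\<infinity>y. shl (\<lambda>x. k x y) x * f y)" for x
    by (cases x) (auto simp: s kop_def)
  have r: "(\<lambda>y. shr (\<lambda>x. k x y) x * f y) summable_on UNIV \<and> shr (kop k f) x = (\<Sum>\<^sub>\<infinity>y. shr (\<lambda>x. k x y) x * f y)" for x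
    by (cases "(f, x)" rule: shr.cases) (auto simp: s kop_def)
  have eq: "D_op (\<lambda>x. k x y) x * f y
      = 1 * (dcoef x * (k x y * f y) + -1 * (shl (\<lambda>x. k x y) x * f y)) + -1 * (shr (\<lambda>x. k x y) x * f y)" for y
    by (simp add: D_op_eq algebra_simps)
  have "(\<Sum>\<^sub>\<infinity>y. D_op (\<lambda>x. k x y) x * f y) = 1 * (dcoef x * (\<Sum>\<^sub>\<infinity>y. k x y * f y) + -1 * shl (kop k f) x) + -1 * shr (kop k f) x"
    unfolding eq infsum_lincomb(2)[OF infsum_lincomb(1)[OF s conjunct1[OF l]] conjunct1[OF r]]
      infsum_lincomb(2)[OF s conjunct1[OF l]] by (simp only: l r)
  then show ?thesis by (simp add: D_op_eq[of "kop k f"] kop_def[of k f x])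
qed

lemma infsum_delta: "(\<Sum>\<^sub>\<infinity>y. (if x = y then 1 else 0) * f y) = (f x :: complex)"
proof -
  have "(\<Sum>\<^sub>\<infinity>y. (if x = y then 1 else 0) * f y) = infsum f {x}"
    by (rule infsum_cong_neutral) auto
  then show ?thesis by simp
qed

text \<open>Only pointwise summability and \<open>cmod \<kappa> < 1\<close> are required, so the
  result applies in the half-plane and also at \<kappa> = 0, where the kernel operator is unbounded
  on l^2.\<close>

lemma D_op_kop_green:
  assumes s: "\<And>x. (\<lambda>y. green \<kappa> x y * f y) summable_on UNIV" and \<kappa>: "cmod \<kappa> < 1"
  shows "D_op (kop (green \<kappa>) f) x + \<kappa>\<^sup>2 * kop (green \<kappa>) f x = f x"
proof -
  have k: "D_op (\<lambda>x. green \<kappa> x y) x * f y = 1 * ((if x = y then 1 else 0) * f y) + (- \<kappa>\<^sup>2) * (green \<kappa> x y * f y)" for y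
  proof -
    have "D_op (\<lambda>x. green \<kappa> x y) x = (if x = y then 1 else 0) - \<kappa>\<^sup>2 * green \<kappa> x y"
      using green_equation[OF \<kappa>, of y x] by (simp only: eq_diff_eq)
    then show ?thesis by (simp only: left_diff_distrib) simp
  qed
  have d: "(\<lambda>y. (if x = y then 1 else 0) * f y) summable_on UNIV"
  proof -
    have "(\<lambda>y. (if x = y then 1 else 0) * f y) summable_on UNIV \<longleftrightarrow> f summable_on {x}"
      by (rule summable_on_cong_neutral) auto
    then show ?thesis by simp
  qed
  show ?thesis
    unfolding D_op_kop[OF s] k infsum_lincomb(2)[OF d s] infsum_delta by (simp add: kop_def)
qed

text \<open>In the half-plane the rows of the Green function are in l^1 and \<open>u\<close> is
  bounded, which allows D to be moved onto the row; the symmetry of the kernel then turns the column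
  equation into the row equation.\<close>

lemma kop_green_D_op:
  fixes u :: "('k::finite, 'r::finite) gfun"
  assumes \<kappa>: "0 < Re \<kappa>" "cmod \<kappa> < 1" and u: "u \<in> fset ell2"
  shows "kop (green \<kappa>) (\<lambda>x. D_op u x + \<kappa>\<^sup>2 * u x) x = u x"
proof -
  note k = green_ell2(3)[OF \<kappa>, where x=x and 'k='k and 'r='r]
  have u': "u \<in> fset (Linf 0)" using bopD(2)[OF bop_id_ell2_ellinf u] .
  note D = D_op_symmetric[OF k u']
  note s = green_ell2(2)[OF \<kappa> u, of x]
  have "kop (green \<kappa>) (\<lambda>x. D_op u x + \<kappa>\<^sup>2 * u x) x = (\<Sum>\<^sub>\<infinity>y. 1 * (green \<kappa> x y * D_op u y) + \<kappa>\<^sup>2 * (green \<kappa> x y * u y))"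
    unfolding kop_def by (simp add: algebra_simps)
  also have "\<dots> = 1 * (\<Sum>\<^sub>\<infinity>y. D_op (green \<kappa> x) y * u y) + \<kappa>\<^sup>2 * (\<Sum>\<^sub>\<infinity>y. green \<kappa> x y * u y)"
    unfolding infsum_lincomb(2)[OF D(2) s] D(1) ..
  also have "\<dots> = (\<Sum>\<^sub>\<infinity>y. 1 * (D_op (green \<kappa> x) y * u y) + \<kappa>\<^sup>2 * (green \<kappa> x y * u y))"
    by (rule infsum_lincomb(2)[OF D(3) s, symmetric])
  also have "\<dots> = (\<Sum>\<^sub>\<infinity>y. (if x = y then 1 else 0) * u y)"
  proof (rule infsum_cong)
    fix y
    have e: "D_op (green \<kappa> x) y + \<kappa>\<^sup>2 * green \<kappa> x y = (if x = y then 1 else 0)"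
      using green_equation[OF \<kappa>(2), of x y] by (simp add: green_commute[of \<kappa> _ x] eq_commute[of x y])
    show "1 * (D_op (green \<kappa> x) y * u y) + \<kappa>\<^sup>2 * (green \<kappa> x y * u y) = (if x = y then 1 else 0) * u y"
      unfolding e[symmetric] by (simp add: distrib_right)
  qed
  finally show ?thesis by (simp only: infsum_delta)
qed

text \<open>Membership in l^2 is summability of the pointwise square, and shifts commute with
  squaring. \<open>shift_adjoint\<close> against the constant function 1 then settles the shifted
  squares.\<close>

lemma D_op_ell2:
  fixes u :: "('k::finite, 'r::finite) gfun"
  assumes u: "u \<in> fset ell2"
  shows "D_op u \<in> fset ell2"
proof -
  have iff: "w \<in> fset ell2 \<longleftrightarrow> (\<lambda>x. cmod (w x * w x)) summable_on UNIV" for w :: "('k, 'r) gfun"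
    unfolding ell2_iff by (simp add: norm_mult power2_eq_square)
  have pow: "(\<lambda>x. shr w x * shr w x) = shr (\<lambda>x. w x * w x)" "(\<lambda>x. shl w x * shl w x) = shl (\<lambda>x. w x * w x)" for w :: "('k, 'r) gfun"
  proof -
    show "(\<lambda>x. shr w x * shr w x) = shr (\<lambda>x. w x * w x)"
    proof
      fix x show "shr w x * shr w x = shr (\<lambda>x. w x * w x) x" by (cases "(w, x)" rule: shr.cases) auto
    qed
    show "(\<lambda>x. shl w x * shl w x) = shl (\<lambda>x. w x * w x)"
    proof
      fix x show "shl w x * shl w x = shl (\<lambda>x. w x * w x) x" by (cases x) auto
    qed
  qed
  have abs: "(\<lambda>x. w x) summable_on UNIV \<longleftrightarrow> (\<lambda>x. cmod (w x)) summable_on UNIV" for w :: "('k, 'r) gfun"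
    by (rule summable_on_iff_abs_summable_on_complex)
  have uu: "(\<lambda>x. u x * u x) summable_on UNIV" using u unfolding iff abs .
  have "(\<lambda>x. 1 * shr (\<lambda>x. u x * u x) x) summable_on UNIV"
  proof (subst shift_adjoint(1))
    have "(\<lambda>x. shl (\<lambda>x. 1) x * (u x * u x)) summable_on UNIV"
    proof (rule summable_on_dominated)
      show "(\<lambda>x. cmod (u x * u x)) summable_on UNIV" using u unfolding iff .
      fix x show "cmod (shl (\<lambda>x. 1) x * (u x * u x)) \<le> cmod (u x * u x)" by (cases x) auto
    qed
    then show "(\<lambda>x. shl (\<lambda>x. 1) x * (u x * u x)) summable_on UNIV" .
  qed
  then have r: "shr u \<in> fset ell2" unfolding iff abs[symmetric] pow by simp
  have "(\<lambda>x. shl (\<lambda>x. u x * u x) x * 1) summable_on UNIV"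
  proof (subst shift_adjoint(1)[symmetric])
    show "(\<lambda>x. u x * u x * shr (\<lambda>x. 1) x) summable_on UNIV"
    proof (rule summable_on_dominated)
      show "(\<lambda>x. cmod (u x * u x)) summable_on UNIV" using u unfolding iff .
      fix x show "cmod (u x * u x * shr (\<lambda>x. 1) x) \<le> cmod (u x * u x)"
        by (cases "(u, x)" rule: shr.cases) auto
    qed
  qed
  then have l: "shl u \<in> fset ell2" unfolding iff abs[symmetric] pow by simp
  have d: "(\<lambda>x. dcoef x * u x) \<in> fset ell2"
    unfolding ell2_iff
  proof (rule summable_on_dominated)
    show "(\<lambda>x. 4 * (cmod (u x))\<^sup>2) summable_on UNIV"
      using u by (intro summable_on_cmult_right) (simp add: ell2_iff)
    fix x show "norm ((cmod (dcoef x * u x))\<^sup>2) \<le> 4 * (cmod (u x))\<^sup>2"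
      by (cases x) (auto simp: norm_mult power_mult_distrib)
  qed
  have "(\<lambda>x. 1 * (1 * (dcoef x * u x) + -1 * shl u x) + -1 * shr u x) \<in> fset ell2"
    by (intro quasi_normedD(2)[OF quasi_normed_ell2] d l r)
  moreover have "(\<lambda>x. 1 * (1 * (dcoef x * u x) + -1 * shl u x) + -1 * shr u x) = D_op u"
    by (rule ext) (simp add: D_op_eq)
  ultimately show ?thesis by simp
qed

text \<open>At the threshold, solutions of \<open>D w = 0\<close> grow linearly on the rays.\<close>

lemma D_op_bounded_kernel:
  fixes w :: "('k::finite, 'r::finite) gfun"
  assumes D: "\<And>x. D_op w x = 0" and bd: "\<And>x. cmod (w x) \<le> C"
  shows "w x = 0"
proof (cases x)
  case (Core c)
  then show ?thesis using D[of x] by simp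
next
  case (Ray a n)
  have step0: "w (Ray a 1) = 2 * w (Ray a 0)" using D[of "Ray a 0"] by simp
  have step: "w (Ray a (Suc (Suc n))) = 2 * w (Ray a (Suc n)) - w (Ray a n)" for n
    using D[of "Ray a (Suc n)"] by (simp add: algebra_simps)
  have lin: "w (Ray a n) = of_nat (Suc n) * w (Ray a 0) \<and> w (Ray a (Suc n)) = of_nat (Suc (Suc n)) * w (Ray a 0)" for n
  proof (induction n)
    case 0
    then show ?case using step0 by simp
  next
    case (Suc n)
    then show ?case using step[of n] by (simp add: algebra_simps)
  qed
  have "w (Ray a 0) = 0"
  proof (rule ccontr)
    assume "w (Ray a 0) \<noteq> 0"
    then have pos: "0 < cmod (w (Ray a 0))" by simp
    obtain N where N: "C < real N * cmod (w (Ray a 0))" using reals_Archimedean3[OF pos] by blast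
    have "cmod (w (Ray a N)) = real (Suc N) * cmod (w (Ray a 0))"
      using lin[of N] by (simp only: norm_mult norm_of_nat)
    then show False using bd[of "Ray a N"] N pos by (simp add: algebra_simps)
  qed
  then show ?thesis using lin[of n] Ray by simp
qed

section \<open>Compact perturbations\<close>

text \<open>The uniformly small tails make such an operator a norm limit of operators of finite rank.\<close>

definition tight :: "nat \<Rightarrow> ('k::finite, 'r::finite) gop \<Rightarrow> bool" where
  "tight s A \<longleftrightarrow> (\<exists>C. bop (Linf s) (L1 s) C A) \<and>
    (\<forall>e>0. \<exists>F. finite F \<and> (\<forall>u\<in>fset (Linf s). \<forall>G. finite G \<longrightarrow> G \<inter> F = {} \<longrightarrow>
      (\<Sum>x\<in>G. om x ^ s * cmod (A u x)) \<le> e * fnorm (Linf s) u))"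

lemma tightD_bop:
  assumes "tight s A"
  obtains C where "bop (Linf s) (L1 s) C A"
  using assms unfolding tight_def by blast

lemma tightD_tail:
  assumes "tight s A" "0 < e"
  obtains F where "finite F"
    "\<And>u G. u \<in> fset (Linf s) \<Longrightarrow> finite G \<Longrightarrow> G \<inter> F = {} \<Longrightarrow>
      (\<Sum>x\<in>G. om x ^ s * cmod (A u x)) \<le> e * fnorm (Linf s) u"
  using assms unfolding tight_def by meson

lemma tight_add:
  fixes A B :: "('k::finite, 'r::finite) gop"
  assumes A: "tight s A" and B: "tight s B"
  shows "tight s (\<lambda>u x. A u x + B u x)"
  unfolding tight_def
proof (intro conjI allI impI)
  obtain C D where "bop (Linf s) (L1 s) C A" "bop (Linf s) (L1 s) D B"
    using tightD_bop[OF A] tightD_bop[OF B] by metis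
  from bop_lincomb[OF this quasi_normed_ell1, of 1 1]
  show "\<exists>C. bop (Linf s) (L1 s) C (\<lambda>u x. A u x + B u x)" by auto
  fix e :: real assume "0 < e"
  then have e: "0 < e / 2" by simp
  obtain F1 where F1: "finite F1"
    "\<And>u G. u \<in> fset (Linf s) \<Longrightarrow> finite G \<Longrightarrow> G \<inter> F1 = {} \<Longrightarrow>
      (\<Sum>x\<in>G. om x ^ s * cmod (A u x)) \<le> e / 2 * fnorm (Linf s) u"
    by (rule tightD_tail[OF A e]) (rule that)
  obtain F2 where F2: "finite F2"
    "\<And>u G. u \<in> fset (Linf s) \<Longrightarrow> finite G \<Longrightarrow> G \<inter> F2 = {} \<Longrightarrow>
      (\<Sum>x\<in>G. om x ^ s * cmod (B u x)) \<le> e / 2 * fnorm (Linf s) u"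
    by (rule tightD_tail[OF B e]) (rule that)
  have "(\<Sum>x\<in>G. om x ^ s * cmod (A u x + B u x)) \<le> e * fnorm (Linf s) u"
    if u: "u \<in> fset (Linf s)" and G: "finite G" "G \<inter> (F1 \<union> F2) = {}" for u G
  proof -
    have "(\<Sum>x\<in>G. om x ^ s * cmod (A u x + B u x)) \<le> (\<Sum>x\<in>G. om x ^ s * cmod (A u x) + om x ^ s * cmod (B u x))"
      unfolding distrib_left[symmetric] by (intro sum_mono mult_left_mono norm_triangle_ineq) auto
    also have "\<dots> = (\<Sum>x\<in>G. om x ^ s * cmod (A u x)) + (\<Sum>x\<in>G. om x ^ s * cmod (B u x))"
      by (rule sum.distrib)
    also have "\<dots> \<le> e / 2 * fnorm (Linf s) u + e / 2 * fnorm (Linf s) u"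
      using G by (intro add_mono F1(2) F2(2) u) auto
    finally show ?thesis by simp
  qed
  then show "\<exists>F. finite F \<and> (\<forall>u\<in>fset (Linf s). \<forall>G. finite G \<longrightarrow> G \<inter> F = {} \<longrightarrow>
      (\<Sum>x\<in>G. om x ^ s * cmod (A u x + B u x)) \<le> e * fnorm (Linf s) u)"
    using F1(1) F2(1) by (intro exI[of _ "F1 \<union> F2"]) simp
qed

lemma tight_assumption_A:
  fixes V :: "('k::finite, 'r::finite) gop"
  assumes A: "assumption_A TYPE('h::complex_hilbert) (real t) V" and st: "s \<le> t"
  shows "tight s V"
  unfolding tight_def
proof (intro conjI allI impI)
  obtain C where C: "bop (Linf t) (L1 t) C V" by (rule assumption_A_bounded[OF A])
  from bop_comp[OF bop_comp[OF bop_id_ellinf[OF st] C] bop_id_ell1[OF st]]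
  show "\<exists>C. bop (Linf s) (L1 s) C V" by auto
  fix e :: real assume e: "0 < e"
  obtain F where F: "finite F"
    "\<And>\<Phi> G. \<Phi> \<in> fset (Linf t) \<Longrightarrow> finite G \<Longrightarrow> G \<inter> F = {} \<Longrightarrow>
      (\<Sum>x\<in>G. om x ^ t * cmod (V \<Phi> x)) \<le> e * fnorm (Linf t) \<Phi>"
    by (rule assumption_A_tail[OF A e]) (rule that)
  have "(\<Sum>x\<in>G. om x ^ s * cmod (V u x)) \<le> e * fnorm (Linf s) u"
    if u: "u \<in> fset (Linf s)" and G: "finite G" "G \<inter> F = {}" for u G
  proof -
    have "(\<Sum>x\<in>G. om x ^ s * cmod (V u x)) \<le> (\<Sum>x\<in>G. om x ^ t * cmod (V u x))"
      by (intro sum_mono mult_right_mono om_pow_mono st) auto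
    also have "\<dots> \<le> e * fnorm (Linf t) u"
      by (rule F(2)[OF bopD(2)[OF bop_id_ellinf[OF st] u] G])
    also have "\<dots> \<le> e * fnorm (Linf s) u"
      using bopD(3)[OF bop_id_ellinf[OF st] u] e by (intro mult_left_mono) auto
    finally show ?thesis .
  qed
  then show "\<exists>F. finite F \<and> (\<forall>u\<in>fset (Linf s). \<forall>G. finite G \<longrightarrow> G \<inter> F = {} \<longrightarrow>
      (\<Sum>x\<in>G. om x ^ s * cmod (V u x)) \<le> e * fnorm (Linf s) u)"
    using F(1) by blast
qed

lemma ell1_tail:
  assumes u: "u \<in> fset (L1 s)" and e: "0 < e"
  obtains F where "finite F" "\<And>G. finite G \<Longrightarrow> G \<inter> F = {} \<Longrightarrow> (\<Sum>x\<in>G. om x ^ s * cmod (u x)) \<le> e"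
proof -
  define N where "N = fnorm (L1 s) u"
  have "\<exists>F. finite F \<and> N - e < (\<Sum>x\<in>F. om x ^ s * cmod (u x))"
  proof (rule ccontr)
    assume "\<not> ?thesis"
    then have "fnorm (L1 s) u \<le> N - e" by (intro ell1_I(2)) (auto simp: not_less)
    then show False using e by (simp add: N_def)
  qed
  then obtain F where F: "finite F" "N - e < (\<Sum>x\<in>F. om x ^ s * cmod (u x))" by blast
  show ?thesis
  proof (rule that[OF F(1)])
    fix G assume G: "finite G" "G \<inter> F = {}"
    have "(\<Sum>x\<in>G \<union> F. om x ^ s * cmod (u x)) \<le> N"
      unfolding N_def by (rule ell1_finite_sum_le[OF u]) (use F G in auto)
    then show "(\<Sum>x\<in>G. om x ^ s * cmod (u x)) \<le> e"
      using F(2) by (simp add: sum.union_disjoint[OF G(1) F(1) G(2)])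
  qed
qed

lemma pairing_ell1_le:
  assumes "\<Psi> \<in> fset (L1 s)" "u \<in> fset (Linf s)"
  shows "cmod (pairing \<Psi> u) \<le> fnorm (L1 s) \<Psi> * fnorm (Linf s) u"
  using pairing_le[OF assms(2,1)] by (subst pairing_commute) (simp add: mult.commute)

lemma pairing_ell1_summable:
  assumes "\<Psi> \<in> fset (L1 s)" "u \<in> fset (Linf s)"
  shows "(\<lambda>x. cnj (\<Psi> x) * u x) summable_on UNIV"
proof -
  have "(\<lambda>x. cnj (cnj (u x) * \<Psi> x)) summable_on UNIV"
    using pairing_summable[OF assms(2,1)] by (simp only: summable_on_cnj_iff)
  then show ?thesis by (simp add: mult.commute)
qed

lemma ket_bra_bop:
  fixes \<Psi> :: "('k::finite, 'r::finite) gfun"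
  assumes \<Psi>: "\<Psi> \<in> fset (L1 s)"
  shows "bop (Linf s) (L1 s) ((fnorm (L1 s) \<Psi>)\<^sup>2) (\<lambda>u x. pairing \<Psi> u * \<Psi> x)"
  unfolding bop_def
proof (intro conjI ballI allI)
  let ?N = "fnorm (L1 s) \<Psi>"
  show "0 \<le> ?N\<^sup>2" by simp
  fix u :: "('k, 'r) gfun" assume u: "u \<in> fset (Linf s)"
  have *: "(\<Sum>x\<in>F. om x ^ s * cmod (pairing \<Psi> u * \<Psi> x)) \<le> ?N\<^sup>2 * fnorm (Linf s) u"
    if F: "finite F" for F
  proof -
    have "(\<Sum>x\<in>F. om x ^ s * cmod (pairing \<Psi> u * \<Psi> x)) = cmod (pairing \<Psi> u) * (\<Sum>x\<in>F. om x ^ s * cmod (\<Psi> x))"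
      by (simp add: norm_mult sum_distrib_left mult_ac)
    also have "\<dots> \<le> (?N * fnorm (Linf s) u) * ?N"
      by (intro mult_mono pairing_ell1_le[OF \<Psi> u] ell1_finite_sum_le[OF \<Psi> F] mult_nonneg_nonneg
          fnorm_ell1_nonneg fnorm_ellinf_nonneg[OF u] sum_nonneg) auto
    finally show ?thesis by (simp add: power2_eq_square mult_ac)
  qed
  show "(\<lambda>x. pairing \<Psi> u * \<Psi> x) \<in> fset (L1 s)"
    "fnorm (L1 s) (\<lambda>x. pairing \<Psi> u * \<Psi> x) \<le> ?N\<^sup>2 * fnorm (Linf s) u"
    by (rule ell1_I(1)[OF *], assumption) (rule ell1_I(2)[OF *])
  fix w :: "('k, 'r) gfun" and a c assume w: "w \<in> fset (Linf s)"
  show "(\<lambda>x. pairing \<Psi> (\<lambda>x. a * u x + c * w x) * \<Psi> x) = (\<lambda>x. a * (pairing \<Psi> u * \<Psi> x) + c * (pairing \<Psi> w * \<Psi> x))"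
    unfolding pairing_lincomb_right[OF pairing_ell1_summable[OF \<Psi> u] pairing_ell1_summable[OF \<Psi> w]]
    by (simp add: algebra_simps)
qed

lemma tight_ket_bra:
  fixes \<Psi> :: "('k::finite, 'r::finite) gfun"
  assumes \<Psi>: "\<Psi> \<in> fset (L1 s)"
  shows "tight s (\<lambda>u x. pairing \<Psi> u * \<Psi> x)"
  unfolding tight_def
proof (intro conjI allI impI)
  show "\<exists>C. bop (Linf s) (L1 s) C (\<lambda>u x. pairing \<Psi> u * \<Psi> x)"
    using ket_bra_bop[OF \<Psi>] by blast
  fix e :: real assume e: "0 < e"
  define N where "N = fnorm (L1 s) \<Psi> + 1"
  have N: "fnorm (L1 s) \<Psi> \<le> N" "0 < N"
    using fnorm_ell1_nonneg[of s \<Psi>] by (auto simp: N_def)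
  obtain F where F: "finite F" "\<And>G. finite G \<Longrightarrow> G \<inter> F = {} \<Longrightarrow> (\<Sum>x\<in>G. om x ^ s * cmod (\<Psi> x)) \<le> e / N"
    using ell1_tail[OF \<Psi>, of "e / N"] e N by auto
  have "(\<Sum>x\<in>G. om x ^ s * cmod (pairing \<Psi> u * \<Psi> x)) \<le> e * fnorm (Linf s) u"
    if u: "u \<in> fset (Linf s)" and G: "finite G" "G \<inter> F = {}" for u G
  proof -
    have u0: "0 \<le> fnorm (Linf s) u" by (rule fnorm_ellinf_nonneg[OF u])
    have "(\<Sum>x\<in>G. om x ^ s * cmod (pairing \<Psi> u * \<Psi> x)) = cmod (pairing \<Psi> u) * (\<Sum>x\<in>G. om x ^ s * cmod (\<Psi> x))"
      by (simp add: norm_mult sum_distrib_left mult_ac)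
    also have "\<dots> \<le> (N * fnorm (Linf s) u) * (e / N)"
    proof (rule mult_mono[OF _ F(2)[OF G]])
      show "cmod (pairing \<Psi> u) \<le> N * fnorm (Linf s) u"
        by (rule order_trans[OF pairing_ell1_le[OF \<Psi> u] mult_right_mono[OF N(1) u0]])
    qed (use N u0 in \<open>auto intro: sum_nonneg\<close>)
    also have "\<dots> = e * fnorm (Linf s) u" using N by simp
    finally show ?thesis .
  qed
  then show "\<exists>F. finite F \<and> (\<forall>u\<in>fset (Linf s). \<forall>G. finite G \<longrightarrow> G \<inter> F = {} \<longrightarrow>
      (\<Sum>x\<in>G. om x ^ s * cmod (pairing \<Psi> u * \<Psi> x)) \<le> e * fnorm (Linf s) u)"
    using F(1) by blast
qed

lemma tight_zero: "tight s (\<lambda>u x. 0)"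
  unfolding tight_def
proof (intro conjI allI impI)
  show "\<exists>C. bop (Linf s) (L1 s) C (\<lambda>u x. 0)"
    using bop_zero[OF quasi_normed_ell1] zero_in_ell1 by blast
  show "\<exists>F. finite F \<and> (\<forall>u\<in>fset (Linf s). \<forall>G. finite G \<longrightarrow> G \<inter> F = {} \<longrightarrow>
      (\<Sum>x\<in>G. om x ^ s * cmod 0) \<le> e * fnorm (Linf s) u)" if "0 < e" for e
    using that fnorm_ellinf_nonneg by (intro exI[of _ "{}"]) (auto intro!: mult_nonneg_nonneg)
qed

lemma tight_ket_bra_sum:
  fixes B :: "('k::finite, 'r::finite) gfun set"
  assumes "finite B" "B \<subseteq> fset (L1 s)"
  shows "tight s (ket_bra_sum B)"
proof -
  have "tight s (\<lambda>u x. \<Sum>\<Psi>\<in>B. pairing \<Psi> u * \<Psi> x)"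
    using assms
  proof (induction B rule: finite_induct)
    case empty
    then show ?case using tight_zero by simp
  next
    case (insert \<Psi> B)
    then show ?case using tight_add[OF tight_ket_bra[of \<Psi> s], of "\<lambda>u x. \<Sum>\<Psi>\<in>B. pairing \<Psi> u * \<Psi> x"]
      by simp
  qed
  then show ?thesis unfolding ket_bra_sum_def .
qed

subsection \<open>The core\<close>

text \<open>The subtracted \<open>u\<close> compensates the identity that \<open>D_op\<close> puts
  on the core. That identity keeps the free inverse regular at \<kappa> = 0 there, with value
  \<open>1 / (1 + \<kappa>\<^sup>2)\<close>.\<close>

fun C_op :: "'k::finite set set \<Rightarrow> ('r::finite \<Rightarrow> 'k) \<Rightarrow> ('k, 'r) gop" where
  "C_op E b u (Core c) = h_core E b (\<lambda>y. u (Core y)) c - u (Core c)"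
| "C_op E b u (Ray a n) = 0"

lemma H_free_eq: "H_free E b u x = D_op u x + C_op E b u x"
  by (cases x) auto

lemma C_op_lincomb: "C_op E b (\<lambda>x. a * u x + c * w x) x = a * C_op E b u x + c * C_op E b w x"
proof (cases x)
  case (Core z)
  have "(\<Sum>y | {z, y} \<in> E. a * u (Core z) + c * w (Core z) - (a * u (Core y) + c * w (Core y)))
      = a * (\<Sum>y | {z, y} \<in> E. u (Core z) - u (Core y)) + c * (\<Sum>y | {z, y} \<in> E. w (Core z) - w (Core y))"
    unfolding sum_distrib_left sum.distrib[symmetric] by (rule sum.cong) (auto simp: algebra_simps)
  then show ?thesis using Core
    by (simp add: h_core_def algebra_simps sum_distrib_left sum_distrib_right sum.distrib)
qed simp

lemma C_op_bop:
  fixes E :: "'k::finite set set" and b :: "'r::finite \<Rightarrow> 'k"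
  shows "\<exists>C. bop (Linf s) (L1 t) C (C_op E b)"
proof -
  define K where "K = real (2 * CARD('k) + CARD('r) + 1)"
  have pt: "cmod (C_op E b u (Core c)) \<le> K * fnorm (Linf s) u"
    if u: "u \<in> fset (Linf s)" for u :: "('k, 'r) gfun" and c
  proof -
    define N where "N = fnorm (Linf s) u"
    have N: "0 \<le> N" unfolding N_def by (rule fnorm_ellinf_nonneg[OF u])
    have le: "cmod (u (Core y)) \<le> N" for y using ellinf_pointwise[OF u, of "Core y"] by (simp add: N_def)
    have "cmod (\<Sum>y | {c, y} \<in> E. u (Core c) - u (Core y)) \<le> (\<Sum>y | {c, y} \<in> E. 2 * N)"
    proof (rule sum_norm_le)
      fix y show "cmod (u (Core c) - u (Core y)) \<le> 2 * N"
        using norm_triangle_ineq4[of "u (Core c)" "u (Core y)"] le[of c] le[of y] by linarith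
    qed
    also have "\<dots> \<le> real (CARD('k)) * (2 * N)"
      using N by (simp add: mult_right_mono card_mono)
    finally have 1: "cmod (\<Sum>y | {c, y} \<in> E. u (Core c) - u (Core y)) \<le> real (CARD('k)) * (2 * N)" .
    have "cmod (\<Sum>\<alpha>\<in>UNIV. (if c = b \<alpha> then 1 else 0) * u (Core c)) \<le> (\<Sum>\<alpha>\<in>(UNIV::'r set). N)"
      by (rule sum_norm_le) (use le N in auto)
    then have 2: "cmod (\<Sum>\<alpha>\<in>UNIV. (if c = b \<alpha> then 1 else 0) * u (Core c)) \<le> real (CARD('r)) * N" by simp
    have "cmod (C_op E b u (Core c)) \<le> real (CARD('k)) * (2 * N) + real (CARD('r)) * N + N"
      unfolding C_op.simps h_core_def
      by (rule order_trans[OF norm_triangle_ineq4 add_mono[OF order_trans[OF norm_triangle_ineq add_mono[OF 1 2]] le]])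
    also have "\<dots> = K * N" by (simp add: K_def algebra_simps)
    finally show ?thesis by (simp add: N_def)
  qed
  have K: "0 \<le> K" by (simp add: K_def)
  have "(\<Sum>x\<in>F. om x ^ t * cmod (C_op E b u x)) \<le> (real (CARD('k)) * K) * fnorm (Linf s) u"
    if u: "u \<in> fset (Linf s)" and F: "finite F" for u :: "('k, 'r) gfun" and F
  proof -
    have zero: "C_op E b u x = 0" if "x \<notin> range Core" for x
      using that by (cases x) auto
    have "(\<Sum>x\<in>F. om x ^ t * cmod (C_op E b u x)) = (\<Sum>x\<in>F \<inter> range Core. om x ^ t * cmod (C_op E b u x))"
      by (rule sum.mono_neutral_right) (use F zero in auto)
    also have "\<dots> \<le> (\<Sum>x\<in>range Core. om x ^ t * cmod (C_op E b u x))"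
      by (rule sum_mono2) auto
    also have "\<dots> = (\<Sum>c\<in>UNIV. cmod (C_op E b u (Core c)))"
      by (subst sum.reindex) (auto intro: inj_onI)
    also have "\<dots> \<le> (\<Sum>c\<in>(UNIV::'k set). K * fnorm (Linf s) u)"
      by (rule sum_mono[OF pt[OF u]])
    finally show ?thesis by simp
  qed
  then have "bop (Linf s) (L1 t) (real (CARD('k)) * K) (C_op E b)"
    unfolding bop_def using K by (auto intro!: ell1_I simp: C_op_lincomb)
  then show ?thesis by blast
qed

lemma tight_C_op: "tight s (C_op E b)"
  unfolding tight_def
proof (intro conjI allI impI C_op_bop)
  fix e :: real assume e: "0 < e"
  show "\<exists>F. finite F \<and> (\<forall>u\<in>fset (Linf s). \<forall>G. finite G \<longrightarrow> G \<inter> F = {} \<longrightarrow>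
      (\<Sum>x\<in>G. om x ^ s * cmod (C_op E b u x)) \<le> e * fnorm (Linf s) u)"
  proof (intro exI[of _ "range Core"] conjI ballI allI impI)
    fix u :: "('a, 'b) gfun" and G :: "('a, 'b) gvert set"
    assume u: "u \<in> fset (Linf s)" and G: "G \<inter> range Core = {}"
    have "C_op E b u x = 0" if "x \<in> G" for x using that G by (cases x) auto
    then have "(\<Sum>x\<in>G. om x ^ s * cmod (C_op E b u x)) = 0" by (intro sum.neutral) simp
    then show "(\<Sum>x\<in>G. om x ^ s * cmod (C_op E b u x)) \<le> e * fnorm (Linf s) u"
      using e fnorm_ellinf_nonneg[OF u] by simp
  qed simp
qed

lemma C_op_symmetric: "pairing \<Psi> (C_op E b \<Phi>) = pairing (C_op E b \<Psi>) \<Phi>"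
proof -
  define e where "e c d = (if {c, d} \<in> E then 1 else 0 :: complex)" for c d
  define n where "n c = (\<Sum>\<alpha>\<in>UNIV. (if c = b \<alpha> then 1 else 0 :: complex))" for c
  have core: "C_op E b u (Core c) = (\<Sum>d\<in>UNIV. e c d * (u (Core c) - u (Core d))) + n c * u (Core c) - u (Core c)"
    for u :: "('a, 'b) gfun" and c
  proof -
    have "(\<Sum>d | {c, d} \<in> E. u (Core c) - u (Core d)) = (\<Sum>d\<in>UNIV. e c d * (u (Core c) - u (Core d)))"
      by (rule sum.mono_neutral_cong_left) (auto simp: e_def)
    then show ?thesis by (simp add: h_core_def n_def sum_distrib_right)
  qed
  have fin: "(\<Sum>\<^sub>\<infinity>x. f x) = (\<Sum>c\<in>UNIV. f (Core c))" if "\<And>a n. f (Ray a n) = 0" for f :: "('a, 'b) gvert \<Rightarrow> complex"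
  proof -
    have "(\<Sum>\<^sub>\<infinity>x. f x) = infsum f (range Core)"
    proof (rule infsum_cong_neutral)
      fix x :: "('a, 'b) gvert" assume "x \<in> UNIV - range Core"
      then show "f x = 0" using that by (cases x) auto
    qed auto
    also have "\<dots> = sum f (range Core)" by simp
    also have "\<dots> = (\<Sum>c\<in>UNIV. f (Core c))" by (subst sum.reindex) (auto intro: inj_onI)
    finally show ?thesis .
  qed
  have e_sym: "e c d = e d c" for c d by (simp add: e_def insert_commute)
  have cnj: "cnj (e c d) = e c d" "cnj (n c) = n c" for c d by (auto simp: e_def n_def intro!: sum.cong)
  have swap: "(\<Sum>c\<in>UNIV. \<Sum>d\<in>UNIV. e c d * (cnj (\<Psi> (Core c)) * \<Phi> (Core d)))
      = (\<Sum>c\<in>UNIV. \<Sum>d\<in>UNIV. e c d * (cnj (\<Psi> (Core d)) * \<Phi> (Core c)))"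
    by (subst sum.swap) (simp add: e_sym)
  have "pairing \<Psi> (C_op E b \<Phi>) = (\<Sum>c\<in>UNIV. cnj (\<Psi> (Core c)) * C_op E b \<Phi> (Core c))"
    unfolding pairing_def by (rule fin) simp
  also have "\<dots> = (\<Sum>c\<in>UNIV. \<Sum>d\<in>UNIV. e c d * (cnj (\<Psi> (Core c)) * \<Phi> (Core c)))
      - (\<Sum>c\<in>UNIV. \<Sum>d\<in>UNIV. e c d * (cnj (\<Psi> (Core c)) * \<Phi> (Core d)))
      + (\<Sum>c\<in>UNIV. (n c - 1) * (cnj (\<Psi> (Core c)) * \<Phi> (Core c)))"
    unfolding core sum_subtractf[symmetric] sum.distrib[symmetric]
    by (rule sum.cong) (simp_all add: algebra_simps sum_distrib_left sum_subtractf sum.distrib)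
  also have "\<dots> = (\<Sum>c\<in>UNIV. cnj (C_op E b \<Psi> (Core c)) * \<Phi> (Core c))"
    unfolding swap core sum_subtractf[symmetric] sum.distrib[symmetric]
    by (rule sum.cong) (simp_all add: algebra_simps sum_distrib_left sum_subtractf sum.distrib cnj)
  also have "\<dots> = pairing (C_op E b \<Psi>) \<Phi>"
    unfolding pairing_def by (rule fin[symmetric]) simp
  finally show ?thesis .
qed

section \<open>The threshold\<close>

lemma norm_green_coeff_0_le_om: "1 \<le> s \<Longrightarrow> cmod (green_coeff 0 x y) \<le> 1 * om x ^ t * om y ^ s"
proof -
  assume s: "1 \<le> s"
  have "cmod (green_coeff 0 x y) \<le> 1 * om y ^ 1" using norm_green_coeff_0_le[of x y] by simp
  also have "\<dots> \<le> om x ^ t * om y ^ s"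
    by (intro mult_mono om_pow_ge_1 om_pow_mono s) auto
  finally show ?thesis by simp
qed

lemma kop_green_coeff_0_bop: "1 \<le> s \<Longrightarrow> bop (L1 s) (Linf t) 1 (kop (green_coeff 0))"
  by (rule kop_bop[OF norm_green_coeff_0_le_om]) auto

text \<open>Tightness gives a finite set outside which \<open>A u\<close> has norm at most half that
  of \<open>u\<close>; G_0 has bound 1, so this part stays a contraction. The values of
  \<open>A u\<close> on the finite set contribute finitely many columns of the Green
  function.\<close>

lemma kop_green_coeff_0_decomposition:
  fixes A :: "('k::finite, 'r::finite) gop"
  assumes s: "1 \<le> s" and A: "tight s A"
  obtains F S where "finite F" "bop (Linf s) (Linf s) (1 / 2) S"
    "\<And>u. u \<in> fset (Linf s) \<Longrightarrow> kop (green_coeff 0) (A u) = (\<lambda>x. (\<Sum>y\<in>F. A u y * green_coeff 0 x y) + S u x)"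
proof -
  have half: "(0::real) < 1 / 2" by simp
  obtain F where F: "finite F"
    "\<And>u G. u \<in> fset (Linf s) \<Longrightarrow> finite G \<Longrightarrow> G \<inter> F = {} \<Longrightarrow>
      (\<Sum>x\<in>G. om x ^ s * cmod (A u x)) \<le> 1 / 2 * fnorm (Linf s) u"
    by (rule tightD_tail[OF A half]) (rule that)
  obtain C where C: "bop (Linf s) (L1 s) C A" by (rule tightD_bop[OF A])
  define cut where "cut w x = (if x \<in> F then 0 else w x)" for w :: "('k, 'r) gfun" and x
  have "bop (Linf s) (L1 s) (1 / 2) (\<lambda>u. cut (A u))"
    unfolding bop_def
  proof (intro conjI ballI allI)
    fix u :: "('k, 'r) gfun" assume u: "u \<in> fset (Linf s)"
    have *: "(\<Sum>x\<in>G. om x ^ s * cmod (cut (A u) x)) \<le> 1 / 2 * fnorm (Linf s) u" if G: "finite G" for G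
    proof -
      have "(\<Sum>x\<in>G. om x ^ s * cmod (cut (A u) x)) = (\<Sum>x\<in>G - F. om x ^ s * cmod (A u x))"
        by (rule sum.mono_neutral_cong_right) (use G in \<open>auto simp: cut_def\<close>)
      also have "\<dots> \<le> 1 / 2 * fnorm (Linf s) u" by (rule F(2)[OF u]) (use G in auto)
      finally show ?thesis .
    qed
    show "cut (A u) \<in> fset (L1 s)" "fnorm (L1 s) (cut (A u)) \<le> 1 / 2 * fnorm (Linf s) u"
      by (rule ell1_I(1)[OF *], assumption) (rule ell1_I(2)[OF *])
    fix w :: "('k, 'r) gfun" and a c assume w: "w \<in> fset (Linf s)"
    show "cut (A (\<lambda>x. a * u x + c * w x)) = (\<lambda>x. a * cut (A u) x + c * cut (A w) x)"
      unfolding bopD(4)[OF C u w] by (auto simp: cut_def)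
  qed simp
  note cut = this
  have S: "bop (Linf s) (Linf s) (1 / 2) (\<lambda>u. kop (green_coeff 0) (cut (A u)))"
    using bop_comp[OF cut kop_green_coeff_0_bop[OF s]] by simp
  show ?thesis
  proof (rule that[OF F(1) S])
    fix u :: "('k, 'r) gfun" assume u: "u \<in> fset (Linf s)"
    define keep where "keep x = (if x \<in> F then A u x else 0)" for x
    have sm1: "(\<lambda>y. green_coeff 0 x y * cut (A u) y) summable_on UNIV" for x
      by (rule kop_summable(1)[OF norm_green_coeff_0_le_om[OF s, where t=0] bopD(2)[OF cut u]])
    have "(\<lambda>y. green_coeff 0 x y * keep y) summable_on UNIV \<longleftrightarrow> (\<lambda>y. green_coeff 0 x y * keep y) summable_on F" for x
      by (rule summable_on_cong_neutral) (auto simp: keep_def)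
    then have sm2: "(\<lambda>y. green_coeff 0 x y * keep y) summable_on UNIV" for x using F(1) by simp
    have split: "A u = (\<lambda>y. 1 * keep y + 1 * cut (A u) y)" by (auto simp: keep_def cut_def)
    show "kop (green_coeff 0) (A u) = (\<lambda>x. (\<Sum>y\<in>F. A u y * green_coeff 0 x y) + kop (green_coeff 0) (cut (A u)) x)"
    proof
      fix x
      have "kop (green_coeff 0) keep x = (\<Sum>\<^sub>\<infinity>y\<in>F. A u y * green_coeff 0 x y)"
        unfolding kop_def by (rule infsum_cong_neutral) (auto simp: keep_def)
      then have keep: "kop (green_coeff 0) keep x = (\<Sum>y\<in>F. A u y * green_coeff 0 x y)" using F(1) by simp
      have "kop (green_coeff 0) (A u) x = 1 * kop (green_coeff 0) keep x + 1 * kop (green_coeff 0) (cut (A u)) x"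
        by (subst split) (rule kop_lincomb[OF sm2 sm1])
      then show "kop (green_coeff 0) (A u) x = (\<Sum>y\<in>F. A u y * green_coeff 0 x y) + kop (green_coeff 0) (cut (A u)) x"
        by (simp add: keep)
    qed
  qed
qed

lemma ell1_pointwise_le: "u \<in> fset (L1 s) \<Longrightarrow> cmod (u x) \<le> fnorm (L1 s) u"
proof -
  assume u: "u \<in> fset (L1 s)"
  have "cmod (u x) \<le> om x ^ s * cmod (u x)"
    using mult_right_mono[OF om_pow_ge_1[of x s] norm_ge_zero[of "u x"]] by simp
  also have "\<dots> \<le> fnorm (L1 s) u" using ell1_finite_sum_le[OF u, of "{x}"] by simp
  finally show ?thesis .
qed

lemma green_coeff_0_column_mem: "(\<lambda>x. green_coeff 0 x y) \<in> fset (Linf s)"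
proof (rule ellinf_I(1))
  fix x
  show "cmod (green_coeff 0 x y) \<le> om y * om x ^ s"
    using norm_green_coeff_0_le[of x y] mult_left_mono[OF om_pow_ge_1[of x s] om_ge_0[of y]] by linarith
qed

lemma threshold_fredholm:
  fixes A :: "('k::finite, 'r::finite) gop" and s :: nat
  defines "Y \<equiv> Linf s"
  assumes s: "1 \<le> s" and A: "tight s A"
    and inj: "\<And>u. u \<in> fset Y \<Longrightarrow> (\<And>x. u x + kop (green_coeff 0) (A u) x = 0) \<Longrightarrow> u = (\<lambda>x. 0)"
  shows "\<exists>L C. bop Y Y C L \<and> (\<forall>u\<in>fset Y. (\<lambda>x. L u x + kop (green_coeff 0) (A (L u)) x) = u \<and>
    L (\<lambda>x. u x + kop (green_coeff 0) (A u) x) = u)"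
proof -
  obtain C where C: "bop Y (L1 s) C A" using tightD_bop[OF A] unfolding Y_def by blast
  have T: "bop Y Y (1 * C) (\<lambda>u. kop (green_coeff 0) (A u))"
    using bop_comp[OF C kop_green_coeff_0_bop[OF s]] unfolding Y_def by simp
  obtain F S where FS: "finite F" "bop Y Y (1 / 2) S"
    "\<And>u. u \<in> fset Y \<Longrightarrow> kop (green_coeff 0) (A u) = (\<lambda>x. (\<Sum>y\<in>F. A u y * green_coeff 0 x y) + S u x)"
    using kop_green_coeff_0_decomposition[OF s A] unfolding Y_def by blast
  show ?thesis
    unfolding Y_def
  proof (rule ellinf_fredholm[where T="\<lambda>u. kop (green_coeff 0) (A u)" and S=S and I=F and \<psi>="\<lambda>y u. A u y"
        and e="\<lambda>y x. green_coeff 0 x y" and D=C, OF T[unfolded Y_def] FS(2)[unfolded Y_def] _ FS(1)])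
    show "cmod (A u y) \<le> C * fnorm (Linf s) u" if "u \<in> fset (Linf s)" for u y
      using ell1_pointwise_le[OF bopD(2)[OF C], of u y] bopD(3)[OF C, of u] that by (simp add: Y_def)
    show "A (\<lambda>x. a * u x + c * w x) y = a * A u y + c * A w y"
      if "u \<in> fset (Linf s)" "w \<in> fset (Linf s)" for u w a c y
      using bopD(4)[OF C, of u w a c] that by (simp add: Y_def)
  qed (use FS(3) inj green_coeff_0_column_mem in \<open>auto simp: Y_def\<close>)
qed

lemma threshold_kernel_finite_dim:
  fixes A :: "('k::finite, 'r::finite) gop" and s :: nat
  defines "Y \<equiv> Linf s"
  assumes s: "1 \<le> s" and A: "tight s A"
  shows "\<exists>n. \<forall>B. finite B \<longrightarrow> (\<forall>u\<in>B. u \<in> fset Y \<and> (\<forall>x. u x + kop (green_coeff 0) (A u) x = 0)) \<longrightarrow>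
    (\<forall>a. (\<forall>x. (\<Sum>u\<in>B. complex_of_real (a u) * u x) = 0) \<longrightarrow> (\<forall>u\<in>B. a u = 0)) \<longrightarrow> card B \<le> n"
proof -
  obtain C where C: "bop Y (L1 s) C A" using tightD_bop[OF A] unfolding Y_def by blast
  have T: "bop Y Y (1 * C) (\<lambda>u. kop (green_coeff 0) (A u))"
    using bop_comp[OF C kop_green_coeff_0_bop[OF s]] unfolding Y_def by simp
  obtain F S where FS: "finite F" "bop Y Y (1 / 2) S"
    "\<And>u. u \<in> fset Y \<Longrightarrow> kop (green_coeff 0) (A u) = (\<lambda>x. (\<Sum>y\<in>F. A u y * green_coeff 0 x y) + S u x)"
    using kop_green_coeff_0_decomposition[OF s A] unfolding Y_def by blast
  show ?thesis
  proof (intro exI[of _ "2 * card F"] allI impI)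
    fix B :: "('k, 'r) gfun set"
    assume B: "finite B" "\<forall>u\<in>B. u \<in> fset Y \<and> (\<forall>x. u x + kop (green_coeff 0) (A u) x = 0)"
      and ind: "\<forall>a. (\<forall>x. (\<Sum>u\<in>B. complex_of_real (a u) * u x) = 0) \<longrightarrow> (\<forall>u\<in>B. a u = 0)"
    show "card B \<le> 2 * card F"
    proof (rule ellinf_kernel_finite_dim[where T="\<lambda>u. kop (green_coeff 0) (A u)" and S=S and I=F and \<psi>="\<lambda>y u. A u y"
          and e="\<lambda>y x. green_coeff 0 x y" and D=C, OF T[unfolded Y_def] FS(2)[unfolded Y_def] _ FS(1)])
      show "cmod (A u y) \<le> C * fnorm (Linf s) u" if "u \<in> fset (Linf s)" for u y
        using ell1_pointwise_le[OF bopD(2)[OF C], of u y] bopD(3)[OF C, of u] that by (simp add: Y_def)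
      show "A (\<lambda>x. a * u x + c * w x) y = a * A u y + c * A w y"
        if "u \<in> fset (Linf s)" "w \<in> fset (Linf s)" for u w a c y
        using bopD(4)[OF C, of u w a c] that by (simp add: Y_def)
    qed (use FS(3) B ind green_coeff_0_column_mem in \<open>auto simp: Y_def\<close>)
  qed
qed

section \<open>Threshold eigenspaces\<close>

lemma pairing_self:
  assumes "(\<lambda>x. cnj (\<Psi> x) * \<Psi> x) summable_on UNIV"
  shows "pairing \<Psi> \<Psi> = complex_of_real (\<Sum>\<^sub>\<infinity>x. (cmod (\<Psi> x))\<^sup>2)"
    and "(\<lambda>x. (cmod (\<Psi> x))\<^sup>2) summable_on UNIV"
proof -
  have e: "cnj (\<Psi> x) * \<Psi> x = complex_of_real ((cmod (\<Psi> x))\<^sup>2)" for x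
    by (metis complex_norm_square mult.commute)
  have Re: "Re (cnj (\<Psi> x) * \<Psi> x) = (cmod (\<Psi> x))\<^sup>2" and Im: "Im (cnj (\<Psi> x) * \<Psi> x) = 0" for x
    unfolding e by simp_all
  have "Re (pairing \<Psi> \<Psi>) = (\<Sum>\<^sub>\<infinity>x. (cmod (\<Psi> x))\<^sup>2)"
    unfolding pairing_def infsum_Re[OF assms, symmetric] Re ..
  moreover have "Im (pairing \<Psi> \<Psi>) = 0"
    unfolding pairing_def infsum_Im[OF assms, symmetric] Im by simp
  ultimately show "pairing \<Psi> \<Psi> = complex_of_real (\<Sum>\<^sub>\<infinity>x. (cmod (\<Psi> x))\<^sup>2)"
    by (simp add: complex_eq_iff)
  show "(\<lambda>x. (cmod (\<Psi> x))\<^sup>2) summable_on UNIV"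
    using summable_on_Re[OF assms] unfolding Re .
qed

lemma pairing_self_eq_0:
  assumes sm: "(\<lambda>x. cnj (\<Psi> x) * \<Psi> x) summable_on UNIV" and "pairing \<Psi> \<Psi> = 0"
  shows "\<Psi> = (\<lambda>x. 0)"
proof
  fix x
  have "(\<Sum>x\<in>{x}. (cmod (\<Psi> x))\<^sup>2) \<le> (\<Sum>\<^sub>\<infinity>x. (cmod (\<Psi> x))\<^sup>2)"
    by (rule finite_sum_le_infsum[OF pairing_self(2)[OF sm]]) auto
  also have "\<dots> = 0" using assms(2) pairing_self(1)[OF sm] by simp
  finally show "\<Psi> x = 0" by simp
qed

text \<open>Here \<open>s\<close> is \<beta> - 2, the weight of the bound states. Boundedness and
  symmetry of \<open>V\<close> are kept at \<open>s + 2\<close>, because the asymptotics of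
  threshold solutions consume the two extra powers; compactness is only used at
  \<open>s\<close>.\<close>

locale threshold =
  fixes E :: "'k::finite set set" and b :: "'r::finite \<Rightarrow> 'k" and V :: "('k, 'r) gop" and s :: nat
  assumes s2: "2 \<le> s"
    and V_tight: "tight s V"
    and V_bop: "\<exists>C. bop (Linf (s + 2)) (L1 (s + 2)) C V"
    and V_symmetric: "\<And>\<Phi> \<Psi>. \<Phi> \<in> fset (Linf (s + 2)) \<Longrightarrow> \<Psi> \<in> fset (Linf (s + 2)) \<Longrightarrow>
      pairing \<Psi> (V \<Phi>) = pairing (V \<Psi>) \<Phi>"
begin

abbreviation X :: "('k, 'r) gvert fspace" where "X \<equiv> L1 s"
abbreviation Y :: "('k, 'r) gvert fspace" where "Y \<equiv> Linf s"

definition H :: "('k, 'r) gop" where "H = H_full E b V"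
definition A0 :: "('k, 'r) gop" where "A0 u x = V u x + C_op E b u x"
definition bound_space :: "('k, 'r) gfun set" where "bound_space = bound_eigenspace (real (s + 2)) H"

lemma s1: "1 \<le> s" using s2 by simp

lemma H_eq: "H u x = D_op u x + A0 u x"
  by (simp add: H_def H_full_def H_free_eq A0_def)

lemma A0_tight: "tight s A0"
  using tight_add[OF V_tight tight_C_op] unfolding A0_def[abs_def] .

lemma A0_bop: "\<exists>C. bop (Linf (s + 2)) (L1 (s + 2)) C A0"
proof -
  obtain C D where "bop (Linf (s + 2)) (L1 (s + 2)) C V"
    "bop (Linf (s + 2)) (L1 (s + 2)) D (C_op E b)"
    using V_bop C_op_bop[of "s + 2" "s + 2"] by blast
  from bop_lincomb[OF this quasi_normed_ell1, of 1 1] show ?thesis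
    unfolding A0_def[abs_def] by auto
qed

lemma X_subset_Y: "u \<in> fset X \<Longrightarrow> u \<in> fset (Linf t)"
  by (rule bopD(2)[OF bop_id_ell1_ellinf])

lemma Y_subset: "u \<in> fset Y \<Longrightarrow> u \<in> fset (Linf (s + 2))"
  by (rule bopD(2)[OF bop_id_ellinf]) auto

lemma A0_lincomb:
  assumes "u \<in> fset Y" "w \<in> fset Y"
  shows "A0 (\<lambda>x. a * u x + c * w x) x = a * A0 u x + c * A0 w x"
  using A0_tight bopD(4)[OF _ assms] by (metis tightD_bop)

lemma A0_mem: "u \<in> fset Y \<Longrightarrow> A0 u \<in> fset X"
  using A0_tight bopD(2) by (metis tightD_bop)

lemma H_lincomb:
  assumes "u \<in> fset Y" "w \<in> fset Y"
  shows "H (\<lambda>x. a * u x + c * w x) x = a * H u x + c * H w x"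
  by (simp add: H_eq D_op_lincomb A0_lincomb[OF assms] algebra_simps)

lemma bound_space_iff: "\<Psi> \<in> bound_space \<longleftrightarrow> \<Psi> \<in> fset X \<and> (\<forall>x. H \<Psi> x = 0)"
  unfolding bound_space_def bound_eigenspace_def gen_eigenspace_def using X_subset_Y[of \<Psi> "s + 2"]
  by auto

lemma bound_space_X: "\<Psi> \<in> bound_space \<Longrightarrow> \<Psi> \<in> fset X" and bound_space_Y: "\<Psi> \<in> bound_space \<Longrightarrow> \<Psi> \<in> fset Y"
  and bound_space_H: "\<Psi> \<in> bound_space \<Longrightarrow> H \<Psi> x = 0"
  by (auto simp: bound_space_iff intro: X_subset_Y)

lemma bound_space_lincomb: "\<Psi> \<in> bound_space \<Longrightarrow> \<Phi> \<in> bound_space \<Longrightarrow> (\<lambda>x. a * \<Psi> x + c * \<Phi> x) \<in> bound_space"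
  using quasi_normedD(2)[OF quasi_normed_ell1 bound_space_X bound_space_X] H_lincomb[OF bound_space_Y bound_space_Y]
  by (auto simp: bound_space_iff)

lemma bound_space_zero: "(\<lambda>x. 0) \<in> bound_space"
proof -
  have z: "(\<lambda>x. 0) \<in> fset Y" by simp
  have "H (\<lambda>x. 0) x = 0" for x using H_lincomb[OF z z, of 0 0 x] by simp
  then show ?thesis by (simp add: bound_space_iff)
qed

lemma bound_space_sum: "finite B \<Longrightarrow> B \<subseteq> bound_space \<Longrightarrow> (\<lambda>x. \<Sum>\<Phi>\<in>B. a \<Phi> * \<Phi> x) \<in> bound_space"
proof (induction B rule: finite_induct)
  case empty
  then show ?case by (simp add: bound_space_zero)
next
  case (insert \<Phi> B)
  then show ?case using bound_space_lincomb[of \<Phi> "\<lambda>x. \<Sum>\<Phi>\<in>B. a \<Phi> * \<Phi> x" "a \<Phi>" 1] by simp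
qed

lemma pairing_lincomb_X:
  assumes "\<Psi> \<in> fset X" "u \<in> fset Y" "w \<in> fset Y"
  shows "pairing \<Psi> (\<lambda>x. a * u x + c * w x) = a * pairing \<Psi> u + c * pairing \<Psi> w"
  by (rule pairing_lincomb_right; rule pairing_ell1_summable; fact assms)

lemma pairing_sum_right:
  assumes "finite B" "B \<subseteq> bound_space" "\<And>\<Phi>. \<Phi> \<in> B \<Longrightarrow> (\<lambda>x. cnj (\<Psi> x) * \<Phi> x) summable_on UNIV"
  shows "pairing \<Psi> (\<lambda>x. \<Sum>\<Phi>\<in>B. a \<Phi> * \<Phi> x) = (\<Sum>\<Phi>\<in>B. a \<Phi> * pairing \<Psi> \<Phi>)"
proof -
  have "pairing \<Psi> (\<lambda>x. \<Sum>\<Phi>\<in>B. a \<Phi> * \<Phi> x) = (\<Sum>\<^sub>\<infinity>x. \<Sum>\<Phi>\<in>B. a \<Phi> * (cnj (\<Psi> x) * \<Phi> x))"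
    unfolding pairing_def by (simp add: sum_distrib_left mult_ac)
  also have "\<dots> = (\<Sum>\<Phi>\<in>B. \<Sum>\<^sub>\<infinity>x. a \<Phi> * (cnj (\<Psi> x) * \<Phi> x))"
    using infsum_finite_sum[OF assms(1), of "\<lambda>\<Phi> x. a \<Phi> * (cnj (\<Psi> x) * \<Phi> x)"] assms(3)
    by (simp add: summable_on_cmult_right)
  finally show ?thesis by (simp add: infsum_cmult_right' pairing_def)
qed

lemma pairing_sum_bound_space:
  assumes "finite B" "B \<subseteq> bound_space" "\<Psi> \<in> bound_space"
  shows "pairing \<Psi> (\<lambda>x. \<Sum>\<Phi>\<in>B. a \<Phi> * \<Phi> x) = (\<Sum>\<Phi>\<in>B. a \<Phi> * pairing \<Psi> \<Phi>)"
  using assms by (intro pairing_sum_right) (auto intro!: pairing_ell1_summable bound_space_X bound_space_Y)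

text \<open>The eigenfunction decays enough to compensate the growth of \<open>w\<close>, so H can
  be moved across the pairing term by term: D by summation by parts, the interaction and the core by
  their symmetry. It annihilates the eigenfunction on the other side.\<close>

lemma pairing_bound_space_H:
  assumes \<psi>: "\<psi> \<in> bound_space" and w: "w \<in> fset Y"
  shows "pairing \<psi> (H w) = 0" and "(\<lambda>x. cnj (\<psi> x) * H w x) summable_on UNIV"
proof -
  note \<psi>X = bound_space_X[OF \<psi>] and \<psi>Y = bound_space_Y[OF \<psi>]
  have c\<psi>: "(\<lambda>x. cnj (\<psi> x)) \<in> fset X" using \<psi>X by (simp add: ell1_iff)
  note D = D_op_symmetric[OF c\<psi> w]
  have A0: "(\<lambda>x. cnj (\<psi> x) * A0 w x) summable_on UNIV" "(\<lambda>x. cnj (A0 \<psi> x) * w x) summable_on UNIV"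
    by (rule pairing_summable[OF \<psi>Y A0_mem[OF w]] pairing_ell1_summable[OF A0_mem[OF \<psi>Y] w])+
  have V_mem: "V u \<in> fset X" if "u \<in> fset Y" for u using V_tight bopD(2) that by (metis tightD_bop)
  have C_mem: "C_op E b u \<in> fset X" if "u \<in> fset Y" for u
    using C_op_bop[of s s] bopD(2) that by blast
  have A0_sym: "pairing \<psi> (A0 w) = pairing (A0 \<psi>) w"
  proof -
    have "pairing \<psi> (A0 w) = pairing \<psi> (V w) + pairing \<psi> (C_op E b w)"
      using pairing_lincomb_right[OF pairing_summable[OF \<psi>Y V_mem[OF w]] pairing_summable[OF \<psi>Y C_mem[OF w]], of 1 1]
      by (simp add: A0_def[abs_def])
    also have "\<dots> = pairing (V \<psi>) w + pairing (C_op E b \<psi>) w"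
      by (simp add: V_symmetric[OF Y_subset[OF w] Y_subset[OF \<psi>Y]] C_op_symmetric)
    also have "\<dots> = cnj (pairing w (V \<psi>) + pairing w (C_op E b \<psi>))"
      by (simp add: pairing_commute[of _ w])
    also have "\<dots> = cnj (pairing w (A0 \<psi>))"
      using pairing_lincomb_right[OF pairing_summable[OF w V_mem[OF \<psi>Y]] pairing_summable[OF w C_mem[OF \<psi>Y]], of 1 1]
      by (simp add: A0_def[abs_def])
    finally show ?thesis by (simp only: pairing_commute[of "A0 \<psi>" w])
  qed
  have eq: "cnj (\<psi> x) * H w x = 1 * (cnj (\<psi> x) * D_op w x) + 1 * (cnj (\<psi> x) * A0 w x)" for x
    by (simp add: H_eq algebra_simps)
  show "(\<lambda>x. cnj (\<psi> x) * H w x) summable_on UNIV"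
    unfolding eq by (rule infsum_lincomb(1)[OF D(2) A0(1)])
  have D_cnj: "D_op (\<lambda>x. cnj (\<psi> x)) x = cnj (D_op \<psi> x)" for x
  proof (cases x)
    case (Ray a n)
    then show ?thesis by (cases n) auto
  qed simp
  have "pairing \<psi> (H w) = (\<Sum>\<^sub>\<infinity>x. cnj (\<psi> x) * D_op w x) + pairing \<psi> (A0 w)"
    unfolding pairing_def eq infsum_lincomb(2)[OF D(2) A0(1)] by simp
  also have "\<dots> = (\<Sum>\<^sub>\<infinity>x. D_op (\<lambda>x. cnj (\<psi> x)) x * w x) + (\<Sum>\<^sub>\<infinity>x. cnj (A0 \<psi> x) * w x)"
    by (simp only: D(1) A0_sym) (simp only: pairing_def)
  also have "\<dots> = (\<Sum>\<^sub>\<infinity>x. D_op (\<lambda>x. cnj (\<psi> x)) x * w x + cnj (A0 \<psi> x) * w x)"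
    by (rule infsum_add[OF D(3) A0(2), symmetric])
  also have "\<dots> = (\<Sum>\<^sub>\<infinity>x. cnj (H \<psi> x) * w x)"
    by (simp add: D_cnj H_eq algebra_simps)
  finally show "pairing \<psi> (H w) = 0" by (simp add: bound_space_H[OF \<psi>])
qed

lemma D_op_kop_green_coeff_0:
  assumes f: "f \<in> fset X"
  shows "D_op (kop (green_coeff 0) f) x = f x"
proof -
  have green_coeff: "green_coeff 0 = green 0" by (intro ext) (rule green_coeff_0)
  have "(\<lambda>y. green_coeff 0 x y * f y) summable_on UNIV" for x
    by (rule kop_summable(1)[OF norm_green_coeff_0_le_om[OF s1, where t=0] f])
  then show ?thesis using D_op_kop_green[of 0 f x] unfolding green_coeff by simp
qed

text \<open>D annihilates the left-hand side and both summands are bounded, whereas nonzero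
  solutions of the free threshold equation grow linearly. The eigenspace thus lies in the kernel of
  a Fredholm operator.\<close>

lemma bound_space_kernel:
  assumes \<Psi>: "\<Psi> \<in> bound_space"
  shows "\<Psi> x + kop (green_coeff 0) (A0 \<Psi>) x = 0"
proof -
  note f = A0_mem[OF bound_space_Y[OF \<Psi>]]
  have k: "kop (green_coeff 0) (A0 \<Psi>) \<in> fset (Linf 0)" by (rule bopD(2)[OF kop_green_coeff_0_bop[OF s1] f])
  have "(\<lambda>x. 1 * \<Psi> x + 1 * kop (green_coeff 0) (A0 \<Psi>) x) \<in> fset (Linf 0)"
    by (rule quasi_normedD(2)[OF quasi_normed_ellinf X_subset_Y[OF bound_space_X[OF \<Psi>]] k])
  then have bd: "cmod (1 * \<Psi> x + 1 * kop (green_coeff 0) (A0 \<Psi>) x)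
      \<le> fnorm (Linf 0) (\<lambda>x. 1 * \<Psi> x + 1 * kop (green_coeff 0) (A0 \<Psi>) x) * om x ^ 0" for x
    by (rule ellinf_pointwise)
  have D: "D_op (\<lambda>x. 1 * \<Psi> x + 1 * kop (green_coeff 0) (A0 \<Psi>) x) x = 0" for x
    unfolding D_op_lincomb D_op_kop_green_coeff_0[OF f] using bound_space_H[OF \<Psi>, of x] by (simp add: H_eq)
  have "1 * \<Psi> x + 1 * kop (green_coeff 0) (A0 \<Psi>) x = 0"
    by (rule D_op_bounded_kernel[OF D, of "fnorm (Linf 0) (\<lambda>x. 1 * \<Psi> x + 1 * kop (green_coeff 0) (A0 \<Psi>) x)"])
      (use bd in simp)
  then show ?thesis by simp
qed

text \<open>
  On a ray the Green function is \<open>min(n, m)\<close>, so \<open>G\<^sub>0 f\<close> tends to the constant \<open>\<Sum> m f(m)\<close>, with a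
  difference \<open>\<Sum>\<^bsub>m > n\<^esub> (m - n) f(m)\<close>.
\<close>

lemma kop_green_coeff_0_asymptotics:
  assumes f: "f \<in> fset (L1 (s + 2) :: ('k, 'r) gvert fspace)"
  shows "\<exists>c. (\<lambda>x. kop (green_coeff 0) f x - (\<Sum>\<alpha>\<in>UNIV. c \<alpha> * one_ray \<alpha> x)) \<in> fset X"
proof -
  define l where "l \<alpha> y = (case y of Core d \<Rightarrow> 0 | Ray a m \<Rightarrow> if a = \<alpha> then complex_of_nat (Suc m) else 0)"
    for \<alpha> and y :: "('k, 'r) gvert"
  define lk where "lk x y = (\<Sum>\<alpha>\<in>UNIV. one_ray \<alpha> x * l \<alpha> y)" for x y :: "('k, 'r) gvert"
  define ek where "ek x y = green_coeff 0 x y - lk x y" for x y :: "('k, 'r) gvert"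
  have fX: "f \<in> fset X" by (rule bopD(2)[OF bop_id_ell1 f]) simp
  have l_le: "cmod (l \<alpha> y) \<le> om y ^ s" for \<alpha> y
  proof (cases y)
    case (Ray a m)
    have "cmod (l \<alpha> y) \<le> cmod (of_nat (Suc m))" using Ray by (simp add: l_def del: of_nat_Suc)
    also have "\<dots> \<le> om y ^ 1"
    proof -
      have "real (Suc m) \<le> om y" using Ray om_Ray_ge[of m a, where 'a='k] by simp
      then show ?thesis by (simp only: norm_of_nat power_one_right)
    qed
    also have "\<dots> \<le> om y ^ s" by (rule om_pow_mono[OF s1])
    finally show ?thesis .
  qed (simp add: l_def)
  have l_sm: "(\<lambda>y. l \<alpha> y * f y) summable_on UNIV" for \<alpha>
  proof (rule summable_on_dominated)
    show "(\<lambda>y. om y ^ s * cmod (f y)) summable_on UNIV" using fX by (simp add: ell1_iff)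
    show "norm (l \<alpha> y * f y) \<le> om y ^ s * cmod (f y)" for y
      unfolding norm_mult by (rule mult_right_mono[OF l_le]) simp
  qed
  define c where "c \<alpha> = (\<Sum>\<^sub>\<infinity>y. l \<alpha> y * f y)" for \<alpha>
  have lk: "(\<lambda>y. lk x y * f y) summable_on UNIV \<and> kop lk f x = (\<Sum>\<alpha>\<in>UNIV. c \<alpha> * one_ray \<alpha> x)" for x
  proof -
    have eq: "lk x y * f y = (\<Sum>\<alpha>\<in>UNIV. one_ray \<alpha> x * (l \<alpha> y * f y))" for y
      by (simp add: lk_def sum_distrib_right mult.assoc)
    have "(\<lambda>y. lk x y * f y) summable_on UNIV \<and> kop lk f x = (\<Sum>\<alpha>\<in>UNIV. \<Sum>\<^sub>\<infinity>y. one_ray \<alpha> x * (l \<alpha> y * f y))"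
      unfolding kop_def eq by (rule infsum_finite_sum) (auto intro: summable_on_cmult_right l_sm)
    then show ?thesis by (simp add: infsum_cmult_right' c_def mult.commute)
  qed
  have green_coeff_sm: "(\<lambda>y. green_coeff 0 x y * f y) summable_on UNIV" for x
    by (rule kop_summable(1)[OF norm_green_coeff_0_le_om[OF s1, where t=0] fX])
  have ek_eq: "kop ek f x = kop (green_coeff 0) f x - (\<Sum>\<alpha>\<in>UNIV. c \<alpha> * one_ray \<alpha> x)" for x
  proof -
    have "kop ek f x = (\<Sum>\<^sub>\<infinity>y. 1 * (green_coeff 0 x y * f y) + -1 * (lk x y * f y))"
      unfolding kop_def ek_def by (simp add: algebra_simps)
    also have "\<dots> = 1 * kop (green_coeff 0) f x + -1 * kop lk f x"
      unfolding infsum_lincomb(2)[OF green_coeff_sm conjunct1[OF lk]] kop_def ..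
    finally show ?thesis using lk[of x] by simp
  qed
  have "kop ek f \<in> fset X"
  proof (rule kop_ell1_ell1[OF _ f, where C=1])
    fix y :: "('k, 'r) gvert" and F :: "('k, 'r) gvert set" assume F: "finite F"
    show "(\<Sum>x\<in>F. om x ^ s * cmod (ek x y)) \<le> 1 * om y ^ (s + 2)"
    proof (cases y)
      case (Core d)
      have ek: "ek x y = (if x = y then 1 else 0)" for x
        using Core by (cases x) (auto simp: ek_def lk_def l_def green_coeff_0)
      have "(\<Sum>x\<in>F. om x ^ s * cmod (ek x y)) = (\<Sum>x\<in>F. if x = y then 1 else 0)"
      proof (rule sum.cong[OF refl])
        fix x show "om x ^ s * cmod (ek x y) = (if x = y then 1 else 0)"
          by (cases "x = y") (simp_all only: ek, simp_all add: Core)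
      qed
      also have "\<dots> \<le> 1" using F by simp
      finally show ?thesis using om_pow_ge_1[of y "s + 2"] by simp
    next
      case (Ray a m)
      have ek: "cmod (ek x y) = (case x of Core d \<Rightarrow> 0 | Ray a' n \<Rightarrow> if a' = a then real (m - n) else 0)" for x
      proof (cases x)
        case (Core d)
        then show ?thesis using Ray by (simp add: ek_def lk_def green_coeff_0)
      next
        case (Ray a' n)
        have "lk x y = (if a' = a then of_nat (Suc m) else 0)"
          using Ray \<open>y = Ray a m\<close> by (simp add: lk_def l_def if_distrib[of "\<lambda>z. z * _"] cong: if_cong)
        moreover have "green_coeff 0 x y = (if a' = a then of_nat (Suc (min n m)) else 0)"
          using Ray \<open>y = Ray a m\<close> by (simp add: green_coeff_0)
        ultimately have "ek x y = (if a' = a then of_nat (Suc (min n m)) - of_nat (Suc m) else 0)"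
          by (simp add: ek_def)
        moreover have "(of_nat (Suc (min n m)) - of_nat (Suc m) :: complex) = - of_nat (m - n)"
          by (cases "n \<le> m") (simp_all add: of_nat_diff min_def)
        ultimately show ?thesis using Ray by simp
      qed
      define M where "M = {n. n < m}"
      have inj: "inj_on (Ray a :: nat \<Rightarrow> ('k, 'r) gvert) M" by (rule inj_onI) simp
      have zero: "ek x y = 0" if "x \<notin> Ray a ` M" for x
      proof -
        have "cmod (ek x y) = 0" using that unfolding ek by (cases x) (auto simp: M_def)
        then show ?thesis by simp
      qed
      have m_le: "real m \<le> om y" using om_Ray_ge[of m a, where 'a='k] Ray by simp
      have "(\<Sum>x\<in>F. om x ^ s * cmod (ek x y)) = (\<Sum>x\<in>F \<inter> Ray a ` M. om x ^ s * cmod (ek x y))"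
        by (rule sum.mono_neutral_right) (use F zero in auto)
      also have "\<dots> \<le> (\<Sum>x\<in>Ray a ` M. om x ^ s * cmod (ek x y))"
        by (rule sum_mono2) (auto simp: M_def)
      also have "\<dots> = (\<Sum>n\<in>M. om (Ray a n :: ('k, 'r) gvert) ^ s * cmod (ek (Ray a n) y))"
        by (simp add: sum.reindex[OF inj])
      \<comment> \<open>Each position \<open>n < m\<close> contributes a weight at most
        \<open>om y ^ s\<close> and a difference \<open>m - n\<close> at most \<open>om y\<close>;
        there are \<open>m\<close> of them. These two factors \<open>om y\<close> are the two extra
        powers demanded of \<open>f\<close>.\<close>
      also have "\<dots> \<le> (\<Sum>n\<in>M. om y ^ s * om y)"
      proof (rule sum_mono)
        fix n assume n: "n \<in> M"
        have "cmod (ek (Ray a n) y) = real (m - n)" unfolding ek by simp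
        also have "\<dots> \<le> om y" using m_le by (simp add: of_nat_diff M_def)
        finally have "cmod (ek (Ray a n) y) \<le> om y" .
        moreover have "om (Ray a n :: ('k, 'r) gvert) ^ s \<le> om y ^ s"
          using n Ray by (auto simp: M_def intro!: power_mono om_Ray_mono)
        ultimately show "om (Ray a n :: ('k, 'r) gvert) ^ s * cmod (ek (Ray a n) y) \<le> om y ^ s * om y"
          by (intro mult_mono) auto
      qed
      also have "\<dots> = real m * (om y ^ s * om y)" by (simp add: M_def)
      also have "\<dots> \<le> om y * (om y ^ s * om y)" by (rule mult_right_mono[OF m_le]) simp
      also have "\<dots> = 1 * om y ^ (s + 2)" by (simp add: power2_eq_square)
      finally show ?thesis .
    qed
  qed
  then have "(\<lambda>x. kop (green_coeff 0) f x - (\<Sum>\<alpha>\<in>UNIV. c \<alpha> * one_ray \<alpha> x)) \<in> fset X"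
    unfolding ek_eq[symmetric] .
  then show ?thesis by blast
qed

text \<open>Although \<open>u\<close> may grow with weight \<open>s\<close>, its image under
  \<open>A0\<close> has weight \<open>s + 2\<close>. As \<open>u\<close> is minus G_0 of that image,
  the asymptotics leave only constants on the rays.\<close>

lemma kernel_imp_res_eigenspace:
  assumes u: "u \<in> fset Y" and eq: "\<And>x. u x + kop (green_coeff 0) (A0 u) x = 0"
  shows "u \<in> res_eigenspace (real (s + 2)) H"
proof -
  obtain C where C: "bop (Linf (s + 2)) (L1 (s + 2)) C A0" using A0_bop by blast
  note f = bopD(2)[OF C Y_subset[OF u]]
  obtain c where c: "(\<lambda>x. kop (green_coeff 0) (A0 u) x - (\<Sum>\<alpha>\<in>UNIV. c \<alpha> * one_ray \<alpha> x)) \<in> fset X"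
    using kop_green_coeff_0_asymptotics[OF f] by blast
  have u_eq: "u = (\<lambda>x. 0 * u x + -1 * kop (green_coeff 0) (A0 u) x)"
    using eq by (auto simp: eq_neg_iff_add_eq_0)
  have "H u x = 0" for x
    unfolding H_eq
    by (subst (1) u_eq, unfold D_op_lincomb D_op_kop_green_coeff_0[OF A0_mem[OF u]]) simp
  moreover have "u \<in> fset (Linf (s + 2))" by (rule Y_subset[OF u])
  moreover have "(\<lambda>x. -1 * (kop (green_coeff 0) (A0 u) x - (\<Sum>\<alpha>\<in>UNIV. c \<alpha> * one_ray \<alpha> x)) + 0 * 0) \<in> fset X"
    by (rule quasi_normedD(2)[OF quasi_normed_ell1 c]) simp
  then have "(\<lambda>x. u x - (\<Sum>\<alpha>\<in>UNIV. (- c \<alpha>) * one_ray \<alpha> x)) \<in> fset X"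
    by (subst u_eq) (simp add: sum_negf algebra_simps)
  moreover have "real (s + 2) - 2 = real s" by simp
  ultimately show ?thesis
    unfolding res_eigenspace_def gen_eigenspace_def by (simp only: mem_Collect_eq Int_iff simp_thms) (rule exI[of _ "\<lambda>\<alpha>. - c \<alpha>"])
qed

section \<open>The orthogonal bound projection\<close>

definition orthonormal :: "('k, 'r) gfun set \<Rightarrow> bool" where
  "orthonormal B \<longleftrightarrow> finite B \<and> B \<subseteq> bound_space \<and> (\<forall>\<Phi>\<in>B. \<forall>\<Phi>'\<in>B. pairing \<Phi>' \<Phi> = (if \<Phi>' = \<Phi> then 1 else 0))"

lemma orthonormal_coefficient:
  assumes "orthonormal B" "\<Psi> \<in> B"
  shows "pairing \<Psi> (\<lambda>x. \<Sum>\<Phi>\<in>B. a \<Phi> * \<Phi> x) = a \<Psi>"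
proof -
  have B: "finite B" "B \<subseteq> bound_space" "\<Psi> \<in> bound_space" using assms by (auto simp: orthonormal_def)
  have "pairing \<Psi> (\<lambda>x. \<Sum>\<Phi>\<in>B. a \<Phi> * \<Phi> x) = (\<Sum>\<Phi>\<in>B. if \<Psi> = \<Phi> then a \<Phi> else 0)"
    unfolding pairing_sum_bound_space[OF B] using assms by (intro sum.cong) (auto simp: orthonormal_def)
  then show ?thesis using B assms by simp
qed

lemma bound_space_self_summable: "\<Psi> \<in> bound_space \<Longrightarrow> \<Phi> \<in> bound_space \<Longrightarrow> (\<lambda>x. cnj (\<Psi> x) * \<Phi> x) summable_on UNIV"
  by (rule pairing_ell1_summable[OF bound_space_X bound_space_Y])

text \<open>An orthonormal set of maximal cardinality; the cardinalities are bounded by the Fredholm property.\<close>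

lemma orthonormal_spanning_exists:
  "\<exists>B. orthonormal B \<and> (\<forall>\<Psi>\<in>bound_space. \<Psi> = (\<lambda>x. \<Sum>\<Phi>\<in>B. pairing \<Phi> \<Psi> * \<Phi> x))"
proof -
  obtain n where n: "\<And>B. finite B \<Longrightarrow> (\<forall>u\<in>B. u \<in> fset Y \<and> (\<forall>x. u x + kop (green_coeff 0) (A0 u) x = 0)) \<Longrightarrow>
    (\<forall>a. (\<forall>x. (\<Sum>u\<in>B. complex_of_real (a u) * u x) = 0) \<longrightarrow> (\<forall>u\<in>B. a u = 0)) \<Longrightarrow> card B \<le> n"
    using threshold_kernel_finite_dim[OF s1 A0_tight] by blast
  have card_le: "card B \<le> n" if B: "orthonormal B" for B
  proof (rule n)
    show "finite B" using B by (simp add: orthonormal_def)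
    show "\<forall>u\<in>B. u \<in> fset Y \<and> (\<forall>x. u x + kop (green_coeff 0) (A0 u) x = 0)"
      using B bound_space_Y bound_space_kernel by (auto simp: orthonormal_def)
    show "\<forall>a. (\<forall>x. (\<Sum>u\<in>B. complex_of_real (a u) * u x) = 0) \<longrightarrow> (\<forall>u\<in>B. a u = 0)"
    proof (intro allI impI ballI)
      fix a u assume z: "\<forall>x. (\<Sum>u\<in>B. complex_of_real (a u) * u x) = 0" and u: "u \<in> B"
      have "complex_of_real (a u) = pairing u (\<lambda>x. \<Sum>u\<in>B. complex_of_real (a u) * u x)"
        by (rule orthonormal_coefficient[OF B u, symmetric])
      also have "\<dots> = 0" using z by (simp add: pairing_def)
      finally show "a u = 0" by simp
    qed
  qed
  have "orthonormal {}" by (simp add: orthonormal_def)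
  then obtain B where B: "orthonormal B" and max: "\<And>B'. orthonormal B' \<Longrightarrow> card B' \<le> card B"
    using ex_has_greatest_nat[of orthonormal "{}" card "Suc n"] card_le by (auto simp: less_Suc_eq_le)
  have fin: "finite B" "B \<subseteq> bound_space" using B by (auto simp: orthonormal_def)
  have "\<Psi> = (\<lambda>x. \<Sum>\<Phi>\<in>B. pairing \<Phi> \<Psi> * \<Phi> x)" if \<Psi>: "\<Psi> \<in> bound_space" for \<Psi>
  proof (rule ccontr)
    assume neq: "\<not> ?thesis"
    \<comment> \<open>One Gram-Schmidt step: the residual of \<Psi> after removing its components
      along \<open>B\<close>, once normalized, would enlarge the maximal orthonormal set.\<close>
    define S where "S = (\<lambda>x. \<Sum>\<Phi>\<in>B. pairing \<Phi> \<Psi> * \<Phi> x)"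
    define R where "R = (\<lambda>x. 1 * \<Psi> x + -1 * S x)"
    have S: "S \<in> bound_space" unfolding S_def by (rule bound_space_sum[OF fin])
    have R: "R \<in> bound_space" unfolding R_def by (rule bound_space_lincomb[OF \<Psi> S])
    have "R \<noteq> (\<lambda>x. 0)" using neq by (auto simp: R_def S_def fun_eq_iff)
    then have "pairing R R \<noteq> 0" using pairing_self_eq_0[OF bound_space_self_summable[OF R R]] by blast
    define r where "r = (\<Sum>\<^sub>\<infinity>x. (cmod (R x))\<^sup>2)"
    have r: "pairing R R = complex_of_real r" unfolding r_def by (rule pairing_self(1)[OF bound_space_self_summable[OF R R]])
    have "0 \<le> r" unfolding r_def by (rule infsum_nonneg) simp
    then have r0: "0 < r" using r \<open>pairing R R \<noteq> 0\<close> by (simp add: less_le)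
    have orth: "pairing \<Phi> R = 0" if \<Phi>: "\<Phi> \<in> B" for \<Phi>
    proof -
      have "\<Phi> \<in> bound_space" using \<Phi> fin by blast
      then have "pairing \<Phi> R = 1 * pairing \<Phi> \<Psi> + -1 * pairing \<Phi> S"
        unfolding R_def by (intro pairing_lincomb_X bound_space_X bound_space_Y \<Psi> S)
      also have "pairing \<Phi> S = pairing \<Phi> \<Psi>" unfolding S_def by (rule orthonormal_coefficient[OF B \<Phi>])
      finally show ?thesis by simp
    qed
    define q where "q = complex_of_real (1 / sqrt r)"
    define R' where "R' = (\<lambda>x. q * R x + 0 * R x)"
    have R': "R' \<in> bound_space" unfolding R'_def by (rule bound_space_lincomb[OF R R])
    have pr: "pairing \<Phi> R' = q * pairing \<Phi> R" if "\<Phi> \<in> bound_space" for \<Phi>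
      unfolding R'_def using pairing_lincomb_X[OF bound_space_X[OF that] bound_space_Y[OF R] bound_space_Y[OF R], of q 0] by simp
    have orth': "pairing \<Phi> R' = 0" if "\<Phi> \<in> B" for \<Phi>
      using pr[of \<Phi>] orth[OF that] that fin by auto
    then have orth'': "pairing R' \<Phi> = 0" if "\<Phi> \<in> B" for \<Phi>
      using that by (subst pairing_commute) simp
    have "pairing R R' = q * of_real r" using pr[OF R] r by simp
    then have "pairing R' R = cnj (q * of_real r)" by (subst pairing_commute) simp
    then have "pairing R' R' = q * (q * of_real r)" using pr[OF R'] by (simp add: q_def)
    also have "\<dots> = of_real (1 / sqrt r * (1 / sqrt r) * r)"
      by (simp only: q_def of_real_mult[symmetric] mult.assoc)
    also have "1 / sqrt r * (1 / sqrt r) * r = 1" using r0 by simp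
    finally have norm1: "pairing R' R' = 1" by simp
    have notin: "R' \<notin> B" using orth'[of R'] norm1 by auto
    have "orthonormal (insert R' B)"
      using B R' norm1 orth' orth'' notin by (auto simp: orthonormal_def)
    then have "card (insert R' B) \<le> card B" by (rule max)
    then show False using notin fin by simp
  qed
  then show ?thesis using B by blast
qed

text \<open>Orthonormality forces the coefficients of any expansion to be the pairings. The quotient
  formulation of a basis becomes a reproducing formula, the form in which bases are used from here
  on.\<close>

lemma orthonormal_bound_basis_iff:
  "orthonormal_bound_basis (real (s + 2)) H B \<longleftrightarrow>
    orthonormal B \<and> (\<forall>\<Psi>\<in>bound_space. \<Psi> = (\<lambda>x. \<Sum>\<Phi>\<in>B. pairing \<Phi> \<Psi> * \<Phi> x))" (is "?l \<longleftrightarrow> ?r")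
proof
  assume l: ?l
  then have basis: "basis_mod bound_space {\<lambda>x. 0} B"
    and orth: "\<And>\<Phi> \<Phi>'. \<Phi> \<in> B \<Longrightarrow> \<Phi>' \<in> B \<Longrightarrow> pairing \<Phi>' \<Phi> = (if \<Phi>' = \<Phi> then 1 else 0)"
    unfolding orthonormal_bound_basis_def bound_space_def by blast+
  have B: "orthonormal B" using basis orth by (auto simp: orthonormal_def basis_mod_def)
  have "\<Psi> = (\<lambda>x. \<Sum>\<Phi>\<in>B. pairing \<Phi> \<Psi> * \<Phi> x)" if \<Psi>: "\<Psi> \<in> bound_space" for \<Psi>
  proof -
    obtain a where "(\<lambda>x. \<Psi> x - (\<Sum>\<Phi>\<in>B. a \<Phi> * \<Phi> x)) = (\<lambda>x. 0)"
      using basis \<Psi> unfolding basis_mod_def by blast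
    then have \<Psi>_eq: "\<Psi> = (\<lambda>x. \<Sum>\<Phi>\<in>B. a \<Phi> * \<Phi> x)" by (simp add: fun_eq_iff)
    have "pairing \<Phi> \<Psi> = a \<Phi>" if "\<Phi> \<in> B" for \<Phi>
      unfolding \<Psi>_eq by (rule orthonormal_coefficient[OF B that])
    then have "(\<lambda>x. \<Sum>\<Phi>\<in>B. pairing \<Phi> \<Psi> * \<Phi> x) = (\<lambda>x. \<Sum>\<Phi>\<in>B. a \<Phi> * \<Phi> x)"
      by (intro ext sum.cong) auto
    then show ?thesis using \<Psi>_eq by simp
  qed
  then show ?r using B by blast
next
  assume r: ?r
  then have B: "orthonormal B" "finite B" "B \<subseteq> bound_space" by (auto simp: orthonormal_def)
  have "basis_mod bound_space {\<lambda>x. 0} B"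
    unfolding basis_mod_def
  proof (intro conjI allI ballI impI B(2,3))
    fix a \<Phi> assume z: "(\<lambda>x. \<Sum>\<Phi>\<in>B. a \<Phi> * \<Phi> x) \<in> {\<lambda>x. 0}" and \<Phi>: "\<Phi> \<in> B"
    have "a \<Phi> = pairing \<Phi> (\<lambda>x. \<Sum>\<Phi>\<in>B. a \<Phi> * \<Phi> x)" by (rule orthonormal_coefficient[OF B(1) \<Phi>, symmetric])
    also have "\<dots> = 0" using z by (simp add: pairing_def fun_eq_iff)
    finally show "a \<Phi> = 0" .
  next
    fix \<Psi> assume "\<Psi> \<in> bound_space"
    then have "\<Psi> = (\<lambda>x. \<Sum>\<Phi>\<in>B. pairing \<Phi> \<Psi> * \<Phi> x)" using r by blast
    then have "(\<lambda>x. \<Psi> x - (\<Sum>\<Phi>\<in>B. pairing \<Phi> \<Psi> * \<Phi> x)) = (\<lambda>x. 0)" by (metis diff_self)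
    then show "\<exists>a. (\<lambda>x. \<Psi> x - (\<Sum>\<Phi>\<in>B. a \<Phi> * \<Phi> x)) \<in> {\<lambda>x. 0}"
      by (intro exI[of _ "\<lambda>\<Phi>. pairing \<Phi> \<Psi>"]) (simp only: singleton_iff)
  qed
  moreover have "(\<lambda>x. cnj (\<Phi>' x) * \<Phi> x) \<in> fset (ell1 0)" if "\<Phi> \<in> B" "\<Phi>' \<in> B" for \<Phi> \<Phi>'
  proof -
    have "(\<lambda>x. cnj (\<Phi>' x) * \<Phi> x) summable_on UNIV" using that B by (intro bound_space_self_summable) auto
    then have "(\<lambda>x. cmod (cnj (\<Phi>' x) * \<Phi> x)) summable_on UNIV"
      by (simp only: summable_on_iff_abs_summable_on_complex)
    then have "(\<lambda>x. cnj (\<Phi>' x) * \<Phi> x) \<in> fset (L1 0)" by (simp only: ell1_iff power_0 mult_1)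
    then show ?thesis by simp
  qed
  ultimately show ?l
    using B unfolding orthonormal_bound_basis_def bound_space_def[symmetric] orthonormal_def by blast
qed

text \<open>The reproducing formula is applied to \<Psi> in the antilinear slot, so \<open>u\<close>
  has only to be pairable with eigenfunctions; it may grow.\<close>

lemma ket_bra_sum_pairing:
  assumes B: "orthonormal B" "\<forall>\<Psi>\<in>bound_space. \<Psi> = (\<lambda>x. \<Sum>\<Phi>\<in>B. pairing \<Phi> \<Psi> * \<Phi> x)"
    and \<Psi>: "\<Psi> \<in> bound_space" and u: "\<And>\<Phi>. \<Phi> \<in> bound_space \<Longrightarrow> (\<lambda>x. cnj (\<Phi> x) * u x) summable_on UNIV"
  shows "pairing \<Psi> (ket_bra_sum B u) = pairing \<Psi> u"
proof -
  have fin: "finite B" "B \<subseteq> bound_space" using B by (auto simp: orthonormal_def)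
  have "pairing \<Psi> (ket_bra_sum B u) = (\<Sum>\<Phi>\<in>B. pairing \<Phi> u * pairing \<Psi> \<Phi>)"
    unfolding ket_bra_sum_def by (rule pairing_sum_bound_space[OF fin \<Psi>])
  also have "\<dots> = (\<Sum>\<Phi>\<in>B. pairing \<Psi> \<Phi> * pairing \<Phi> u)" by (simp add: mult.commute)
  also have "\<dots> = (\<Sum>\<Phi>\<in>B. \<Sum>\<^sub>\<infinity>x. pairing \<Psi> \<Phi> * (cnj (\<Phi> x) * u x))"
    by (simp add: pairing_def infsum_cmult_right')
  also have "\<dots> = (\<Sum>\<^sub>\<infinity>x. \<Sum>\<Phi>\<in>B. pairing \<Psi> \<Phi> * (cnj (\<Phi> x) * u x))"
    using infsum_finite_sum[OF fin(1), of "\<lambda>\<Phi> x. pairing \<Psi> \<Phi> * (cnj (\<Phi> x) * u x)"] u fin(2)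
    by (simp add: summable_on_cmult_right subset_iff)
  also have "\<dots> = (\<Sum>\<^sub>\<infinity>x. cnj (\<Psi> x) * u x)"
  proof (rule infsum_cong)
    fix x
    have "cnj (\<Psi> x) = cnj (\<Sum>\<Phi>\<in>B. pairing \<Phi> \<Psi> * \<Phi> x)" using B(2) \<Psi> by metis
    also have "\<dots> = (\<Sum>\<Phi>\<in>B. pairing \<Psi> \<Phi> * cnj (\<Phi> x))" by (simp add: pairing_commute[of \<Psi>])
    finally show "(\<Sum>\<Phi>\<in>B. pairing \<Psi> \<Phi> * (cnj (\<Phi> x) * u x)) = cnj (\<Psi> x) * u x"
      by (simp add: sum_distrib_right mult.assoc)
  qed
  finally show ?thesis by (simp add: pairing_def)
qed

lemma ket_bra_sum_mem: "orthonormal B \<Longrightarrow> ket_bra_sum B u \<in> bound_space"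
  unfolding ket_bra_sum_def by (rule bound_space_sum) (auto simp: orthonormal_def)

text \<open>The difference of the two images lies in the eigenspace and is orthogonal to it, since
  both images have the same pairings with eigenfunctions as \<open>u\<close>.\<close>

lemma ket_bra_sum_unique:
  assumes B: "orthonormal B" "\<forall>\<Psi>\<in>bound_space. \<Psi> = (\<lambda>x. \<Sum>\<Phi>\<in>B. pairing \<Phi> \<Psi> * \<Phi> x)"
    and B': "orthonormal B'" "\<forall>\<Psi>\<in>bound_space. \<Psi> = (\<lambda>x. \<Sum>\<Phi>\<in>B'. pairing \<Phi> \<Psi> * \<Phi> x)"
    and u: "u \<in> fset (L1 t)"
  shows "ket_bra_sum B u = ket_bra_sum B' u"
proof -
  have sm: "(\<lambda>x. cnj (\<Phi> x) * u x) summable_on UNIV" if "\<Phi> \<in> bound_space" for \<Phi>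
    by (rule pairing_summable[OF X_subset_Y[OF bound_space_X[OF that]] u])
  note P = ket_bra_sum_mem[OF B(1), of u] and P' = ket_bra_sum_mem[OF B'(1), of u]
  define w where "w = (\<lambda>x. 1 * ket_bra_sum B u x + -1 * ket_bra_sum B' u x)"
  have w: "w \<in> bound_space" unfolding w_def by (rule bound_space_lincomb[OF P P'])
  have "pairing w w = 1 * pairing w (ket_bra_sum B u) + -1 * pairing w (ket_bra_sum B' u)"
    by (subst (2) w_def) (rule pairing_lincomb_X[OF bound_space_X[OF w] bound_space_Y[OF P] bound_space_Y[OF P']])
  also have "\<dots> = 0" using ket_bra_sum_pairing[OF B w sm] ket_bra_sum_pairing[OF B' w sm] by simp
  finally have "w = (\<lambda>x. 0)" by (rule pairing_self_eq_0[OF bound_space_self_summable[OF w w]])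
  then show ?thesis by (simp add: w_def fun_eq_iff)
qed

end

section \<open>The resolvent near the threshold\<close>

locale threshold_basis = threshold E b V s
  for E :: "'k::finite set set" and b :: "'r::finite \<Rightarrow> 'k" and V :: "('k, 'r) gop" and s :: nat +
  fixes B :: "('k, 'r) gfun set"
  assumes no_resonance: "res_eigenspace (real (s + 2)) H \<subseteq> bound_space"
    and orthonormal_B: "orthonormal B"
    and span_B: "\<forall>\<Psi>\<in>bound_space. \<Psi> = (\<lambda>x. \<Sum>\<Phi>\<in>B. pairing \<Phi> \<Psi> * \<Phi> x)"
begin

abbreviation P :: "('k, 'r) gop" where "P \<equiv> ket_bra_sum B"

text \<open>Adding \<open>P\<close> moves the eigenvalue \<open>0\<close> of \<open>H\<close> to \<open>1\<close>, which makes the threshold regular.\<close>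

definition A :: "('k, 'r) gop" where "A u x = A0 u x + P u x"

lemma P_tight: "tight s P"
  using orthonormal_B by (intro tight_ket_bra_sum) (auto simp: orthonormal_def bound_space_X)

lemma A_tight: "tight s A"
  using tight_add[OF A0_tight P_tight] unfolding A_def[abs_def] .

lemma A_mem: "u \<in> fset Y \<Longrightarrow> A u \<in> fset X"
  using A_tight bopD(2) by (metis tightD_bop)

lemma P_bound_space: "P u \<in> bound_space"
  by (rule ket_bra_sum_mem[OF orthonormal_B])

lemma pairing_P:
  assumes "\<Psi> \<in> bound_space" "u \<in> fset Y"
  shows "pairing \<Psi> (P u) = pairing \<Psi> u"
  by (rule ket_bra_sum_pairing[OF orthonormal_B span_B assms(1)])
    (rule pairing_ell1_summable[OF bound_space_X assms(2)])

lemma P_eq_0I: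
  assumes u: "u \<in> fset Y" and "\<And>\<Psi>. \<Psi> \<in> bound_space \<Longrightarrow> pairing \<Psi> u = 0"
  shows "P u = (\<lambda>x. 0)"
  using assms pairing_P[OF P_bound_space u] by (intro pairing_self_eq_0[OF bound_space_self_summable[OF P_bound_space P_bound_space]]) (simp add: P_bound_space)

text \<open>The equation gives \<open>H u = - P u\<close>. Pairing with eigenfunctions kills the
  left side, so \<open>P u = 0\<close> and \<open>A\<close> may be replaced by \<open>A0\<close>;
  then \<open>u\<close> belongs to the resonance space, hence to the eigenspace, where
  \<open>u = P u\<close>.\<close>

lemma threshold_injective:
  assumes u: "u \<in> fset Y" and eq: "\<And>x. u x + kop (green_coeff 0) (A u) x = 0"
  shows "u = (\<lambda>x. 0)"
proof -
  have u_eq: "u = (\<lambda>x. 0 * u x + -1 * kop (green_coeff 0) (A u) x)"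
    using eq by (auto simp: eq_neg_iff_add_eq_0)
  have D: "D_op u x = - A u x" for x
    by (subst u_eq, unfold D_op_lincomb D_op_kop_green_coeff_0[OF A_mem[OF u]]) simp
  have HP: "H u = (\<lambda>x. - P u x)"
    by (auto simp: H_eq D A_def)
  have P0: "P u = (\<lambda>x. 0)"
  proof (rule P_eq_0I[OF u])
    fix \<Psi> assume \<Psi>: "\<Psi> \<in> bound_space"
    have "0 = pairing \<Psi> (\<lambda>x. -1 * P u x + 0 * P u x)" using pairing_bound_space_H(1)[OF \<Psi> u] by (simp add: HP)
    also have "\<dots> = - pairing \<Psi> u"
      using pairing_lincomb_X[OF bound_space_X[OF \<Psi>] bound_space_Y[OF P_bound_space] bound_space_Y[OF P_bound_space], of "-1" u 0 u] pairing_P[OF \<Psi> u] by simp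
    finally show "pairing \<Psi> u = 0" by simp
  qed
  then have "A u = A0 u" by (simp add: A_def[abs_def] fun_eq_iff)
  then have "u \<in> bound_space" using kernel_imp_res_eigenspace[OF u] eq no_resonance by auto
  then have "u = (\<lambda>x. \<Sum>\<Phi>\<in>B. pairing \<Phi> u * \<Phi> x)" using span_B by blast
  also have "\<dots> = P u" by (simp add: ket_bra_sum_def)
  finally show ?thesis using P0 by simp
qed

section \<open>Uniform inverses of 1 + R_0(\<kappa>) A near the threshold\<close>

definition T :: "complex \<Rightarrow> ('k, 'r) gop" where "T \<kappa> u = kop (green \<kappa>) (A u)"

lemma A_bop: obtains C where "bop Y X C A"
  using tightD_bop[OF A_tight] by blast

lemma green_summable:
  assumes \<kappa>: "0 < Re \<kappa>" "cmod \<kappa> < 1" and f: "f \<in> fset ell2"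
  shows "(\<lambda>y. green \<kappa> x y * f y) summable_on UNIV"
  by (rule green_ell2(2)[OF \<kappa> f])

lemma X_ell2: "u \<in> fset X \<Longrightarrow> u \<in> fset ell2"
  by (rule bopD(2)[OF bop_id_ell1_ell2])

lemma ell2_Y: "u \<in> fset (ell2 :: ('k, 'r) gvert fspace) \<Longrightarrow> u \<in> fset Y"
  by (rule bopD(2)[OF bop_id_ell2_ellinf])

lemma kop_green_mem: "0 < Re \<kappa> \<Longrightarrow> cmod \<kappa> < 1 \<Longrightarrow> f \<in> fset ell2 \<Longrightarrow> kop (green \<kappa>) f \<in> fset (ell2 :: ('k, 'r) gvert fspace)"
  using green_ell2(1)[of \<kappa>, where 'k='k and 'r='r] bopD(2) by blast

lemma kop_green_lincomb:
  assumes "0 < Re \<kappa>" "cmod \<kappa> < 1" "f \<in> fset (ell2 :: ('k, 'r) gvert fspace)" "g \<in> fset ell2"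
  shows "kop (green \<kappa>) (\<lambda>x. a * f x + c * g x) x = a * kop (green \<kappa>) f x + c * kop (green \<kappa>) g x"
  by (rule kop_lincomb; rule green_summable; fact assms)

text \<open>The first-order remainder of the kernel carries the square of
  \<open>om x * om y\<close>, so this is the step that forces \<open>2 \<le> s\<close>. The constant
  72 is \<open>3 * (M + 2) * 8 ^ M\<close> at \<open>M = 1\<close>.\<close>

lemma T_difference_bop:
  "\<exists>C. \<forall>\<kappa>. 0 < Re \<kappa> \<longrightarrow> cmod \<kappa> \<le> 1 / 2 \<longrightarrow> bop Y Y (C * cmod \<kappa>) (\<lambda>u x. T \<kappa> u x - kop (green_coeff 0) (A u) x)"
proof -
  obtain C where C: "bop Y X C A" by (rule A_bop)
  have "bop Y Y (72 * C * cmod \<kappa>) (\<lambda>u x. T \<kappa> u x - kop (green_coeff 0) (A u) x)"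
    if \<kappa>: "0 < Re \<kappa>" "cmod \<kappa> \<le> 1 / 2" for \<kappa>
  proof -
    define k where "k x y = green \<kappa> x y - green_coeff 0 x y" for x y :: "('k, 'r) gvert"
    have k_le: "cmod (k x y) \<le> (72 * cmod \<kappa>) * om x ^ s * om y ^ s" for x y
    proof -
      have "cmod (k x y) \<le> (72 * cmod \<kappa>) * (om x * om y) ^ 2"
        using green_expansion[OF \<kappa>, of x y 1] by (simp add: k_def numeral_2_eq_2)
      also have "\<dots> \<le> (72 * cmod \<kappa>) * (om x * om y) ^ s"
        by (intro mult_left_mono power_increasing[OF s2 om_mult_ge_1]) auto
      finally show ?thesis by (simp add: power_mult_distrib mult.assoc)
    qed
    have "bop X Y (72 * cmod \<kappa>) (kop k)" by (rule kop_bop[OF k_le]) simp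
    from bop_comp[OF C this] have bop: "bop Y Y (72 * C * cmod \<kappa>) (\<lambda>u. kop k (A u))" by (simp add: mult_ac)
    have eq: "kop k (A u) x = T \<kappa> u x - kop (green_coeff 0) (A u) x" if u: "u \<in> fset Y" for u x
    proof -
      have s1: "(\<lambda>y. green \<kappa> x y * A u y) summable_on UNIV"
        by (rule green_summable[OF \<kappa>(1) _ X_ell2[OF A_mem[OF u]]]) (use \<kappa> in simp)
      have s2: "(\<lambda>y. green_coeff 0 x y * A u y) summable_on UNIV"
        by (rule kop_summable(1)[OF norm_green_coeff_0_le_om[OF threshold.s1[OF threshold_axioms], where t=0] A_mem[OF u]])
      have "kop k (A u) x = (\<Sum>\<^sub>\<infinity>y. 1 * (green \<kappa> x y * A u y) + -1 * (green_coeff 0 x y * A u y))"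
        unfolding kop_def k_def by (simp add: algebra_simps)
      also have "\<dots> = 1 * kop (green \<kappa>) (A u) x + -1 * kop (green_coeff 0) (A u) x"
        unfolding infsum_lincomb(2)[OF s1 s2] kop_def ..
      finally show ?thesis by (simp add: T_def)
    qed
    have eq': "(\<lambda>x. T \<kappa> u x - kop (green_coeff 0) (A u) x) = kop k (A u)" if "u \<in> fset Y" for u
      using eq[OF that] by auto
    show ?thesis by (rule bop_cong[OF bop eq'[symmetric] quasi_normed_ellinf])
  qed
  then show ?thesis by blast
qed

lemma threshold_inverse:
  obtains L0 C where "bop Y Y C L0"
    "\<And>u. u \<in> fset Y \<Longrightarrow> (\<lambda>x. L0 u x + kop (green_coeff 0) (A (L0 u)) x) = u"
    "\<And>u. u \<in> fset Y \<Longrightarrow> L0 (\<lambda>x. u x + kop (green_coeff 0) (A u) x) = u"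
  using threshold_fredholm[OF s1 A_tight threshold_injective] by blast

text \<open>With \<open>D\<close> the difference of \<open>T \<kappa>\<close> and its threshold
  value, \<open>1 + T \<kappa>\<close> factors as the threshold operator times
  \<open>1 + L0 D\<close>. The choice of \<delta> makes \<open>L0 D\<close> a contraction by 1/2,
  whence the bound \<open>2 * C0\<close> independent of \<kappa>.\<close>

lemma perturbed_inverse:
  "\<exists>\<delta>>0. \<exists>C. \<delta> \<le> 1 / 2 \<and> (\<forall>\<kappa>. 0 < Re \<kappa> \<longrightarrow> cmod \<kappa> < \<delta> \<longrightarrow>
    (\<exists>L. bop Y Y C L \<and> (\<forall>u\<in>fset Y. (\<lambda>x. L u x + T \<kappa> (L u) x) = u \<and> L (\<lambda>x. u x + T \<kappa> u x) = u)))"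
proof -
  obtain L0 C0 where L0: "bop Y Y C0 L0"
    "\<And>u. u \<in> fset Y \<Longrightarrow> (\<lambda>x. L0 u x + kop (green_coeff 0) (A (L0 u)) x) = u"
    "\<And>u. u \<in> fset Y \<Longrightarrow> L0 (\<lambda>x. u x + kop (green_coeff 0) (A u) x) = u" by (rule threshold_inverse) (rule that)
  obtain C1 where C1: "\<And>\<kappa>. 0 < Re \<kappa> \<Longrightarrow> cmod \<kappa> \<le> 1 / 2 \<Longrightarrow>
    bop Y Y (C1 * cmod \<kappa>) (\<lambda>u x. T \<kappa> u x - kop (green_coeff 0) (A u) x)" using T_difference_bop by blast
  obtain CA where CA: "bop Y X CA A" by (rule A_bop)
  have T0: "bop Y Y (1 * CA) (\<lambda>u. kop (green_coeff 0) (A u))" by (rule bop_comp[OF CA kop_green_coeff_0_bop[OF s1]])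
  define K where "K = \<bar>C0 * C1\<bar> + 1"
  have K: "0 < K" "C0 * C1 \<le> K" by (auto simp: K_def)
  define \<delta> where "\<delta> = min (1 / 2) (1 / (2 * K))"
  have \<delta>: "0 < \<delta>" "\<delta> \<le> 1 / 2" using K by (auto simp: \<delta>_def)
  have "\<exists>L. bop Y Y (2 * C0) L \<and> (\<forall>u\<in>fset Y. (\<lambda>x. L u x + T \<kappa> (L u) x) = u \<and> L (\<lambda>x. u x + T \<kappa> u x) = u)"
    if \<kappa>: "0 < Re \<kappa>" "cmod \<kappa> < \<delta>" for \<kappa>
  proof -
    have \<kappa>': "cmod \<kappa> \<le> 1 / 2" "2 * K * cmod \<kappa> \<le> 1"
      using \<kappa>(2) K by (auto simp: \<delta>_def field_simps)
    define D where "D u x = T \<kappa> u x - kop (green_coeff 0) (A u) x" for u x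
    have D: "bop Y Y (C1 * cmod \<kappa>) D" using C1[OF \<kappa>(1) \<kappa>'(1)] by (simp add: D_def[abs_def])
    have S: "bop Y Y (C0 * (C1 * cmod \<kappa>)) (\<lambda>u. L0 (D u))" by (rule bop_comp[OF D L0(1)])
    have "C0 * (C1 * cmod \<kappa>) \<le> K * cmod \<kappa>" using mult_right_mono[OF K(2), of "cmod \<kappa>"] by (simp add: mult.assoc)
    also have "\<dots> \<le> 1 / 2" using \<kappa>'(2) by simp
    finally have S': "bop Y Y (1 / 2) (\<lambda>u. L0 (D u))" by (rule bop_mono[OF S quasi_normed_ellinf])
    have half: "(1 / 2 :: real) < 1" by simp
    obtain N where N: "bop Y Y (1 / (1 - 1 / 2)) N"
      "\<And>u. u \<in> fset Y \<Longrightarrow> (\<lambda>x. N u x + L0 (D (N u)) x) = u"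
      "\<And>u. u \<in> fset Y \<Longrightarrow> N (\<lambda>x. u x + L0 (D u) x) = u"
      using ellinf_neumann[OF S' half] by blast
    have bopL: "bop Y Y (2 * C0) (\<lambda>u. N (L0 u))" using bop_comp[OF L0(1) N(1)] by simp
    have right: "(\<lambda>x. N (L0 u) x + T \<kappa> (N (L0 u)) x) = u" if u: "u \<in> fset Y" for u
    proof -
      define w where "w = N (L0 u)"
      have L0u: "L0 u \<in> fset Y" by (rule bopD(2)[OF L0(1) u])
      have w: "w \<in> fset Y" unfolding w_def by (rule bopD(2)[OF N(1) L0u])
      have Dw: "D w \<in> fset Y" by (rule bopD(2)[OF D w])
      have LDw: "L0 (D w) \<in> fset Y" by (rule bopD(2)[OF L0(1) Dw])
      have eq: "(\<lambda>x. 1 * w x + 1 * L0 (D w) x) = L0 u" using N(2)[OF L0u] by (simp add: w_def)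
      have "u = (\<lambda>x. L0 u x + kop (green_coeff 0) (A (L0 u)) x)" by (rule L0(2)[OF u, symmetric])
      also have "\<dots> = (\<lambda>x. (w x + L0 (D w) x) + (kop (green_coeff 0) (A w) x + kop (green_coeff 0) (A (L0 (D w))) x))"
        unfolding eq[symmetric] bopD(4)[OF T0 w LDw] by simp
      also have "\<dots> = (\<lambda>x. w x + kop (green_coeff 0) (A w) x + (L0 (D w) x + kop (green_coeff 0) (A (L0 (D w))) x))"
        by (simp add: algebra_simps)
      also have "\<dots> = (\<lambda>x. w x + kop (green_coeff 0) (A w) x + D w x)" using fun_cong[OF L0(2)[OF Dw]] by simp
      finally show ?thesis by (simp add: D_def w_def)
    qed
    have left: "N (L0 (\<lambda>x. u x + T \<kappa> u x)) = u" if u: "u \<in> fset Y" for u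
    proof -
      have Du: "D u \<in> fset Y" by (rule bopD(2)[OF D u])
      have T0u: "(\<lambda>x. 1 * u x + 1 * kop (green_coeff 0) (A u) x) \<in> fset Y"
        by (rule quasi_normedD(2)[OF quasi_normed_ellinf u bopD(2)[OF T0 u]])
      have "(\<lambda>x. u x + T \<kappa> u x) = (\<lambda>x. 1 * (1 * u x + 1 * kop (green_coeff 0) (A u) x) + 1 * D u x)"
        by (simp add: D_def)
      then have "L0 (\<lambda>x. u x + T \<kappa> u x) = (\<lambda>x. u x + L0 (D u) x)"
        using bopD(4)[OF L0(1) T0u Du, of 1 1] L0(3)[OF u] by simp
      then show ?thesis using N(3)[OF u] by simp
    qed
    show ?thesis using bopL right left by blast
  qed
  then show ?thesis using \<delta> by blast
qed

text \<open>\<open>L\<close> after the free resolvent inverts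
  \<open>H + P + \<kappa>\<^sup>2\<close>. On the range of P it gives
  \<open>1 / (1 + \<kappa>\<^sup>2)\<close> where the resolvent of H must give
  \<open>1 / \<kappa>\<^sup>2\<close>; the multiple \<open>c\<close> of P is the difference.\<close>

lemma resolvent_inverse:
  assumes \<kappa>: "0 < Re \<kappa>" "cmod \<kappa> < 1"
    and L: "bop Y Y C L" "\<forall>u\<in>fset Y. (\<lambda>x. L u x + T \<kappa> (L u) x) = u \<and> L (\<lambda>x. u x + T \<kappa> u x) = u"
  defines "c \<equiv> 1 / \<kappa>\<^sup>2 - 1 / (1 + \<kappa>\<^sup>2)"
  shows "- \<kappa>\<^sup>2 \<notin> spectrum_ell2 H"
    and "u \<in> fset ell2 \<Longrightarrow> resolvent H \<kappa> u = (\<lambda>x. L (kop (green \<kappa>) u) x + c * P u x)"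
proof -
  have L1: "(\<lambda>x. L u x + T \<kappa> (L u) x) = u" and L2: "L (\<lambda>x. u x + T \<kappa> u x) = u"
    if "u \<in> fset Y" for u using L(2) that by blast+
  have \<kappa>0: "\<kappa>\<^sup>2 \<noteq> 0" using \<kappa> by auto
  have \<kappa>1: "1 + \<kappa>\<^sup>2 \<noteq> 0" by (rule one_plus_sq_nonzero[OF \<kappa>(2)])
  define R' where "R' u = L (kop (green \<kappa>) u)" for u
  have R0_mem: "kop (green \<kappa>) u \<in> fset Y" if "u \<in> fset ell2" for u
    by (rule ell2_Y[OF kop_green_mem[OF \<kappa> that]])
  have R'_Y: "R' u \<in> fset Y" if "u \<in> fset ell2" for u
    unfolding R'_def by (rule bopD(2)[OF L(1) R0_mem[OF that]])
  \<comment> \<open>\<open>L\<close> controls \<open>R' u\<close> only in the weighted space.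
    Rewriting the equation as \<open>R' u = kop (green \<kappa>) (f u)\<close> with
    \<open>f u\<close> in l^2 returns it to l^2.\<close>
  define f where "f u = (\<lambda>x. 1 * u x + -1 * A (R' u) x)" for u
  have f_mem: "f u \<in> fset ell2" if "u \<in> fset ell2" for u
    unfolding f_def by (rule quasi_normedD(2)[OF quasi_normed_ell2 that X_ell2[OF A_mem[OF R'_Y[OF that]]]])
  have R'_eq: "R' u = kop (green \<kappa>) (f u)" if u: "u \<in> fset ell2" for u
  proof
    fix x
    have a: "R' u x = kop (green \<kappa>) u x - T \<kappa> (R' u) x"
      using fun_cong[OF L1[OF R0_mem[OF u]], of x] by (simp add: R'_def eq_diff_eq)
    have b: "kop (green \<kappa>) (f u) x = 1 * kop (green \<kappa>) u x + -1 * T \<kappa> (R' u) x"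
      unfolding f_def T_def by (rule kop_green_lincomb[OF \<kappa> u X_ell2[OF A_mem[OF R'_Y[OF u]]]])
    show "R' u x = kop (green \<kappa>) (f u) x" unfolding b by (subst a) simp
  qed
  have R'_ell2: "R' u \<in> fset ell2" if "u \<in> fset ell2" for u
    unfolding R'_eq[OF that] by (rule kop_green_mem[OF \<kappa> f_mem[OF that]])
  have R'_solves: "H (R' u) x + P (R' u) x + \<kappa>\<^sup>2 * R' u x = u x" if u: "u \<in> fset ell2" for u x
  proof -
    have "D_op (R' u) x + \<kappa>\<^sup>2 * R' u x = f u x"
      unfolding R'_eq[OF u] by (rule D_op_kop_green[OF green_summable[OF \<kappa> f_mem[OF u]] \<kappa>(2)])
    then show ?thesis by (simp add: H_eq f_def A_def algebra_simps)
  qed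
  \<comment> \<open>Pairing the resolvent equation with an eigenfunction removes H and lets P act as
    the identity, leaving the scalar factor \<open>1 + \<kappa>\<^sup>2\<close>.\<close>
  have pair: "pairing \<psi> (R' u) = pairing \<psi> u / (1 + \<kappa>\<^sup>2)" if \<psi>: "\<psi> \<in> bound_space" and u: "u \<in> fset ell2" for \<psi> u
  proof -
    note w = R'_Y[OF u]
    have sm: "(\<lambda>x. cnj (\<psi> x) * P (R' u) x) summable_on UNIV" "(\<lambda>x. cnj (\<psi> x) * R' u x) summable_on UNIV"
      by (rule bound_space_self_summable[OF \<psi> P_bound_space] pairing_ell1_summable[OF bound_space_X[OF \<psi>] w])+
    have eq: "u = (\<lambda>x. 1 * H (R' u) x + 1 * (1 * P (R' u) x + \<kappa>\<^sup>2 * R' u x))"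
      using R'_solves[OF u] by (simp add: fun_eq_iff algebra_simps)
    have sm2: "(\<lambda>x. cnj (\<psi> x) * (1 * P (R' u) x + \<kappa>\<^sup>2 * R' u x)) summable_on UNIV"
      using infsum_lincomb(1)[OF sm, of 1 "\<kappa>\<^sup>2"] by (simp add: algebra_simps)
    have "pairing \<psi> u = 1 * pairing \<psi> (H (R' u)) + 1 * (1 * pairing \<psi> (P (R' u)) + \<kappa>\<^sup>2 * pairing \<psi> (R' u))"
      by (subst (1) eq) (simp only: pairing_lincomb_right[OF pairing_bound_space_H(2)[OF \<psi> w] sm2] pairing_lincomb_right[OF sm])
    then have "pairing \<psi> u = (1 + \<kappa>\<^sup>2) * pairing \<psi> (R' u)"
      by (simp add: pairing_bound_space_H(1)[OF \<psi> w] pairing_P[OF \<psi> w] algebra_simps)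
    then show ?thesis using \<kappa>1 by (simp add: field_simps)
  qed
  have PR': "P (R' u) x = P u x / (1 + \<kappa>\<^sup>2)" if "u \<in> fset ell2" for u x
  proof -
    have "pairing \<Psi> (R' u) = pairing \<Psi> u / (1 + \<kappa>\<^sup>2)" if "\<Psi> \<in> B" for \<Psi>
      using pair \<open>u \<in> fset ell2\<close> that orthonormal_B by (auto simp: orthonormal_def)
    then show ?thesis unfolding ket_bra_sum_def by (simp add: sum_divide_distrib)
  qed
  define R where "R u = (\<lambda>x. 1 * R' u x + c * P u x)" for u
  have P_ell2: "P u \<in> fset ell2" for u by (rule X_ell2[OF bound_space_X[OF P_bound_space]])
  have R_ell2: "R u \<in> fset ell2" if "u \<in> fset ell2" for u
    unfolding R_def by (rule quasi_normedD(2)[OF quasi_normed_ell2 R'_ell2[OF that] P_ell2])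
  have R_solves: "H (R u) x + \<kappa>\<^sup>2 * R u x = u x" if u: "u \<in> fset ell2" for u x
  proof -
    have "H (R u) x = H (R' u) x + c * H (P u) x"
      unfolding R_def using H_lincomb[OF R'_Y[OF u] bound_space_Y[OF P_bound_space], of 1 c] by simp
    then have "H (R u) x + \<kappa>\<^sup>2 * R u x = (H (R' u) x + P (R' u) x + \<kappa>\<^sup>2 * R' u x) + (c * \<kappa>\<^sup>2 * P u x - P (R' u) x)"
      by (simp add: R_def bound_space_H[OF P_bound_space] algebra_simps)
    also have "c * \<kappa>\<^sup>2 = 1 / (1 + \<kappa>\<^sup>2)"
    proof -
      have "c * \<kappa>\<^sup>2 = 1 - \<kappa>\<^sup>2 / (1 + \<kappa>\<^sup>2)" using \<kappa>0 by (simp add: c_def left_diff_distrib)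
      also have "\<dots> = 1 / (1 + \<kappa>\<^sup>2)" using \<kappa>1 by (simp add: diff_divide_eq_iff)
      finally show ?thesis .
    qed
    finally show ?thesis using R'_solves[OF u, of x] PR'[OF u, of x] by simp
  qed
  \<comment> \<open>A null vector is orthogonal to all eigenfunctions because \<kappa> is not 0.
    Thus P drops out, and the equation becomes \<open>w + T \<kappa> w = 0\<close>, which
    \<open>L\<close> inverts.\<close>
  have inj: "w = (\<lambda>x. 0)" if w: "w \<in> fset ell2" and eq: "\<And>x. H w x + \<kappa>\<^sup>2 * w x = 0" for w
  proof -
    note wY = ell2_Y[OF w]
    have P0: "P w = (\<lambda>x. 0)"
    proof (rule P_eq_0I[OF wY])
      fix \<Psi> assume \<Psi>: "\<Psi> \<in> bound_space"
      have "0 = pairing \<Psi> (\<lambda>x. 1 * H w x + \<kappa>\<^sup>2 * w x)" using eq by (simp add: pairing_def)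
      also have "\<dots> = 1 * pairing \<Psi> (H w) + \<kappa>\<^sup>2 * pairing \<Psi> w"
        by (rule pairing_lincomb_right[OF pairing_bound_space_H(2)[OF \<Psi> wY] pairing_ell1_summable[OF bound_space_X[OF \<Psi>] wY]])
      finally show "pairing \<Psi> w = 0" using \<kappa>0 by (simp add: pairing_bound_space_H(1)[OF \<Psi> wY])
    qed
    have D: "(\<lambda>x. D_op w x + \<kappa>\<^sup>2 * w x) = (\<lambda>x. -1 * A w x + 0 * A w x)"
      using eq by (simp add: fun_eq_iff H_eq A_def P0 eq_neg_iff_add_eq_0 algebra_simps)
    note Aw = X_ell2[OF A_mem[OF wY]]
    have "w x + T \<kappa> w x = 0" for x
      using kop_green_D_op[OF \<kappa> w, of x] kop_green_lincomb[OF \<kappa> Aw Aw, of "-1" 0 x] unfolding D by (simp add: T_def)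
    then have "w = L (\<lambda>x. 0)" using L2[OF wY] by simp
    moreover have "L (\<lambda>x. 0) = (\<lambda>x. 0)"
      using bopD(4)[OF L(1), of "\<lambda>x. 0" "\<lambda>x. 0" 0 0] by simp
    ultimately show ?thesis by simp
  qed
  have H_diff: "H (\<lambda>x. 1 * w x + -1 * u x) x + \<kappa>\<^sup>2 * (1 * w x + -1 * u x)
      = (H w x + \<kappa>\<^sup>2 * w x) - (H u x + \<kappa>\<^sup>2 * u x)" if "w \<in> fset ell2" "u \<in> fset ell2" for w u x
    unfolding H_lincomb[OF ell2_Y[OF that(1)] ell2_Y[OF that(2)]] by (simp add: algebra_simps)
  have eq_if: "w = u" if w: "w \<in> fset ell2" and u: "u \<in> fset ell2"
    and eq: "\<And>x. H w x + \<kappa>\<^sup>2 * w x = H u x + \<kappa>\<^sup>2 * u x" for w u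
  proof -
    have "(\<lambda>x. 1 * w x + -1 * u x) = (\<lambda>x. 0)"
      by (rule inj[OF quasi_normedD(2)[OF quasi_normed_ell2 w u]]) (use H_diff[OF w u] eq in simp)
    then show ?thesis by (simp add: fun_eq_iff)
  qed
  show "resolvent H \<kappa> u = (\<lambda>x. L (kop (green \<kappa>) u) x + c * P u x)" if u: "u \<in> fset ell2"
  proof -
    have "resolvent H \<kappa> u = R u"
      unfolding resolvent_def
    proof (rule inv_into_f_eq)
      show "inj_on (\<lambda>w x. H w x + \<kappa>\<^sup>2 * w x) (fset ell2)"
        by (rule inj_onI) (rule eq_if, simp_all add: fun_eq_iff)
      show "(\<lambda>x. H (R u) x + \<kappa>\<^sup>2 * R u x) = u" using R_solves[OF u] by blast
    qed (rule R_ell2[OF u])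
    then show ?thesis by (simp add: R_def R'_def)
  qed
  obtain C1 where C1: "bop (ell2 :: ('k, 'r) gvert fspace) ell2 C1 (kop (green \<kappa>))" using green_ell2(1)[OF \<kappa>] by blast
  obtain CA where CA: "bop Y X CA A" by (rule A_bop)
  obtain CP where CP: "bop Y X CP P" using tightD_bop[OF P_tight] by blast
  have b1: "bop ell2 Y (C * C1) R'"
    using bop_comp[OF bop_comp[OF C1 bop_id_ell2_ellinf] L(1)] by (simp add: R'_def[abs_def])
  have b2: "bop ell2 ell2 (1 * (CA * (C * C1))) (\<lambda>u. A (R' u))" by (rule bop_comp[OF bop_comp[OF b1 CA] bop_id_ell1_ell2])
  have id: "bop ell2 ell2 1 (\<lambda>u. u :: ('k, 'r) gfun)" by (simp add: bop_def)
  have b3: "\<exists>K. bop ell2 ell2 K f" using bop_lincomb[OF id b2 quasi_normed_ell2, of 1 "-1"] by (auto simp: f_def[abs_def])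
  then have "\<exists>K. bop ell2 ell2 K (\<lambda>u. kop (green \<kappa>) (f u))" using bop_comp[OF _ C1] by blast
  moreover have "bop ell2 ell2 (1 * (CP * 1)) P"
    by (rule bop_comp[OF bop_comp[OF bop_id_ell2_ellinf CP] bop_id_ell1_ell2])
  ultimately obtain K where K: "bop ell2 ell2 K (\<lambda>u x. 1 * kop (green \<kappa>) (f u) x + c * P u x)"
    using bop_lincomb[OF _ _ quasi_normed_ell2, where a=1 and c=c] by blast
  \<comment> \<open>The spectrum asks for a bounded operator on l^2. The expression through
    \<open>f\<close> provides that bound, while agreement with \<open>R\<close> is required only on
    l^2.\<close>
  define R2 where "R2 u = (\<lambda>x. 1 * kop (green \<kappa>) (f u) x + c * P u x)" for u
  have R2: "R2 u = R u" if "u \<in> fset ell2" for u by (simp add: R2_def R_def R'_eq[OF that])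
  have "R2 \<in> bounded_ops ell2 ell2" using bop_imp_bounded_ops[OF K] by (simp add: R2_def[abs_def])
  moreover have "R2 (\<lambda>x. H u x - - \<kappa>\<^sup>2 * u x) = u \<and> (\<lambda>x. H (R2 u) x - - \<kappa>\<^sup>2 * R2 u x) = u"
    if u: "u \<in> fset ell2" for u
  proof
    have v: "(\<lambda>x. 1 * (1 * D_op u x + 1 * A0 u x) + \<kappa>\<^sup>2 * u x) \<in> fset ell2"
      by (intro quasi_normedD(2)[OF quasi_normed_ell2] D_op_ell2 u X_ell2 A0_mem ell2_Y)
    have v_eq: "(\<lambda>x. H u x - - \<kappa>\<^sup>2 * u x) = (\<lambda>x. 1 * (1 * D_op u x + 1 * A0 u x) + \<kappa>\<^sup>2 * u x)"
      by (simp add: H_eq)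
    show "R2 (\<lambda>x. H u x - - \<kappa>\<^sup>2 * u x) = u"
      unfolding v_eq R2[OF v] by (rule eq_if[OF R_ell2[OF v] u]) (subst R_solves[OF v], simp add: H_eq)
    show "(\<lambda>x. H (R2 u) x - - \<kappa>\<^sup>2 * R2 u x) = u" using R_solves[OF u] by (simp add: R2[OF u])
  qed
  ultimately show "- \<kappa>\<^sup>2 \<notin> spectrum_ell2 H" unfolding spectrum_ell2_def by blast
qed

end

section \<open>Uniform operator bounds\<close>

definition ubop :: "'c set \<Rightarrow> ('c \<Rightarrow> real) \<Rightarrow> 'v fspace \<Rightarrow> 'v fspace \<Rightarrow>
    ('c \<Rightarrow> ('v \<Rightarrow> complex) \<Rightarrow> 'v \<Rightarrow> complex) \<Rightarrow> bool" where
  "ubop S r X Y F \<longleftrightarrow> (\<exists>C. \<forall>\<kappa>\<in>S. bop X Y (C * r \<kappa>) (F \<kappa>))"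

lemma ubopI: "(\<And>\<kappa>. \<kappa> \<in> S \<Longrightarrow> bop X Y (C * r \<kappa>) (F \<kappa>)) \<Longrightarrow> ubop S r X Y F"
  unfolding ubop_def by blast

lemma ubop_lincomb:
  assumes "ubop S r X Y F" "ubop S r X Y G" "quasi_normed Y"
  shows "ubop S r X Y (\<lambda>\<kappa> u x. a * F \<kappa> u x + c * G \<kappa> u x)"
proof -
  obtain C D where C: "\<And>\<kappa>. \<kappa> \<in> S \<Longrightarrow> bop X Y (C * r \<kappa>) (F \<kappa>)" and D: "\<And>\<kappa>. \<kappa> \<in> S \<Longrightarrow> bop X Y (D * r \<kappa>) (G \<kappa>)"
    using assms(1,2) unfolding ubop_def by blast
  have "bop X Y ((2 * (cmod a * C + cmod c * D)) * r \<kappa>) (\<lambda>u x. a * F \<kappa> u x + c * G \<kappa> u x)" if "\<kappa> \<in> S" for \<kappa>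
    using bop_lincomb[OF C[OF that] D[OF that] assms(3), of a c] by (simp add: algebra_simps)
  then show ?thesis by (rule ubopI)
qed

lemma ubop_sum:
  assumes "finite I" "\<And>i. i \<in> I \<Longrightarrow> ubop S r X Y (F i)" "quasi_normed Y" "fset Y \<noteq> {}"
  shows "ubop S r X Y (\<lambda>\<kappa> u x. \<Sum>i\<in>I. F i \<kappa> u x)"
  using assms(1,2)
proof (induction I rule: finite_induct)
  case empty
  show ?case by (rule ubopI[where C=0]) (simp add: bop_zero[OF assms(3,4)])
next
  case (insert i I)
  have "ubop S r X Y (\<lambda>\<kappa> u x. 1 * F i \<kappa> u x + 1 * (\<Sum>i\<in>I. F i \<kappa> u x))"
    by (rule ubop_lincomb[OF _ _ assms(3)]) (use insert in auto)
  then show ?case using insert by simp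
qed

lemma bop_apply_sum:
  assumes A: "bop X Y C A" and X: "quasi_normed X" "(\<lambda>x. 0) \<in> fset X"
    and I: "finite I" "\<And>i. i \<in> I \<Longrightarrow> u i \<in> fset X"
  shows "(\<lambda>x. \<Sum>i\<in>I. a i * u i x) \<in> fset X \<and> A (\<lambda>x. \<Sum>i\<in>I. a i * u i x) = (\<lambda>x. \<Sum>i\<in>I. a i * A (u i) x)"
  using I
proof (induction I rule: finite_induct)
  case empty
  show ?case using X(2) bopD(4)[OF A X(2) X(2), of 0 0] by simp
next
  case (insert i I)
  then have ih: "(\<lambda>x. \<Sum>i\<in>I. a i * u i x) \<in> fset X" "A (\<lambda>x. \<Sum>i\<in>I. a i * u i x) = (\<lambda>x. \<Sum>i\<in>I. a i * A (u i) x)"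
    and ui: "u i \<in> fset X" by auto
  show ?case
    using insert quasi_normedD(2)[OF X(1) ui ih(1), of "a i" 1] bopD(4)[OF A ui ih(1), of "a i" 1] ih(2) by simp
qed

lemma op_norm_bop:
  assumes A: "bop X Y C A" and X: "quasi_normed X" "(\<lambda>x. 0) \<in> fset X" and Y: "quasi_normed Y"
  shows "0 \<le> op_norm X Y A" "op_norm X Y A \<le> C"
proof -
  have "fnorm X (\<lambda>x. 0) \<le> 0" using quasi_normedD(3)[OF X(1) X(2) X(2), of 0 0] by simp
  then have mem: "(\<lambda>x. 0) \<in> {u \<in> fset X. fnorm X u \<le> 1}" using X(2) by simp
  have le: "fnorm Y (A u) \<le> C" if "u \<in> {u \<in> fset X. fnorm X u \<le> 1}" for u
  proof -
    have "fnorm Y (A u) \<le> C * fnorm X u" using bopD(3)[OF A] that by simp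
    also have "\<dots> \<le> C * 1" using bopD(1)[OF A] that by (intro mult_left_mono) auto
    finally show ?thesis by simp
  qed
  show "op_norm X Y A \<le> C"
    unfolding op_norm_def by (rule cSUP_least) (use mem le in blast)+
  have "0 \<le> fnorm Y (A (\<lambda>x. 0))" by (rule quasi_normedD(1)[OF Y bopD(2)[OF A X(2)]])
  also have "\<dots> \<le> op_norm X Y A"
    unfolding op_norm_def by (rule cSUP_upper[OF mem]) (use le in \<open>auto intro!: bdd_aboveI2[where M=C]\<close>)
  finally show "0 \<le> op_norm X Y A" .
qed

lemma triangle_sum:
  fixes f :: "nat \<Rightarrow> nat \<Rightarrow> 'a::comm_monoid_add"
  shows "(\<Sum>j<M. \<Sum>i<M - j. f j i) = (\<Sum>l<M. \<Sum>j\<le>l. f j (l - j))"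
proof -
  have "(\<Sum>j<M. \<Sum>i<M - j. f j i) = (\<Sum>(j, i)\<in>Sigma {..<M} (\<lambda>j. {..<M - j}). f j i)"
    by (rule sum.Sigma) auto
  also have "Sigma {..<M} (\<lambda>j. {..<M - j}) = {(j, i). j + i < M}" by auto
  also have "(\<Sum>(j, i)\<in>{(j, i). j + i < M}. f j i) = (\<Sum>l<M. \<Sum>j\<le>l. f j (l - j))"
    by (rule sum.triangle_reindex)
  finally show ?thesis .
qed

section \<open>The expansion\<close>

lemma om_mult_power_le:
  assumes "m \<le> t" "m \<le> s"
  shows "(om x * om y) ^ m \<le> om x ^ t * om y ^ s"
  unfolding power_mult_distrib by (intro mult_mono om_pow_mono assms) auto

lemma kop_green_coeff_bop:
  assumes "Suc j \<le> t" "Suc j \<le> s"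
  shows "bop (L1 s) (Linf t) (3 * 4 ^ j) (kop (green_coeff j))"
proof (rule kop_bop)
  fix x y :: "('a, 'b) gvert"
  have "cmod (green_coeff j x y) \<le> (3 * 4 ^ j) * (om x * om y) ^ Suc j" by (rule norm_green_coeff_le)
  also have "\<dots> \<le> (3 * 4 ^ j) * (om x ^ t * om y ^ s)"
    by (intro mult_left_mono om_mult_power_le assms) auto
  finally show "cmod (green_coeff j x y) \<le> 3 * 4 ^ j * om x ^ t * om y ^ s" by (simp add: mult.assoc)
qed simp

definition green_rem :: "nat \<Rightarrow> complex \<Rightarrow> ('k, 'r) gvert \<Rightarrow> ('k, 'r) gvert \<Rightarrow> complex" where
  "green_rem M \<kappa> x y = green \<kappa> x y - (\<Sum>j<M. \<kappa> ^ j * green_coeff j x y)"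

lemma kop_green_rem_bop:
  assumes "Suc M \<le> t" "Suc M \<le> s" "0 < Re \<kappa>" "cmod \<kappa> \<le> 1 / 2"
  shows "bop (L1 s) (Linf t) ((3 * real (M + 2) * 8 ^ M) * cmod \<kappa> ^ M) (kop (green_rem M \<kappa>))"
proof (rule kop_bop)
  fix x y :: "('a, 'b) gvert"
  have "cmod (green_rem M \<kappa> x y) \<le> ((3 * real (M + 2) * 8 ^ M) * cmod \<kappa> ^ M) * (om x * om y) ^ Suc M"
    unfolding green_rem_def by (rule green_expansion[OF assms(3,4)])
  also have "\<dots> \<le> ((3 * real (M + 2) * 8 ^ M) * cmod \<kappa> ^ M) * (om x ^ t * om y ^ s)"
    by (intro mult_left_mono om_mult_power_le assms) auto
  finally show "cmod (green_rem M \<kappa> x y) \<le> 3 * real (M + 2) * 8 ^ M * cmod \<kappa> ^ M * om x ^ t * om y ^ s"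
    by (simp add: mult.assoc)
qed simp

lemma kop_green_expansion:
  fixes u :: "('k::finite, 'r::finite) gfun"
  assumes M: "Suc M \<le> s" and \<kappa>: "0 < Re \<kappa>" "cmod \<kappa> \<le> 1 / 2" and u: "u \<in> fset (L1 s)"
  shows "kop (green \<kappa>) u x = (\<Sum>j<M. \<kappa> ^ j * kop (green_coeff j) u x) + kop (green_rem M \<kappa>) u x"
proof -
  have u2: "u \<in> fset ell2" by (rule bopD(2)[OF bop_id_ell1_ell2 u])
  have green_sm: "(\<lambda>y. green \<kappa> x y * u y) summable_on UNIV"
    by (rule green_ell2(2)[OF \<kappa>(1) _ u2]) (use \<kappa> in simp)
  have green_coeff_sm: "(\<lambda>y. green_coeff j x y * u y) summable_on UNIV" if "j < M" for j
  proof (rule kop_summable(1)[OF _ u, where t="Suc j" and C="3 * 4 ^ j"])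
    fix x y :: "('k, 'r) gvert"
    have "cmod (green_coeff j x y) \<le> (3 * 4 ^ j) * (om x * om y) ^ Suc j" by (rule norm_green_coeff_le)
    also have "\<dots> \<le> (3 * 4 ^ j) * (om x ^ Suc j * om y ^ s)"
      by (intro mult_left_mono om_mult_power_le) (use that M in auto)
    finally show "cmod (green_coeff j x y) \<le> 3 * 4 ^ j * om x ^ Suc j * om y ^ s" by (simp add: mult.assoc)
  qed
  have sum: "(\<lambda>y. \<Sum>j<M. \<kappa> ^ j * (green_coeff j x y * u y)) summable_on UNIV \<and>
    (\<Sum>\<^sub>\<infinity>y. \<Sum>j<M. \<kappa> ^ j * (green_coeff j x y * u y)) = (\<Sum>j<M. \<Sum>\<^sub>\<infinity>y. \<kappa> ^ j * (green_coeff j x y * u y))"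
    by (rule infsum_finite_sum) (auto intro: summable_on_cmult_right green_coeff_sm)
  have green_rem: "green_rem M \<kappa> x y * u y = 1 * (green \<kappa> x y * u y) + -1 * (\<Sum>j<M. \<kappa> ^ j * (green_coeff j x y * u y))" for y
    by (simp add: green_rem_def sum_distrib_right left_diff_distrib mult.assoc)
  have "kop (green_rem M \<kappa>) u x = 1 * kop (green \<kappa>) u x + -1 * (\<Sum>j<M. \<kappa> ^ j * kop (green_coeff j) u x)"
    unfolding kop_def green_rem infsum_lincomb(2)[OF green_sm conjunct1[OF sum]] conjunct2[OF sum]
    by (simp only: infsum_cmult_right')
  then show ?thesis by simp
qed

context threshold_basis
begin

text \<open>The coefficients solve \<open>\<Gamma>\<^sub>l + \<Sum>\<^bsub>j \<le> l\<^esub> G\<^sub>l\<^sub>-\<^sub>j A \<Gamma>\<^sub>j = G\<^sub>l\<close>, with \<open>L0\<close> the inverse of \<open>1 + G\<^sub>0 A\<close>.\<close>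

fun Gam :: "('k, 'r) gop \<Rightarrow> nat \<Rightarrow> ('k, 'r) gop" where
  "Gam L0 j u = L0 (\<lambda>x. kop (green_coeff j) u x - (\<Sum>i<j. kop (green_coeff (j - i)) (A (Gam L0 i u)) x))"

declare Gam.simps [simp del]

text \<open>\<open>L0\<close> was built on the weight \<open>s\<close>, yet it equals the identity
  minus \<open>G\<^sub>0 A L0\<close>, whose last term is bounded for every target weight. It
  therefore preserves every smaller weight as well.\<close>

lemma L0_bop:
  assumes L0: "bop Y Y C L0" "\<And>u. u \<in> fset Y \<Longrightarrow> (\<lambda>x. L0 u x + kop (green_coeff 0) (A (L0 u)) x) = u"
    and t: "t \<le> s"
  shows "\<exists>C. bop (Linf t) (Linf t) C L0"
proof -
  obtain CA where CA: "bop Y X CA A" by (rule A_bop)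
  have id: "bop (Linf t) (Linf t) 1 (\<lambda>u. u :: ('k, 'r) gfun)"
    by (rule bop_id_ellinf) simp
  note 1 = bop_comp[OF bop_id_ellinf[OF t] L0(1)]
  note 2 = bop_comp[OF bop_comp[OF 1 CA] kop_green_coeff_0_bop[OF s1, where t=t]]
  note 3 = bop_lincomb[OF id 2 quasi_normed_ellinf, of 1 "-1"]
  have eq: "(\<lambda>x. 1 * u x + -1 * kop (green_coeff 0) (A (L0 u)) x) = L0 u" if "u \<in> fset (Linf t)" for u
    using fun_cong[OF L0(2)[OF bopD(2)[OF bop_id_ellinf[OF t] that]]] by (simp add: fun_eq_iff diff_eq_eq eq_commute)
  show ?thesis using bop_cong[OF 3 eq quasi_normed_ellinf] by blast
qed

text \<open>Earlier coefficients may be measured crudely at weight \<open>s\<close>, since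
  \<open>A\<close> sends them back into \<open>X\<close>. The weight of the output comes only from
  the outermost kernel, of order \<open>j - i\<close>, and \<open>L0\<close> preserves it.\<close>

lemma Gam_bop:
  assumes L0: "bop Y Y C L0" "\<And>u. u \<in> fset Y \<Longrightarrow> (\<lambda>x. L0 u x + kop (green_coeff 0) (A (L0 u)) x) = u"
  shows "Suc j \<le> s \<Longrightarrow> \<exists>C. bop (L1 (Suc j)) (Linf (Suc j)) C (Gam L0 j)"
proof (induction j rule: less_induct)
  case (less j)
  obtain CA where CA: "bop Y X CA A" by (rule A_bop)
  obtain C' where C': "bop (Linf (Suc j)) (Linf (Suc j)) C' L0"
    using L0_bop[OF L0 less.prems] by blast
  have ne: "fset (Linf (Suc j) :: ('k, 'r) gvert fspace) \<noteq> {}" using zero_in_ellinf by blast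
  have "\<exists>C. bop (L1 (Suc j)) (Linf (Suc j)) C (\<lambda>u. kop (green_coeff (j - i)) (A (Gam L0 i u)))"
    if i: "i \<in> {..<j}" for i
  proof -
    obtain D where D: "bop (L1 (Suc i)) (Linf (Suc i)) D (Gam L0 i)"
      using less.IH[of i] less.prems i by auto
    have le: "Suc i \<le> Suc j" "Suc i \<le> s" "Suc (j - i) \<le> Suc j" "Suc (j - i) \<le> s" using i less.prems by auto
    note 1 = bop_comp[OF bop_comp[OF bop_id_ell1[OF le(1)] D] bop_id_ellinf[OF le(2)]]
    show ?thesis using bop_comp[OF bop_comp[OF 1 CA] kop_green_coeff_bop[OF le(3,4)]] by blast
  qed
  then have "\<exists>C. bop (L1 (Suc j)) (Linf (Suc j)) C (\<lambda>u x. \<Sum>i<j. kop (green_coeff (j - i)) (A (Gam L0 i u)) x)"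
    by (rule bop_sum[OF finite_lessThan _ quasi_normed_ellinf ne])
  then obtain D where D: "bop (L1 (Suc j)) (Linf (Suc j)) D (\<lambda>u x. \<Sum>i<j. kop (green_coeff (j - i)) (A (Gam L0 i u)) x)"
    by blast
  note 2 = bop_lincomb[OF kop_green_coeff_bop[of j "Suc j" "Suc j"] D quasi_normed_ellinf, of 1 "-1", OF order_refl order_refl]
  have eq: "L0 (\<lambda>x. 1 * kop (green_coeff j) u x + -1 * (\<Sum>i<j. kop (green_coeff (j - i)) (A (Gam L0 i u)) x)) = Gam L0 j u" for u
    unfolding Gam.simps[of L0 j u] by simp
  show ?case using bop_cong[OF bop_comp[OF 2 C'] eq quasi_normed_ell1] by blast
qed

lemma Gam_mem:
  assumes L0: "bop Y Y C L0" "\<And>u. u \<in> fset Y \<Longrightarrow> (\<lambda>x. L0 u x + kop (green_coeff 0) (A (L0 u)) x) = u"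
    and j: "Suc j \<le> s" and u: "u \<in> fset X"
  shows "Gam L0 j u \<in> fset Y"
proof -
  obtain D where "bop (L1 (Suc j)) (Linf (Suc j)) D (Gam L0 j)" using Gam_bop[OF L0 j] by blast
  from bopD(2)[OF bop_ell1_ellinf_mono[OF this j] u] show ?thesis .
qed

lemma Gam_equation:
  assumes L0: "bop Y Y C L0" "\<And>u. u \<in> fset Y \<Longrightarrow> (\<lambda>x. L0 u x + kop (green_coeff 0) (A (L0 u)) x) = u"
    and l: "Suc l \<le> s" and u: "u \<in> fset X"
  shows "Gam L0 l u x + (\<Sum>j\<le>l. kop (green_coeff (l - j)) (A (Gam L0 j u)) x) = kop (green_coeff l) u x"
proof -
  define w where "w = (\<lambda>x. kop (green_coeff l) u x - (\<Sum>i<l. kop (green_coeff (l - i)) (A (Gam L0 i u)) x))"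
  have g: "kop (green_coeff l) u \<in> fset Y" by (rule bopD(2)[OF kop_green_coeff_bop[OF l l] u])
  have gi: "kop (green_coeff (l - i)) (A (Gam L0 i u)) \<in> fset Y" if "i < l" for i
  proof -
    have le: "Suc (l - i) \<le> s" "Suc i \<le> s" using l that by auto
    show ?thesis by (rule bopD(2)[OF kop_green_coeff_bop[OF le(1) le(1)] A_mem[OF Gam_mem[OF L0 le(2) u]]])
  qed
  have id: "bop Y Y 1 (\<lambda>u. u :: ('k, 'r) gfun)" by (rule bop_id_ellinf) simp
  have "(\<lambda>x. \<Sum>i<l. 1 * kop (green_coeff (l - i)) (A (Gam L0 i u)) x) \<in> fset Y"
    using bop_apply_sum[OF id quasi_normed_ellinf zero_in_ellinf, of "{..<l}" "\<lambda>i. kop (green_coeff (l - i)) (A (Gam L0 i u))" "\<lambda>i. 1"]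
      gi by simp
  from quasi_normedD(2)[OF quasi_normed_ellinf g this, of 1 "-1"] have w: "w \<in> fset Y" by (simp add: w_def)
  have Gam: "Gam L0 l u = L0 w" unfolding w_def by (rule Gam.simps)
  have "Gam L0 l u x + kop (green_coeff 0) (A (Gam L0 l u)) x = w x" unfolding Gam by (rule fun_cong[OF L0(2)[OF w]])
  moreover have "(\<Sum>j\<le>l. kop (green_coeff (l - j)) (A (Gam L0 j u)) x)
      = (\<Sum>i<l. kop (green_coeff (l - i)) (A (Gam L0 i u)) x) + kop (green_coeff 0) (A (Gam L0 l u)) x"
    by (simp add: lessThan_Suc_atMost[symmetric])
  ultimately show ?thesis by (simp add: w_def algebra_simps)
qed

lemma T_bop:
  assumes \<kappa>: "0 < Re \<kappa>" "cmod \<kappa> \<le> 1 / 2"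
  shows "\<exists>C. bop Y Y C (T \<kappa>)" and "bop X Y 3 (kop (green \<kappa>))"
proof -
  show *: "bop X Y 3 (kop (green \<kappa>))"
  proof (rule kop_bop)
    fix x y :: "('k, 'r) gvert"
    have "cmod (green \<kappa> x y) \<le> 3 * (om x * om y) ^ 1" using norm_green_le[of \<kappa> x y] \<kappa> by simp
    also have "\<dots> \<le> 3 * (om x ^ s * om y ^ s)" by (intro mult_left_mono om_mult_power_le s1) auto
    finally show "cmod (green \<kappa> x y) \<le> 3 * om x ^ s * om y ^ s" by (simp add: mult.assoc)
  qed simp
  obtain CA where "bop Y X CA A" by (rule A_bop)
  from bop_comp[OF this *] show "\<exists>C. bop Y Y C (T \<kappa>)" by (auto simp: T_def[abs_def])
qed

text \<open>Applying \<open>1 + T \<kappa>\<close> to the error of the partial sum cancels all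
  orders below \<open>M\<close>, by the recursion for the coefficients. What remains is of order
  \<open>M\<close>, and the uniform bound on \<open>L \<kappa>\<close> transfers this to the
  error.\<close>

lemma reduced_resolvent_expansion:
  assumes L0: "bop Y Y C0 L0" "\<And>u. u \<in> fset Y \<Longrightarrow> (\<lambda>x. L0 u x + kop (green_coeff 0) (A (L0 u)) x) = u"
    and M: "Suc M \<le> s" and S: "\<And>\<kappa>. \<kappa> \<in> S \<Longrightarrow> 0 < Re \<kappa> \<and> cmod \<kappa> \<le> 1 / 2"
    and L: "\<And>\<kappa>. \<kappa> \<in> S \<Longrightarrow> bop Y Y C (L \<kappa>)"
      "\<And>\<kappa> u. \<kappa> \<in> S \<Longrightarrow> u \<in> fset Y \<Longrightarrow> (\<lambda>x. L \<kappa> u x + T \<kappa> (L \<kappa> u) x) = u"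
      "\<And>\<kappa> u. \<kappa> \<in> S \<Longrightarrow> u \<in> fset Y \<Longrightarrow> L \<kappa> (\<lambda>x. u x + T \<kappa> u x) = u"
  shows "ubop S (\<lambda>\<kappa>. cmod \<kappa> ^ M) X Y (\<lambda>\<kappa> u x. L \<kappa> (kop (green \<kappa>) u) x - (\<Sum>j<M. \<kappa> ^ j * Gam L0 j u x))"
proof -
  obtain CA where CA: "bop Y X CA A" by (rule A_bop)
  \<comment> \<open>The image of the error under \<open>1 + T \<kappa>\<close>: the remainder of the
    free resolvent minus those arising when \<open>T \<kappa>\<close> acts on the partial sum. The
    term with \<open>\<kappa> ^ j\<close> is expanded only to order \<open>M - j\<close>, so every
    term has order \<open>M\<close>.\<close>
  define z where "z \<kappa> u x = 1 * kop (green_rem M \<kappa>) u x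
    + -1 * (\<Sum>j<M. \<kappa> ^ j * kop (green_rem (M - j) \<kappa>) (A (Gam L0 j u)) x)" for \<kappa> u x
  have z_bop: "ubop S (\<lambda>\<kappa>. cmod \<kappa> ^ M) X Y z"
    unfolding z_def[abs_def]
  proof (intro ubop_lincomb ubop_sum quasi_normed_ellinf finite_lessThan)
    show "ubop S (\<lambda>\<kappa>. cmod \<kappa> ^ M) X Y (\<lambda>\<kappa>. kop (green_rem M \<kappa>))"
      by (rule ubopI) (use kop_green_rem_bop[OF M M] S in blast)
    show "fset Y \<noteq> {}" using zero_in_ellinf by blast
    fix j assume j: "j \<in> {..<M}"
    then have le: "Suc j \<le> s" "Suc (M - j) \<le> s" using M by auto
    obtain D where "bop (L1 (Suc j)) (Linf (Suc j)) D (Gam L0 j)" using Gam_bop[OF L0 le(1)] by blast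
    then have D: "bop X Y D (Gam L0 j)" by (rule bop_ell1_ellinf_mono[OF _ le(1)])
    define K where "K = 3 * real (M - j + 2) * 8 ^ (M - j)"
    show "ubop S (\<lambda>\<kappa>. cmod \<kappa> ^ M) X Y (\<lambda>\<kappa> u x. \<kappa> ^ j * kop (green_rem (M - j) \<kappa>) (A (Gam L0 j u)) x)"
    proof (rule ubopI)
      fix \<kappa> assume \<kappa>: "\<kappa> \<in> S"
      have "bop X Y (K * cmod \<kappa> ^ (M - j)) (kop (green_rem (M - j) \<kappa>))"
        unfolding K_def by (rule kop_green_rem_bop[OF le(2,2)]) (use S[OF \<kappa>] in auto)
      note 1 = bop_comp[OF bop_comp[OF D CA] this]
      have "cmod \<kappa> ^ M = cmod \<kappa> ^ j * cmod \<kappa> ^ (M - j)"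
        unfolding power_add[symmetric] using j by simp
      then show "bop X Y ((2 * K * (CA * D)) * cmod \<kappa> ^ M) (\<lambda>u x. \<kappa> ^ j * kop (green_rem (M - j) \<kappa>) (A (Gam L0 j u)) x)"
        using bop_lincomb[OF 1 1 quasi_normed_ellinf, of "\<kappa> ^ j" 0] by (simp add: norm_power mult_ac)
    qed
  qed
  have eq: "L \<kappa> (z \<kappa> u) = (\<lambda>x. L \<kappa> (kop (green \<kappa>) u) x - (\<Sum>j<M. \<kappa> ^ j * Gam L0 j u x))"
    if \<kappa>S: "\<kappa> \<in> S" and u: "u \<in> fset X" for \<kappa> u
  proof -
    have \<kappa>: "0 < Re \<kappa>" "cmod \<kappa> \<le> 1 / 2" using S[OF \<kappa>S] by auto
    obtain CT where CT: "bop Y Y CT (T \<kappa>)" using T_bop(1)[OF \<kappa>] by blast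
    have R0: "kop (green \<kappa>) u \<in> fset Y" by (rule bopD(2)[OF T_bop(2)[OF \<kappa>] u])
    define w where "w = L \<kappa> (kop (green \<kappa>) u)"
    have w: "w \<in> fset Y" unfolding w_def by (rule bopD(2)[OF L(1)[OF \<kappa>S] R0])
    have Gj: "Gam L0 j u \<in> fset Y" if "j \<in> {..<M}" for j
      by (rule Gam_mem[OF L0 _ u]) (use that M in auto)
    define v where "v = (\<lambda>x. \<Sum>j<M. \<kappa> ^ j * Gam L0 j u x)"
    have v: "v \<in> fset Y" "T \<kappa> v = (\<lambda>x. \<Sum>j<M. \<kappa> ^ j * T \<kappa> (Gam L0 j u) x)"
      using bop_apply_sum[OF CT quasi_normed_ellinf zero_in_ellinf finite_lessThan Gj, where a="\<lambda>j. \<kappa> ^ j"]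
      unfolding v_def by auto
    define r where "r = (\<lambda>x. 1 * w x + -1 * v x)"
    have r: "r \<in> fset Y" unfolding r_def by (rule quasi_normedD(2)[OF quasi_normed_ellinf w v(1)])
    have Tr: "T \<kappa> r = (\<lambda>x. 1 * T \<kappa> w x + -1 * T \<kappa> v x)" unfolding r_def by (rule bopD(4)[OF CT w v(1)])
    have "r x + T \<kappa> r x = z \<kappa> u x" for x
    proof -
      have "w x + T \<kappa> w x = kop (green \<kappa>) u x" unfolding w_def by (rule fun_cong[OF L(2)[OF \<kappa>S R0]])
      also have "\<dots> = (\<Sum>l<M. \<kappa> ^ l * kop (green_coeff l) u x) + kop (green_rem M \<kappa>) u x" by (rule kop_green_expansion[OF M \<kappa> u])
      finally have w_eq: "w x + T \<kappa> w x = (\<Sum>l<M. \<kappa> ^ l * kop (green_coeff l) u x) + kop (green_rem M \<kappa>) u x" .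
      define g where "g j i = kop (green_coeff i) (A (Gam L0 j u)) x" for j i
      define \<rho> where "\<rho> j = kop (green_rem (M - j) \<kappa>) (A (Gam L0 j u)) x" for j
      \<comment> \<open>Cauchy product: the double sum over \<open>j + i < M\<close> is regrouped by
        total degree, after which each degree is one instance of
        \<open>Gam_equation\<close>.\<close>
      have "T \<kappa> v x = (\<Sum>j<M. \<kappa> ^ j * ((\<Sum>i<M - j. \<kappa> ^ i * g j i) + \<rho> j))"
        unfolding v(2)
      proof (rule sum.cong[OF refl])
        fix j assume j: "j \<in> {..<M}"
        have "Suc (M - j) \<le> s" using M by auto
        then have "T \<kappa> (Gam L0 j u) x = (\<Sum>i<M - j. \<kappa> ^ i * g j i) + \<rho> j"
          unfolding T_def g_def \<rho>_def by (rule kop_green_expansion[OF _ \<kappa> A_mem[OF Gj[OF j]]])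
        then show "\<kappa> ^ j * T \<kappa> (Gam L0 j u) x = \<kappa> ^ j * ((\<Sum>i<M - j. \<kappa> ^ i * g j i) + \<rho> j)" by simp
      qed
      also have "\<dots> = (\<Sum>j<M. \<Sum>i<M - j. \<kappa> ^ (j + i) * g j i) + (\<Sum>j<M. \<kappa> ^ j * \<rho> j)"
        by (simp add: distrib_left sum.distrib sum_distrib_left power_add mult.assoc)
      also have "(\<Sum>j<M. \<Sum>i<M - j. \<kappa> ^ (j + i) * g j i) = (\<Sum>l<M. \<Sum>j\<le>l. \<kappa> ^ (j + (l - j)) * g j (l - j))"
        by (rule triangle_sum)
      also have "\<dots> = (\<Sum>l<M. \<kappa> ^ l * (\<Sum>j\<le>l. g j (l - j)))"
        unfolding sum_distrib_left by (intro sum.cong) auto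
      finally have "v x + T \<kappa> v x = (\<Sum>l<M. \<kappa> ^ l * (Gam L0 l u x + (\<Sum>j\<le>l. g j (l - j)))) + (\<Sum>j<M. \<kappa> ^ j * \<rho> j)"
        by (simp add: v_def distrib_left sum.distrib)
      also have "(\<Sum>l<M. \<kappa> ^ l * (Gam L0 l u x + (\<Sum>j\<le>l. g j (l - j)))) = (\<Sum>l<M. \<kappa> ^ l * kop (green_coeff l) u x)"
      proof (rule sum.cong[OF refl])
        fix l assume "l \<in> {..<M}"
        then have "Suc l \<le> s" using M by auto
        then show "\<kappa> ^ l * (Gam L0 l u x + (\<Sum>j\<le>l. g j (l - j))) = \<kappa> ^ l * kop (green_coeff l) u x"
          using Gam_equation[OF L0 _ u, of l x] by (simp add: g_def)
      qed
      finally have v_eq: "v x + T \<kappa> v x = (\<Sum>l<M. \<kappa> ^ l * kop (green_coeff l) u x) + (\<Sum>j<M. \<kappa> ^ j * \<rho> j)" .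
      have "r x + T \<kappa> r x = (w x + T \<kappa> w x) - (v x + T \<kappa> v x)" unfolding Tr by (simp add: r_def)
      then show ?thesis unfolding w_eq v_eq by (simp add: z_def \<rho>_def)
    qed
    then have "(\<lambda>x. r x + T \<kappa> r x) = z \<kappa> u" by blast
    then have "L \<kappa> (z \<kappa> u) = r" using L(3)[OF \<kappa>S r] by simp
    then show ?thesis by (simp add: r_def w_def v_def)
  qed
  obtain K where K: "\<And>\<kappa>. \<kappa> \<in> S \<Longrightarrow> bop X Y (K * cmod \<kappa> ^ M) (z \<kappa>)" using z_bop unfolding ubop_def by blast
  show ?thesis
  proof (rule ubopI)
    fix \<kappa> assume \<kappa>: "\<kappa> \<in> S"
    from bop_cong[OF bop_comp[OF K[OF \<kappa>] L(1)[OF \<kappa>]] eq[OF \<kappa>] quasi_normed_ell1]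
    show "bop X Y ((C * K) * cmod \<kappa> ^ M) (\<lambda>u x. L \<kappa> (kop (green \<kappa>) u) x - (\<Sum>j<M. \<kappa> ^ j * Gam L0 j u x))"
      by (simp add: mult.assoc)
  qed
qed

end

lemma weighted_projection_expansion:
  assumes P: "bop X Y C P" and S: "\<And>\<kappa>. \<kappa> \<in> S \<Longrightarrow> cmod \<kappa> \<le> 1 / 2" and Y: "quasi_normed Y"
    and X: "quasi_normed X"
  shows "ubop S (\<lambda>\<kappa>. cmod \<kappa> ^ M) X Y
    (\<lambda>\<kappa> u x. (1 / (1 + \<kappa>\<^sup>2) - (\<Sum>j<M. \<kappa> ^ j * tcoeff (\<lambda>\<kappa>. 1 / (1 + \<kappa>\<^sup>2)) j)) * P u x)"
proof (rule ubopI)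
  fix \<kappa> assume \<kappa>: "\<kappa> \<in> S"
  define F where "F \<kappa> = 1 / (1 + \<kappa>\<^sup>2)" for \<kappa> :: complex
  define a where "a = F \<kappa> - (\<Sum>j<M. \<kappa> ^ j * tcoeff F j)"
  \<comment> \<open>The Taylor estimate on radius 1/2 with bound 3: the factor
    \<open>2 * cmod \<kappa> / (1 / 2)\<close> produces \<open>4 ^ M\<close>.\<close>
  define K where "K = real (M + 2) * 3 * 4 ^ M"
  have hol: "F holomorphic_on ball 0 1"
    unfolding F_def
    by (intro holomorphic_on_divide holomorphic_on_const holomorphic_on_add holomorphic_on_power
        holomorphic_on_ident one_plus_sq_nonzero) simp
  have "cmod a \<le> real (M + 2) * 3 * (2 * cmod \<kappa> / (1 / 2)) ^ M"
    unfolding a_def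
    by (rule taylor_remainder_le[OF hol]) (use norm_inverse_1_plus_sq_le S[OF \<kappa>] in \<open>auto simp: F_def\<close>)
  also have "\<dots> = K * cmod \<kappa> ^ M" by (simp add: K_def power_mult_distrib)
  finally have a: "cmod a \<le> K * cmod \<kappa> ^ M" .
  have "bop X Y (2 * (cmod a * C)) (\<lambda>u x. a * P u x)" using bop_lincomb[OF P P Y, of a 0] by simp
  moreover have "2 * (cmod a * C) \<le> (2 * K * C) * cmod \<kappa> ^ M"
    using mult_right_mono[OF a bopD(1)[OF P]] by (simp add: mult_ac)
  ultimately have "bop X Y ((2 * K * C) * cmod \<kappa> ^ M) (\<lambda>u x. a * P u x)" by (rule bop_mono[OF _ X])
  then show "bop X Y ((2 * K * C) * cmod \<kappa> ^ M)
      (\<lambda>u x. (1 / (1 + \<kappa>\<^sup>2) - (\<Sum>j<M. \<kappa> ^ j * tcoeff (\<lambda>\<kappa>. 1 / (1 + \<kappa>\<^sup>2)) j)) * P u x)"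
    by (simp add: a_def F_def[abs_def])
qed

section \<open>The full resolvent, with both multiples of P\<close>

context threshold_basis
begin

text \<open>Eigenfunctions are bounded, so P has a bounded kernel and acts between any two of these
  weights. In particular its multiples never raise the weight of a coefficient.\<close>

lemma P_bop: "\<exists>C. bop (L1 t) (ellinf (- real t')) C P"
proof -
  have "\<exists>C. bop (L1 t) (ellinf (- real t')) C (\<lambda>u x. pairing \<Psi> u * \<Psi> x)" if "\<Psi> \<in> B" for \<Psi>
  proof -
    have \<Psi>: "\<Psi> \<in> fset X" using that orthonormal_B bound_space_X by (auto simp: orthonormal_def)
    define N where "N = fnorm X \<Psi>"
    have N: "0 \<le> N" "cmod (\<Psi> x) \<le> N" for x
      unfolding N_def by (rule fnorm_ell1_nonneg ell1_pointwise_le[OF \<Psi>])+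
    have "bop (L1 t) (ellinf (- real t')) (N * N) (kop (\<lambda>x y. \<Psi> x * cnj (\<Psi> y)))"
    proof (rule kop_bop)
      fix x y :: "('k, 'r) gvert"
      have "cmod (\<Psi> x * cnj (\<Psi> y)) \<le> N * N"
        unfolding norm_mult complex_mod_cnj by (intro mult_mono N) auto
      also have "\<dots> \<le> (N * N) * (om x ^ t' * om y ^ t)"
        using mult_left_mono[OF mult_mono[OF om_pow_ge_1[of x t'] om_pow_ge_1[of y t]], of "N * N"] N(1) by simp
      finally show "cmod (\<Psi> x * cnj (\<Psi> y)) \<le> N * N * om x ^ t' * om y ^ t" by (simp add: mult.assoc)
    qed (use N in simp)
    moreover have "kop (\<lambda>x y. \<Psi> x * cnj (\<Psi> y)) = (\<lambda>u x. pairing \<Psi> u * \<Psi> x)"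
      by (intro ext) (simp add: kop_def pairing_def mult.assoc infsum_cmult_right' mult.commute[of _ "\<Psi> _"])
    ultimately show ?thesis by auto
  qed
  moreover have "finite B" using orthonormal_B by (simp add: orthonormal_def)
  moreover have "fset (ellinf (- real t') :: ('k, 'r) gvert fspace) \<noteq> {}" using zero_in_ellinf by blast
  ultimately have "\<exists>C. bop (L1 t) (ellinf (- real t')) C (\<lambda>u x. \<Sum>\<Psi>\<in>B. pairing \<Psi> u * \<Psi> x)"
    by (intro bop_sum quasi_normed_ellinf)
  then show ?thesis by (simp add: ket_bra_sum_def[abs_def])
qed

lemma resolvent_expansion:
  assumes M: "Suc M \<le> s"
  shows "\<exists>\<Gamma> \<delta>. 0 < \<delta> \<and> \<delta> \<le> 1 / 2 \<and>
    (\<forall>j. Suc j \<le> s \<longrightarrow> (\<exists>C. bop (L1 (Suc j)) (Linf (Suc j)) C (\<Gamma> j))) \<and>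
    (\<forall>\<kappa>. 0 < Re \<kappa> \<longrightarrow> cmod \<kappa> < \<delta> \<longrightarrow> - \<kappa>\<^sup>2 \<notin> spectrum_ell2 H) \<and>
    ubop {\<kappa>. 0 < Re \<kappa> \<and> cmod \<kappa> < \<delta>} (\<lambda>\<kappa>. cmod \<kappa> ^ M) X Y
      (\<lambda>\<kappa> u x. resolvent H \<kappa> u x - (1 / \<kappa>\<^sup>2 * P u x + (\<Sum>j<M. \<kappa> ^ j * \<Gamma> j u x)))"
proof -
  obtain L0 C0 where L0: "bop Y Y C0 L0"
    "\<And>u. u \<in> fset Y \<Longrightarrow> (\<lambda>x. L0 u x + kop (green_coeff 0) (A (L0 u)) x) = u" by (rule threshold_inverse) (rule that)
  obtain \<delta> C where \<delta>: "0 < \<delta>" "\<delta> \<le> 1 / 2" and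
    ex: "\<And>\<kappa>. 0 < Re \<kappa> \<Longrightarrow> cmod \<kappa> < \<delta> \<Longrightarrow>
    \<exists>L. bop Y Y C L \<and> (\<forall>u\<in>fset Y. (\<lambda>x. L u x + T \<kappa> (L u) x) = u \<and> L (\<lambda>x. u x + T \<kappa> u x) = u)"
    using perturbed_inverse by blast
  define S where "S = {\<kappa>. 0 < Re \<kappa> \<and> cmod \<kappa> < \<delta>}"
  have S: "0 < Re \<kappa> \<and> cmod \<kappa> \<le> 1 / 2" if "\<kappa> \<in> S" for \<kappa> using that \<delta> by (simp add: S_def)
  have "\<forall>\<kappa>\<in>S. \<exists>L. bop Y Y C L \<and> (\<forall>u\<in>fset Y. (\<lambda>x. L u x + T \<kappa> (L u) x) = u \<and> L (\<lambda>x. u x + T \<kappa> u x) = u)"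
    using ex by (simp add: S_def)
  from bchoice[OF this] obtain L where L: "\<forall>\<kappa>\<in>S. bop Y Y C (L \<kappa>) \<and>
      (\<forall>u\<in>fset Y. (\<lambda>x. L \<kappa> u x + T \<kappa> (L \<kappa> u) x) = u \<and> L \<kappa> (\<lambda>x. u x + T \<kappa> u x) = u)"
    by (rule exE)
  define p where "p j = tcoeff (\<lambda>\<kappa>. 1 / (1 + \<kappa>\<^sup>2)) j" for j
  \<comment> \<open>The Taylor coefficients \<open>p j\<close> of
    \<open>1 / (1 + \<kappa>\<^sup>2)\<close> enter with a minus sign: the resolvent of
    \<open>H + P\<close> acts on the range of P by that factor, which has to be removed.\<close>
  define \<Gamma> where "\<Gamma> j u x = 1 * Gam L0 j u x + - p j * P u x" for j u x
  have \<Gamma>: "\<exists>C. bop (L1 (Suc j)) (Linf (Suc j)) C (\<Gamma> j)" if j: "Suc j \<le> s" for j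
  proof -
    obtain C D where "bop (L1 (Suc j)) (Linf (Suc j)) C (Gam L0 j)"
      "bop (L1 (Suc j)) (Linf (Suc j)) D P"
      using Gam_bop[OF L0 j] P_bop by blast
    from bop_lincomb[OF this quasi_normed_ellinf, of 1 "- p j"] show ?thesis
      unfolding \<Gamma>_def[abs_def] by blast
  qed
  have res: "- \<kappa>\<^sup>2 \<notin> spectrum_ell2 H"
    "u \<in> fset ell2 \<Longrightarrow> resolvent H \<kappa> u = (\<lambda>x. L \<kappa> (kop (green \<kappa>) u) x + (1 / \<kappa>\<^sup>2 - 1 / (1 + \<kappa>\<^sup>2)) * P u x)"
    if \<kappa>: "\<kappa> \<in> S" for \<kappa> u
    using resolvent_inverse[of \<kappa> C "L \<kappa>"] S[OF \<kappa>] L[rule_format, OF \<kappa>] by simp_all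
  have 1: "ubop S (\<lambda>\<kappa>. cmod \<kappa> ^ M) X Y (\<lambda>\<kappa> u x. L \<kappa> (kop (green \<kappa>) u) x - (\<Sum>j<M. \<kappa> ^ j * Gam L0 j u x))"
    by (rule reduced_resolvent_expansion[OF L0 M S, where C=C]) (use L in auto)
  obtain CP where CP: "bop X Y CP P" using P_bop by blast
  have 2: "ubop S (\<lambda>\<kappa>. cmod \<kappa> ^ M) X Y (\<lambda>\<kappa> u x. (1 / (1 + \<kappa>\<^sup>2) - (\<Sum>j<M. \<kappa> ^ j * p j)) * P u x)"
    unfolding p_def by (rule weighted_projection_expansion[OF CP _ quasi_normed_ellinf quasi_normed_ell1]) (use S in simp)
  have "ubop S (\<lambda>\<kappa>. cmod \<kappa> ^ M) X Y (\<lambda>\<kappa> u x. 1 * (L \<kappa> (kop (green \<kappa>) u) x - (\<Sum>j<M. \<kappa> ^ j * Gam L0 j u x))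
      + -1 * ((1 / (1 + \<kappa>\<^sup>2) - (\<Sum>j<M. \<kappa> ^ j * p j)) * P u x))"
    by (rule ubop_lincomb[OF 1 2 quasi_normed_ellinf])
  then obtain K where K: "\<And>\<kappa>. \<kappa> \<in> S \<Longrightarrow> bop X Y (K * cmod \<kappa> ^ M)
      (\<lambda>u x. 1 * (L \<kappa> (kop (green \<kappa>) u) x - (\<Sum>j<M. \<kappa> ^ j * Gam L0 j u x))
      + -1 * ((1 / (1 + \<kappa>\<^sup>2) - (\<Sum>j<M. \<kappa> ^ j * p j)) * P u x))"
    unfolding ubop_def by blast
  have "ubop S (\<lambda>\<kappa>. cmod \<kappa> ^ M) X Y
      (\<lambda>\<kappa> u x. resolvent H \<kappa> u x - (1 / \<kappa>\<^sup>2 * P u x + (\<Sum>j<M. \<kappa> ^ j * \<Gamma> j u x)))"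
  proof (rule ubopI, rule bop_cong[OF K _ quasi_normed_ell1])
    fix \<kappa> u assume \<kappa>: "\<kappa> \<in> S" and u: "u \<in> fset X"
    have "(\<Sum>j<M. \<kappa> ^ j * \<Gamma> j u x) = (\<Sum>j<M. \<kappa> ^ j * Gam L0 j u x) - (\<Sum>j<M. \<kappa> ^ j * p j) * P u x" for x
      by (simp add: \<Gamma>_def algebra_simps sum_subtractf sum_distrib_left sum_distrib_right)
    then show "(\<lambda>x. 1 * (L \<kappa> (kop (green \<kappa>) u) x - (\<Sum>j<M. \<kappa> ^ j * Gam L0 j u x))
      + -1 * ((1 / (1 + \<kappa>\<^sup>2) - (\<Sum>j<M. \<kappa> ^ j * p j)) * P u x))
      = (\<lambda>x. resolvent H \<kappa> u x - (1 / \<kappa>\<^sup>2 * P u x + (\<Sum>j<M. \<kappa> ^ j * \<Gamma> j u x)))"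
      unfolding res(2)[OF \<kappa> X_ell2[OF u]] by (simp add: left_diff_distrib add_diff_eq diff_add_eq diff_diff_eq add.commute)
  qed
  then show ?thesis using \<delta> \<Gamma> res(1) unfolding S_def
    by (intro exI[of _ \<Gamma>] exI[of _ \<delta>]) simp
qed

end

section \<open>Assembly of the coefficients and the two projections\<close>

theorem theorem3p7:
  fixes E :: "'k::finite set set"
    and b :: "'r::finite \<Rightarrow> 'k"
    and V H :: "('k, 'r) gop"
    and \<beta> :: int
  assumes graph: "connected_simple_graph E"
    and beta: "\<beta> \<ge> 4"
    and A: "assumption_A TYPE('h::complex_hilbert) (of_int \<beta>) V"
    and H: "H = H_full E b V"
    and second_kind: "exceptional_second_kind (of_int \<beta>) H"
  shows "\<exists>G :: int \<Rightarrow> ('k, 'r) gop.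
    (\<forall>j\<in>{-2..\<beta> - 6}.
       (even j \<longrightarrow> G j \<in> Bs (of_int (j + 3))) \<and> (odd j \<longrightarrow> G j \<in> Bs (of_int (j + 2)))) \<and>
    (\<forall>\<^sub>F \<kappa> in at 0 within {\<kappa>. Re \<kappa> > 0}.
       - \<kappa>\<^sup>2 \<notin> spectrum_ell2 H \<and>
       expansion_remainder H G (-2) (\<beta> - 6) \<kappa> \<in> Bs (of_int (\<beta> - 2))) \<and>
    (\<lambda>\<kappa>. Bs_norm (of_int (\<beta> - 2)) (expansion_remainder H G (-2) (\<beta> - 6) \<kappa>))
       \<in> O[at 0 within {\<kappa>. Re \<kappa> > 0}](\<lambda>\<kappa>. cmod \<kappa> powi (\<beta> - 5)) \<and>
    equals_projection 1 (orthonormal_bound_basis (of_int \<beta>) H) (G (-2)) \<and>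
    (\<exists>u\<in>fset (ell1 1). G (-2) u \<noteq> (\<lambda>x. 0)) \<and>
    equals_projection 1 (orthonormal_resonance_basis (of_int \<beta>) H) (\<lambda>u x. 0) \<and>
    (\<beta> \<ge> 5 \<longrightarrow> equals_projection 1 (orthonormal_resonance_basis (of_int \<beta>) H) (G (-1)))"
proof -
  define s where "s = nat (\<beta> - 2)"
  \<comment> \<open>The number of coefficients with nonnegative index. The truncation to 0 matters
    at \<beta> = 4, where the expansion stops at index -2.\<close>
  define M where "M = nat (\<beta> - 5)"
  have s: "2 \<le> s" "Suc M \<le> s" using beta by (auto simp: s_def M_def)
  have \<beta>_int: "\<beta> = int (s + 2)" using beta by (simp add: s_def)
  have \<beta>: "real_of_int \<beta> = real (s + 2)" "real_of_int (\<beta> - 2) = real s" unfolding \<beta>_int by simp_all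
  note A' = A[unfolded \<beta>(1)]
  interpret th: threshold E b V s
  proof
    show "tight s V" by (rule tight_assumption_A[OF A']) simp
    show "\<exists>C. bop (Linf (s + 2)) (L1 (s + 2)) C V"
      using assumption_A_bounded[OF A'] by blast
    show "pairing \<Psi> (V \<Phi>) = pairing (V \<Psi>) \<Phi>"
      if "\<Phi> \<in> fset (Linf (s + 2))" "\<Psi> \<in> fset (Linf (s + 2))" for \<Phi> \<Psi>
      by (rule assumption_A_symmetric[OF A' that])
  qed (rule s(1))
  have H_eq: "H = th.H" by (simp add: H th.H_def)
  have res: "res_eigenspace (real (s + 2)) th.H = th.bound_space" and nonzero: "{\<lambda>x. 0} \<subset> th.bound_space"
    using second_kind unfolding exceptional_second_kind_def \<beta>(1) H_eq th.bound_space_def by auto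
  obtain B where B: "th.orthonormal B" "\<forall>\<Psi>\<in>th.bound_space. \<Psi> = (\<lambda>x. \<Sum>\<Phi>\<in>B. pairing \<Phi> \<Psi> * \<Phi> x)"
    using th.orthonormal_spanning_exists by blast
  interpret tb: threshold_basis E b V s B
    by unfold_locales (use res B in auto)
  obtain \<Gamma> \<delta> where \<delta>: "0 < \<delta>" "\<delta> \<le> 1 / 2"
    and \<Gamma>: "\<And>j. Suc j \<le> s \<Longrightarrow> \<exists>C. bop (L1 (Suc j)) (Linf (Suc j)) C (\<Gamma> j)"
    and spectrum: "\<And>\<kappa>. 0 < Re \<kappa> \<Longrightarrow> cmod \<kappa> < \<delta> \<Longrightarrow> - \<kappa>\<^sup>2 \<notin> spectrum_ell2 th.H"
    and exp: "ubop {\<kappa>. 0 < Re \<kappa> \<and> cmod \<kappa> < \<delta>} (\<lambda>\<kappa>. cmod \<kappa> ^ M) (L1 s) (Linf s)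
      (\<lambda>\<kappa> u x. resolvent th.H \<kappa> u x - (1 / \<kappa>\<^sup>2 * ket_bra_sum B u x + (\<Sum>j<M. \<kappa> ^ j * \<Gamma> j u x)))"
    using tb.resolvent_expansion[OF s(2)] by blast
  \<comment> \<open>The only negative index with a nonzero coefficient is -2, so the sum over all
    indices reduces to P and the \<open>M\<close> regular terms.\<close>
  define G where "G j = (if j = -2 then ket_bra_sum B else if j < 0 then (\<lambda>u x. 0) else \<Gamma> (nat j))" for j :: int
  obtain K where K: "\<And>\<kappa>. 0 < Re \<kappa> \<Longrightarrow> cmod \<kappa> < \<delta> \<Longrightarrow> bop (L1 s) (Linf s) (K * cmod \<kappa> ^ M)
      (\<lambda>u x. resolvent th.H \<kappa> u x - (1 / \<kappa>\<^sup>2 * ket_bra_sum B u x + (\<Sum>j<M. \<kappa> ^ j * \<Gamma> j u x)))"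
    using exp unfolding ubop_def by blast
  have sum_eq: "(\<Sum>j\<in>{-2..\<beta> - 6}. \<kappa> powi j * G j u x) = 1 / \<kappa>\<^sup>2 * ket_bra_sum B u x + (\<Sum>j<M. \<kappa> ^ j * \<Gamma> j u x)"
    for \<kappa> u x
  proof -
    have "(\<Sum>j\<in>{-2..\<beta> - 6}. \<kappa> powi j * G j u x) = (\<Sum>j\<in>insert (-2) (int ` {..<M}). \<kappa> powi j * G j u x)"
    proof (rule sum.mono_neutral_right)
      show "insert (-2) (int ` {..<M}) \<subseteq> {-2..\<beta> - 6}" using beta by (auto simp: M_def)
      show "\<forall>j\<in>{-2..\<beta> - 6} - insert (-2) (int ` {..<M}). \<kappa> powi j * G j u x = 0"
      proof
        fix j assume j: "j \<in> {-2..\<beta> - 6} - insert (-2) (int ` {..<M})"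
        have "j < 0"
        proof (rule ccontr)
          assume "\<not> j < 0"
          then have "j = int (nat j)" "nat j < M" using j by (auto simp: M_def)
          then show False using j by blast
        qed
        then show "\<kappa> powi j * G j u x = 0" using j by (simp add: G_def)
      qed
    qed simp
    also have "\<dots> = \<kappa> powi (-2) * G (-2) u x + (\<Sum>j\<in>int ` {..<M}. \<kappa> powi j * G j u x)"
      by (rule sum.insert) auto
    also have "(\<Sum>j\<in>int ` {..<M}. \<kappa> powi j * G j u x) = (\<Sum>j<M. \<kappa> ^ j * \<Gamma> j u x)"
      by (subst sum.reindex) (auto simp: G_def)
    also have "\<kappa> powi (-2) * G (-2) u x = 1 / \<kappa>\<^sup>2 * ket_bra_sum B u x"
      by (simp add: G_def power_int_def inverse_eq_divide power_divide)
    finally show ?thesis .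
  qed
  have rem: "expansion_remainder H G (-2) (\<beta> - 6) \<kappa>
      = (\<lambda>u x. resolvent th.H \<kappa> u x - (1 / \<kappa>\<^sup>2 * ket_bra_sum B u x + (\<Sum>j<M. \<kappa> ^ j * \<Gamma> j u x)))" for \<kappa>
    unfolding expansion_remainder_def sum_eq H_eq ..
  note rem_bop = K[folded rem]
  have near: "\<forall>\<^sub>F \<kappa> in at 0 within {\<kappa>. Re \<kappa> > 0}. 0 < Re \<kappa> \<and> cmod \<kappa> < \<delta>"
    unfolding eventually_at by (intro exI[of _ \<delta>]) (use \<delta> in \<open>auto simp: dist_norm\<close>)
  have Bs_I: "F \<in> Bs (real t)" if "bop (L1 n) (Linf n) C F" "n \<le> t" for F :: "('k, 'r) gop" and C n t
    unfolding Bs_def by (rule bop_imp_bounded_ops[OF bop_ell1_ellinf_mono[OF that]])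
  \<comment> \<open>The regular coefficients already act at weight \<open>j + 1\<close>, and P at
    weight 1; monotonicity in the weight gives the classes claimed for even and odd indices.\<close>
  have G_Bs: "G j \<in> Bs (of_int (j + 3))" "odd j \<longrightarrow> G j \<in> Bs (of_int (j + 2))" if j: "j \<in> {-2..\<beta> - 6}" for j
  proof -
    have "j = -2 \<or> j = -1 \<or> 0 \<le> j" using j by auto
    then consider "j = -2" | "j = -1" | n where "j = int n" by (metis nonneg_int_cases)
    then have "G j \<in> Bs (of_int (j + 3)) \<and> (odd j \<longrightarrow> G j \<in> Bs (of_int (j + 2)))"
    proof cases
      case 1
      obtain C where "bop (L1 1) (Linf 1) C (ket_bra_sum B)" using tb.P_bop by blast
      from Bs_I[OF this, of 1] show ?thesis using 1 by (simp add: G_def)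
    next
      case 2
      have "bop (L1 1) (Linf 1) 0 (\<lambda>u x. 0 :: complex)"
        by (rule bop_zero[OF quasi_normed_ellinf]) (use zero_in_ellinf in blast)
      from Bs_I[OF this, of 1] Bs_I[OF this, of 2] show ?thesis using 2 by (simp add: G_def)
    next
      case (3 n)
      then have "Suc n \<le> s" using j beta by (auto simp: s_def)
      then obtain C where C: "bop (L1 (Suc n)) (Linf (Suc n)) C (\<Gamma> n)" using \<Gamma> by blast
      from Bs_I[OF C, of "n + 3"] Bs_I[OF C, of "n + 2"] show ?thesis using 3 by (simp add: G_def add.commute)
    qed
    then show "G j \<in> Bs (of_int (j + 3))" "odd j \<longrightarrow> G j \<in> Bs (of_int (j + 2))" by auto
  qed
  have bigo: "(\<lambda>\<kappa>. Bs_norm (of_int (\<beta> - 2)) (expansion_remainder H G (-2) (\<beta> - 6) \<kappa>))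
       \<in> O[at 0 within {\<kappa>. Re \<kappa> > 0}](\<lambda>\<kappa>. cmod \<kappa> powi (\<beta> - 5))"
  proof (rule bigoI[where c="\<bar>K\<bar>"], rule eventually_mono[OF near])
    fix \<kappa> :: complex assume \<kappa>: "0 < Re \<kappa> \<and> cmod \<kappa> < \<delta>"
    then have pos: "0 < cmod \<kappa>" "cmod \<kappa> \<le> 1" using \<delta> by auto
    note op = op_norm_bop[OF rem_bop quasi_normed_ell1 zero_in_ell1 quasi_normed_ellinf, of \<kappa>]
    \<comment> \<open>Equality for \<beta> \<ge> 5. For \<beta> = 4 the remainder is bounded, while
      the claim allows growth like the inverse of \<open>cmod \<kappa>\<close>.\<close>
    have "cmod \<kappa> ^ M \<le> cmod \<kappa> powi (\<beta> - 5)"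
    proof (cases "5 \<le> \<beta>")
      case True
      then have "\<beta> - 5 = int M" by (simp add: M_def)
      then show ?thesis by simp
    next
      case False
      then have "\<beta> - 5 = -1" "M = 0" using beta by (auto simp: M_def)
      then show ?thesis using pos by (simp add: power_int_minus one_le_inverse)
    qed
    then have "\<bar>K\<bar> * cmod \<kappa> ^ M \<le> \<bar>K\<bar> * (cmod \<kappa> powi (\<beta> - 5))" by (rule mult_left_mono) simp
    moreover have "K * cmod \<kappa> ^ M \<le> \<bar>K\<bar> * cmod \<kappa> ^ M" by (rule mult_right_mono) auto
    moreover have "\<bar>cmod \<kappa> powi (\<beta> - 5)\<bar> = cmod \<kappa> powi (\<beta> - 5)" by simp
    ultimately show "norm (Bs_norm (of_int (\<beta> - 2)) (expansion_remainder H G (-2) (\<beta> - 6) \<kappa>))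
        \<le> \<bar>K\<bar> * norm (cmod \<kappa> powi (\<beta> - 5))"
      using op \<kappa> unfolding Bs_norm_def \<beta>(2) real_norm_def by linarith
  qed
  have bound: "equals_projection 1 (orthonormal_bound_basis (of_int \<beta>) H) (G (-2))"
    unfolding equals_projection_def \<beta>(1) H_eq th.orthonormal_bound_basis_iff
  proof (intro conjI exI[of _ B] allI impI ballI B)
    fix B' and u :: "('k, 'r) gfun"
    assume B': "th.orthonormal B' \<and> (\<forall>\<Psi>\<in>th.bound_space. \<Psi> = (\<lambda>x. \<Sum>\<Phi>\<in>B'. pairing \<Phi> \<Psi> * \<Phi> x))"
      and "u \<in> fset (ell1 1)"
    then have "u \<in> fset (L1 1)" by simp
    from th.ket_bra_sum_unique[OF B conjunct1[OF B'] conjunct2[OF B'] this]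
    show "G (-2) u = ket_bra_sum B' u" by (simp add: G_def)
  qed (rule bspec[OF B(2)])
  have G_nonzero: "\<exists>u\<in>fset (ell1 1). G (-2) u \<noteq> (\<lambda>x. 0)"
  proof -
    obtain \<Psi> where \<Psi>: "\<Psi> \<in> th.bound_space" "\<Psi> \<noteq> (\<lambda>x. 0)" using nonzero by blast
    have "\<Psi> \<in> fset (L1 1)" by (rule bopD(2)[OF bop_id_ell1 th.bound_space_X[OF \<Psi>(1)]]) (use s in simp)
    moreover have "G (-2) \<Psi> = \<Psi>" using B(2) \<Psi>(1) by (simp add: G_def ket_bra_sum_def fun_eq_iff)
    ultimately show ?thesis using \<Psi>(2) by (metis of_nat_1)
  qed
  have resonance: "equals_projection 1 (orthonormal_resonance_basis (of_int \<beta>) H) (\<lambda>u x. 0)"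
  proof -
    \<comment> \<open>When the resonance and bound spaces coincide the quotient is trivial. The
      combination with all coefficients 1 lies in the smaller space, so independence leaves no room
      for an element, and the resonance projection is 0.\<close>
    have empty: "B' = {}" if "basis_mod th.bound_space th.bound_space B'" for B'
    proof (rule ccontr)
      assume "B' \<noteq> {}"
      then obtain \<Phi> where \<Phi>: "\<Phi> \<in> B'" by blast
      have sum: "(\<lambda>x. \<Sum>\<Phi>\<in>B'. 1 * \<Phi> x) \<in> th.bound_space"
        by (rule th.bound_space_sum) (use that in \<open>auto simp: basis_mod_def\<close>)
      have "\<forall>a. (\<lambda>x. \<Sum>\<Phi>\<in>B'. a \<Phi> * \<Phi> x) \<in> th.bound_space \<longrightarrow> (\<forall>\<Phi>\<in>B'. a \<Phi> = 0)"
        using that unfolding basis_mod_def by (elim conjE)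
      from spec[OF this, of "\<lambda>\<Phi>. 1"] sum \<Phi> show False by auto
    qed
    have "basis_mod th.bound_space th.bound_space {}"
      by (auto simp: basis_mod_def th.bound_space_zero)
    then have ex: "orthonormal_resonance_basis (real (s + 2)) th.H {}"
      unfolding orthonormal_resonance_basis_def res th.bound_space_def[symmetric] by simp
    have only: "B' = {}" if "orthonormal_resonance_basis (real (s + 2)) th.H B'" for B'
      using that unfolding orthonormal_resonance_basis_def res th.bound_space_def[symmetric] by (elim conjE) (rule empty)
    show ?thesis
      unfolding equals_projection_def \<beta>(1) H_eq
    proof (intro conjI exI[of _ "{}"] ex allI impI ballI)
      fix B' and u :: "('k, 'r) gfun" assume "orthonormal_resonance_basis (real (s + 2)) th.H B'"
      from only[OF this] show "(\<lambda>x. 0) = ket_bra_sum B' u" by (simp add: ket_bra_sum_def)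
    qed
  qed
  have resonance': "G (-1) = (\<lambda>u x. 0)" by (simp add: G_def)
  show ?thesis
  proof (intro exI[of _ G] conjI ballI impI)
    show "\<forall>\<^sub>F \<kappa> in at 0 within {\<kappa>. Re \<kappa> > 0}. - \<kappa>\<^sup>2 \<notin> spectrum_ell2 H \<and>
       expansion_remainder H G (-2) (\<beta> - 6) \<kappa> \<in> Bs (of_int (\<beta> - 2))"
    proof (rule eventually_mono[OF near])
      fix \<kappa> :: complex assume "0 < Re \<kappa> \<and> cmod \<kappa> < \<delta>"
      then show "- \<kappa>\<^sup>2 \<notin> spectrum_ell2 H \<and> expansion_remainder H G (-2) (\<beta> - 6) \<kappa> \<in> Bs (of_int (\<beta> - 2))"
        using spectrum[of \<kappa>] Bs_I[OF rem_bop order_refl, of \<kappa>] unfolding \<beta>(2) H_eq by blast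
    qed
  qed (use G_Bs bigo bound G_nonzero resonance resonance' in auto)
qed

end
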